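(* Let $(M,g,\mathcal{E})$ be an embedded ambient structure with Christoffel function $\Gamma$ and Levi-Civita connection $\nabla$. Let $\alpha:\mathbb{R}_{\ge0}\to\mathbb{R}_{>0}$ and $\beta:\mathbb{R}_{\ge0}\to\mathbb{R}_{\ge0}$ be smooth. Define $\hat g:TM\to L(\mathcal{E},\mathcal{E})$ by $$\hat g_{(x,v)}\omega=\alpha(\|v\|^2_{g,x})\,g_x\omega+\beta(\|v\|^2_{g,x})\,\langle v,\omega\rangle_{g,x}\,g_xv.$$ Then $\Pi_{g,x}$ is the projection to $T_xM$ corresponding to $\hat g_{(x,v)}$. The inverse of $\hat g$ is $$\hat g_{(x,v)}^{-1}\omega=\frac1{\alpha}g_x^{-1}\omega-\frac{\beta}{\alpha(\alpha+\beta\|v\|_{g,x}^2)}\langle v,\omega\rangle_{\mathcal{E}}\,v ,$$ with $\alpha,\beta$ evaluated at $\|v\|^2_{g,x}$. For three vector fields $X,Y,Z$ on $M$, $$D_{X^h}\langle Y\circ\pi,\hat g(Z\circ\pi)\rangle_{\mathcal{E}}=\langle\nabla_XY,\hat gZ\rangle_{\mathcal{E}}+\langle Y,\hat g\nabla_XZ\rangle_{\mathcal{E}}.$$ Let $G$ be the metric operator on $TM$ built from $g$ and $\hat g$. A Christoffel function $\Gamma_G$ of $G$ can be evaluated at tangent vectors $\tilde\xi=(\xi_m,\xi_t),\tilde\eta=(\eta_m,\eta_t)\in T_{(x,v)}TM$ as $$\Gamma_G(\tilde\xi,\tilde\eta)=\Gamma_G(\xi_m^h,\eta_m^h)+\Gamma_G(\xi_m^h,(C\tilde\eta)^{\mathrm{v}})+\Gamma_G((C\tilde\xi)^{\mathrm{v}},\eta_m^h)+\Gamma_G((C\tilde\xi)^{\mathrm{v}},(C\tilde\eta)^{\mathrm{v}}),$$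 $$\Gamma_G(\xi_m^h,\eta_m^h)=\big(\Gamma(\xi_m,\eta_m),-\Gamma(\Gamma(\xi_m,\eta_m),v)+(D_{\xi_m}\Gamma)(\eta_m,v)-\Gamma(\eta_m,\Gamma(\xi_m,v))+\tfrac12R_{\xi_m,\eta_m}v\big),$$ $$\Gamma_G(\xi_m^h,(C\tilde\eta)^{\mathrm{v}})=\big(-\tfrac\alpha2R_{v,C\tilde\eta}\xi_m,\ \tfrac\alpha2\Gamma(R_{v,C\tilde\eta}\xi_m,v)+\Gamma(\xi_m,C\tilde\eta)\big),$$ $$\Gamma_G((C\tilde\xi)^{\mathrm{v}},\eta_m^h)=\big(-\tfrac\alpha2R_{v,C\tilde\xi}\eta_m,\ \tfrac\alpha2\Gamma(R_{v,C\tilde\xi}\eta_m,v)+\Gamma(C\tilde\xi,\eta_m)\big),$$ $$\Gamma_G((C\tilde\xi)^{\mathrm{v}},(C\tilde\eta)^{\mathrm{v}})=\big(0,\ \tfrac{\alpha'}{\alpha}\{\langle v,gC\tilde\eta\rangle_{\mathcal{E}}C\tilde\xi+\langle v,gC\tilde\xi\rangle_{\mathcal{E}}C\tilde\eta\}+F v\big),$$ where $\Gamma$, its directional derivatives, $R$ and $g$ are evaluated at $x$, $C$ at $(x,v)$, the functions $\alpha,\alpha',\beta,\beta'$ at $\|v\|_g^2$, and $$F=(\alpha+\|v\|_g^2\beta)^{-1}\Big\{(\beta-\alpha')\langle C\tilde\xi,C\tilde\eta\rangle_g+\big(\beta'-2\tfrac{\alpha'}{\alpha}\beta\big)\langle v,C\tilde\xi\rangle_g\langle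 v,C\tilde\eta\rangle_g\Big\}.$$
   Context: $\mathcal{E}$ is a finite-dimensional inner product space. An embedded ambient structure $(M,g,\mathcal{E})$ is a Riemannian manifold $M$ differentiably embedded in $\mathcal{E}$ with a metric operator $g$: a smooth map $M\to L(\mathcal{E},\mathcal{E})$, each $g_x$ self-adjoint positive-definite, with $\langle\xi,g_x\eta\rangle_{\mathcal{E}}$ the Riemannian inner product of $\xi,\eta\in T_xM\subset\mathcal{E}$. $\langle a,b\rangle_{g,x}=\langle a,g_xb\rangle_{\mathcal{E}}$, with norm $\|\cdot\|_{g,x}$. The projection to $T_xM$ corresponding to a positive-definite operator $h$ is the one orthogonal for $\langle\cdot,h\cdot\rangle_{\mathcal{E}}$; $\Pi_{g,x}$ is the one for $g_x$. A Christoffel function is a smooth $\Gamma:M\to L(\mathcal{E}\otimes\mathcal{E},\mathcal{E})$ with $\nabla_XY=D_XY+\Gamma(X,Y)$ for vector fields (as $\mathcal{E}$-valued functions), $D$ directional derivative; $(D_\xi\Gamma)(\eta,v)$ is the derivative of $\Gamma$ with $\eta,v$ held fixed. $TM\subset\mathcal{E}^2$, $T_{(x,v)}TM\subset\mathcal{E}^2$, $\pi:TM\to M$ is the bundle projection. For $\delta\in T_xM$: the horizontal lift to $(x,v)$ is $\delta^h=(\delta,-\Gamma(\delta,v)_x)$ and the vertical lift is $\delta^{\mathrm{v}}=(0,\delta)$; likewise for vector fields. The connection map is $C_{(x,v)}\tilde\xi=\xi_t+\Gamma(\xi_m,v)_x\in T_xM$ for $\tilde\xi=(\xi_m,\xi_t)\in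 T_{(x,v)}TM$. The metric operator $G:TM\to L(\mathcal{E}^2,\mathcal{E}^2)$ is $G_{(x,v)}=\begin{bmatrix}I&\Gamma^T[v]_x\\0&I\end{bmatrix}\begin{bmatrix}g_x&0\\0&\hat g_{(x,v)}\end{bmatrix}\begin{bmatrix}I&0\\\Gamma[v]_x&I\end{bmatrix}$ with $\Gamma[v]_x\omega=\Gamma(\omega,v)_x$ and $\Gamma^T[v]_x$ its adjoint; a Christoffel function of $G$ is defined as for $g$, with $(TM,G,\mathcal{E}^2)$ in place of $(M,g,\mathcal{E})$. Curvature sign convention: $R_{X,Y}Z=\nabla_{[X,Y]}Z-\nabla_X\nabla_YZ+\nabla_Y\nabla_XZ$. *)

theory Defs
  imports "HOL-Analysis.Analysis"
begin

section \<open>Smooth maps on subsets of a Euclidean space\<close>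

primrec Ck_on :: "nat \<Rightarrow> 'a::real_normed_vector set \<Rightarrow> ('a \<Rightarrow> 'b::real_normed_vector) \<Rightarrow> bool" where
  "Ck_on 0 U f \<longleftrightarrow> continuous_on U f"
| "Ck_on (Suc k) U f \<longleftrightarrow>
     (\<forall>x\<in>U. f differentiable (at x)) \<and> (\<forall>v. Ck_on k U (\<lambda>x. frechet_derivative f (at x) v))"

text \<open>A map on an arbitrary subset is smooth if it locally extends to a smooth map on an open set of
  the ambient space. On an embedded submanifold this is smoothness in charts; on the closed half line
  it is smoothness with one-sided derivatives at the end point.\<close>

definition smooth_on :: "'a::real_normed_vector set \<Rightarrow> ('a \<Rightarrow> 'b::real_normed_vector) \<Rightarrow> bool" where
  "smooth_on S f \<longleftrightarrow>
     (\<forall>x\<in>S. \<exists>U F. open U \<and> x \<in> U \<and> (\<forall>k. Ck_on k U F) \<and> (\<forall>y\<in>S \<inter> U. F y = f y))"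

section \<open>Embedded submanifolds, tangent spaces and vector fields\<close>

definition embedded_submanifold :: "'a::euclidean_space set \<Rightarrow> bool" where
  "embedded_submanifold M \<longleftrightarrow>
     (\<exists>d. \<forall>x\<in>M. \<exists>U V S \<phi> \<psi>. open U \<and> x \<in> U \<and> open V \<and>
        homeomorphism U V \<phi> \<psi> \<and> smooth_on U \<phi> \<and> smooth_on V \<psi> \<and>
        subspace (S :: 'a set) \<and> dim S = d \<and> \<phi> ` (U \<inter> M) = V \<inter> S)"

definition tangent_space :: "'a::euclidean_space set \<Rightarrow> 'a \<Rightarrow> 'a set" where
  "tangent_space M x =
     {\<xi>. \<exists>c e. 0 < e \<and> smooth_on {-e<..<e} c \<and> c ` {-e<..<e} \<subseteq> M \<and> c (0::real) = x \<and>
            (c has_vector_derivative \<xi>) (at 0)}"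

definition tangent_bundle :: "'a::euclidean_space set \<Rightarrow> ('a \<times> 'a) set" where
  "tangent_bundle M = Sigma M (tangent_space M)"

text \<open>Vector fields are represented by ambient functions; their values off \<open>M\<close> are irrelevant.\<close>

definition vector_fields :: "'a::euclidean_space set \<Rightarrow> ('a \<Rightarrow> 'a) set" where
  "vector_fields M = {X. smooth_on M X \<and> (\<forall>x\<in>M. X x \<in> tangent_space M x)}"

text \<open>Directional derivative at \<open>x\<close>, for \<open>\<xi>\<close> tangent to \<open>M\<close>. A derivative within \<open>M\<close> is not unique as a
  linear map on the ambient space, but any two of them agree on tangent vectors, where they give
  the derivative along a curve in \<open>M\<close> with velocity \<open>\<xi>\<close>.\<close>

definition dir_deriv ::
  "'a::euclidean_space set \<Rightarrow> ('a \<Rightarrow> 'b::real_normed_vector) \<Rightarrow> 'a \<Rightarrow> 'a \<Rightarrow> 'b" where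
  "dir_deriv M f x \<xi> = frechet_derivative f (at x within M) \<xi>"

definition lie_bracket :: "'a::euclidean_space set \<Rightarrow> ('a \<Rightarrow> 'a) \<Rightarrow> ('a \<Rightarrow> 'a) \<Rightarrow> 'a \<Rightarrow> 'a" where
  "lie_bracket M X Y = (\<lambda>x. dir_deriv M Y x (X x) - dir_deriv M X x (Y x))"

section \<open>Metric operators and projections\<close>

definition self_adjoint_pos_def :: "('a::euclidean_space \<Rightarrow>\<^sub>L 'a) \<Rightarrow> bool" where
  "self_adjoint_pos_def h \<longleftrightarrow>
     (\<forall>\<xi> \<eta>. h \<xi> \<bullet> \<eta> = \<xi> \<bullet> h \<eta>) \<and> (\<forall>\<xi>. \<xi> \<noteq> 0 \<longrightarrow> 0 < \<xi> \<bullet> h \<xi>)"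

definition embedded_ambient_structure ::
  "'a::euclidean_space set \<Rightarrow> ('a \<Rightarrow> 'a \<Rightarrow>\<^sub>L 'a) \<Rightarrow> bool" where
  "embedded_ambient_structure M g \<longleftrightarrow>
     embedded_submanifold M \<and> smooth_on M g \<and> (\<forall>x\<in>M. self_adjoint_pos_def (g x))"

definition is_metric_projection ::
  "('a::euclidean_space \<Rightarrow>\<^sub>L 'a) \<Rightarrow> 'a set \<Rightarrow> ('a \<Rightarrow> 'a) \<Rightarrow> bool" where
  "is_metric_projection h T P \<longleftrightarrow>
     linear P \<and> (\<forall>\<omega>. P \<omega> \<in> T \<and> (\<forall>t\<in>T. t \<bullet> h (\<omega> - P \<omega>) = 0))"

definition metric_projection :: "('a::euclidean_space \<Rightarrow>\<^sub>L 'a) \<Rightarrow> 'a set \<Rightarrow> 'a \<Rightarrow> 'a" where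
  "metric_projection h T = (THE P. is_metric_projection h T P)"

section \<open>Levi-Civita connection, Christoffel functions, curvature\<close>

definition affine_connection ::
  "'a::euclidean_space set \<Rightarrow> (('a \<Rightarrow> 'a) \<Rightarrow> ('a \<Rightarrow> 'a) \<Rightarrow> ('a \<Rightarrow> 'a)) \<Rightarrow> bool" where
  "affine_connection M N \<longleftrightarrow>
     (\<forall>X\<in>vector_fields M. \<forall>Y\<in>vector_fields M. N X Y \<in> vector_fields M) \<and>
     (\<forall>X\<in>vector_fields M. \<forall>X'\<in>vector_fields M. \<forall>Y\<in>vector_fields M. \<forall>x\<in>M.
        N (\<lambda>y. X y + X' y) Y x = N X Y x + N X' Y x) \<and>
     (\<forall>X\<in>vector_fields M. \<forall>Y\<in>vector_fields M. \<forall>Y'\<in>vector_fields M. \<forall>x\<in>M.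
        N X (\<lambda>y. Y y + Y' y) x = N X Y x + N X Y' x) \<and>
     (\<forall>f::'a \<Rightarrow> real. smooth_on M f \<longrightarrow>
        (\<forall>X\<in>vector_fields M. \<forall>Y\<in>vector_fields M. \<forall>x\<in>M.
           N (\<lambda>y. f y *\<^sub>R X y) Y x = f x *\<^sub>R N X Y x \<and>
           N X (\<lambda>y. f y *\<^sub>R Y y) x = dir_deriv M f x (X x) *\<^sub>R Y x + f x *\<^sub>R N X Y x))"

definition levi_civita_connection ::
  "'a::euclidean_space set \<Rightarrow> ('a \<Rightarrow> 'a \<Rightarrow>\<^sub>L 'a) \<Rightarrow>
   (('a \<Rightarrow> 'a) \<Rightarrow> ('a \<Rightarrow> 'a) \<Rightarrow> ('a \<Rightarrow> 'a)) \<Rightarrow> bool" where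
  "levi_civita_connection M g N \<longleftrightarrow>
     affine_connection M N \<and>
     (\<forall>X\<in>vector_fields M. \<forall>Y\<in>vector_fields M. \<forall>Z\<in>vector_fields M. \<forall>x\<in>M.
        dir_deriv M (\<lambda>y. Y y \<bullet> g y (Z y)) x (X x)
          = N X Y x \<bullet> g x (Z x) + Y x \<bullet> g x (N X Z x)) \<and>
     (\<forall>X\<in>vector_fields M. \<forall>Y\<in>vector_fields M. \<forall>x\<in>M.
        N X Y x - N Y X x = lie_bracket M X Y x)"

text \<open>Bilinear maps are curried: \<open>\<Gamma> x \<xi> \<eta>\<close> is the value of the Christoffel function at \<open>x\<close> on
  \<open>(\<xi>, \<eta>)\<close>, for arbitrary (not only tangent) \<open>\<xi>\<close> and \<open>\<eta>\<close>.\<close>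

definition christoffel_function ::
  "'a::euclidean_space set \<Rightarrow> (('a \<Rightarrow> 'a) \<Rightarrow> ('a \<Rightarrow> 'a) \<Rightarrow> ('a \<Rightarrow> 'a)) \<Rightarrow>
   ('a \<Rightarrow> 'a \<Rightarrow>\<^sub>L 'a \<Rightarrow>\<^sub>L 'a) \<Rightarrow> bool" where
  "christoffel_function M N \<Gamma> \<longleftrightarrow>
     smooth_on M \<Gamma> \<and>
     (\<forall>X\<in>vector_fields M. \<forall>Y\<in>vector_fields M. \<forall>x\<in>M.
        N X Y x = dir_deriv M Y x (X x) + \<Gamma> x (X x) (Y x))"

text \<open>The curvature tensor on tangent vectors at a point: the common value obtained from all
  extensions to vector fields. Its sign is opposite to the more common one.\<close>

definition curvature ::
  "'a::euclidean_space set \<Rightarrow> (('a \<Rightarrow> 'a) \<Rightarrow> ('a \<Rightarrow> 'a) \<Rightarrow> ('a \<Rightarrow> 'a)) \<Rightarrow>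
   'a \<Rightarrow> 'a \<Rightarrow> 'a \<Rightarrow> 'a \<Rightarrow> 'a" where
  "curvature M N x \<xi> \<eta> \<zeta> =
     (THE r. \<exists>X\<in>vector_fields M. \<exists>Y\<in>vector_fields M. \<exists>Z\<in>vector_fields M.
        X x = \<xi> \<and> Y x = \<eta> \<and> Z x = \<zeta> \<and>
        r = N (lie_bracket M X Y) Z x - N X (N Y Z) x + N Y (N X Z) x)"

section \<open>Lifts and metric operators on the tangent bundle\<close>

definition horizontal_lift ::
  "('a::euclidean_space \<Rightarrow> 'a \<Rightarrow>\<^sub>L 'a \<Rightarrow>\<^sub>L 'a) \<Rightarrow> 'a \<times> 'a \<Rightarrow> 'a \<Rightarrow> 'a \<times> 'a" where
  "horizontal_lift \<Gamma> p \<delta> = (\<delta>, - \<Gamma> (fst p) \<delta> (snd p))"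

definition vertical_lift :: "'a::euclidean_space \<Rightarrow> 'a \<times> 'a" where
  "vertical_lift \<delta> = (0, \<delta>)"

definition connection_map ::
  "('a::euclidean_space \<Rightarrow> 'a \<Rightarrow>\<^sub>L 'a \<Rightarrow>\<^sub>L 'a) \<Rightarrow> 'a \<times> 'a \<Rightarrow> 'a \<times> 'a \<Rightarrow> 'a" where
  "connection_map \<Gamma> p \<xi> = snd \<xi> + \<Gamma> (fst p) (fst \<xi>) (snd p)"

definition norm_sq :: "('a::euclidean_space \<Rightarrow> 'a \<Rightarrow>\<^sub>L 'a) \<Rightarrow> 'a \<times> 'a \<Rightarrow> real" where
  "norm_sq g p = snd p \<bullet> g (fst p) (snd p)"

definition ghat ::
  "('a::euclidean_space \<Rightarrow> 'a \<Rightarrow>\<^sub>L 'a) \<Rightarrow> (real \<Rightarrow> real) \<Rightarrow> (real \<Rightarrow> real) \<Rightarrow>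
   'a \<times> 'a \<Rightarrow> 'a \<Rightarrow>\<^sub>L 'a" where
  "ghat g \<alpha> \<beta> = (\<lambda>(x, v). Blinfun (\<lambda>\<omega>.
     \<alpha> (norm_sq g (x, v)) *\<^sub>R g x \<omega> + (\<beta> (norm_sq g (x, v)) * (v \<bullet> g x \<omega>)) *\<^sub>R g x v))"

lemma ghat_apply:
  "ghat g \<alpha> \<beta> (x, v) \<omega> =
     \<alpha> (norm_sq g (x, v)) *\<^sub>R g x \<omega> + (\<beta> (norm_sq g (x, v)) * (v \<bullet> g x \<omega>)) *\<^sub>R g x v"
  unfolding ghat_def prod.case
  by (subst bounded_linear_Blinfun_apply) (auto intro!: bounded_linear_intros)

definition block_operator ::
  "('a::euclidean_space \<Rightarrow>\<^sub>L 'a) \<Rightarrow> ('a \<Rightarrow>\<^sub>L 'a) \<Rightarrow> ('a \<Rightarrow>\<^sub>L 'a) \<Rightarrow> ('a \<Rightarrow>\<^sub>L 'a) \<Rightarrow>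
   ('a \<times> 'a) \<Rightarrow>\<^sub>L ('a \<times> 'a)" where
  "block_operator A B C D = Blinfun (\<lambda>\<omega>. (A (fst \<omega>) + B (snd \<omega>), C (fst \<omega>) + D (snd \<omega>)))"

lemma block_operator_apply:
  "block_operator A B C D \<omega> = (A (fst \<omega>) + B (snd \<omega>), C (fst \<omega>) + D (snd \<omega>))"
  unfolding block_operator_def
  by (subst bounded_linear_Blinfun_apply) (auto intro!: bounded_linear_intros)

text \<open>\<open>\<Gamma>\<close> at \<open>x\<close> with its second argument fixed to \<open>v\<close>.\<close>

definition christoffel_at ::
  "('a::euclidean_space \<Rightarrow> 'a \<Rightarrow>\<^sub>L 'a \<Rightarrow>\<^sub>L 'a) \<Rightarrow> 'a \<times> 'a \<Rightarrow> 'a \<Rightarrow>\<^sub>L 'a" where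
  "christoffel_at \<Gamma> = (\<lambda>(x, v). Blinfun (\<lambda>\<omega>. \<Gamma> x \<omega> v))"

lemma christoffel_at_apply: "christoffel_at \<Gamma> (x, v) \<omega> = \<Gamma> x \<omega> v"
  unfolding christoffel_at_def prod.case
  by (subst bounded_linear_Blinfun_apply) (auto intro!: bounded_linear_intros)

definition adjoint_operator :: "('a::euclidean_space \<Rightarrow>\<^sub>L 'a) \<Rightarrow> 'a \<Rightarrow>\<^sub>L 'a" where
  "adjoint_operator A = Blinfun (adjoint (blinfun_apply A))"

lemma adjoint_operator_apply: "\<xi> \<bullet> adjoint_operator A \<eta> = A \<xi> \<bullet> \<eta>"
proof -
  have lin: "linear (blinfun_apply A)"
    by (rule bounded_linear.linear[OF blinfun.bounded_linear_right])
  have "bounded_linear (adjoint (blinfun_apply A))"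
    by (simp add: adjoint_linear[OF lin] linear_conv_bounded_linear[symmetric])
  then show ?thesis
    by (simp add: adjoint_operator_def bounded_linear_Blinfun_apply adjoint_works[OF lin])
qed

definition tangent_bundle_metric ::
  "('a::euclidean_space \<Rightarrow> 'a \<Rightarrow>\<^sub>L 'a \<Rightarrow>\<^sub>L 'a) \<Rightarrow> ('a \<Rightarrow> 'a \<Rightarrow>\<^sub>L 'a) \<Rightarrow> ('a \<times> 'a \<Rightarrow> 'a \<Rightarrow>\<^sub>L 'a) \<Rightarrow>
   'a \<times> 'a \<Rightarrow> ('a \<times> 'a) \<Rightarrow>\<^sub>L ('a \<times> 'a)" where
  "tangent_bundle_metric \<Gamma> g h p =
     block_operator id_blinfun (adjoint_operator (christoffel_at \<Gamma> p)) 0 id_blinfun o\<^sub>L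
     block_operator (g (fst p)) 0 0 (h p) o\<^sub>L
     block_operator id_blinfun 0 (christoffel_at \<Gamma> p) id_blinfun"

end

theory Submission
  imports Defs
begin

text \<open>
  The statements about the operator \<open>ghat g \<alpha> \<beta>\<close> are linear algebra: it differs from the multiple \<open>\<alpha> g\<close> of \<open>g\<close> by
  a nonnegative rank-one operator with range spanned by \<open>g v\<close>, so it is positive definite, its inverse is a
  rank-one correction of \<open>g\<^sup>-\<^sup>1\<close>, and as \<open>v\<close> is tangent it has the same normal vectors to the tangent space as \<open>g\<close>.

  The heart of the matter is that the values of a Christoffel function on tangent vectors at one point are determined
  by three conditions at that point: symmetry, compatibility with the derivative of the metric, and tangency of
  \<open>D\<^sub>\<xi> Y + \<Gamma>(\<xi>, Y)\<close> (\<open>levi_civita_form\<close>, \<open>levi_civita_form_unique\<close>; the argument is that of the Koszul formula).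
  It suffices to test them on one extension of each tangent vector to a vector field
  (\<open>levi_civita_formI\<close>). Conversely a smooth family of such forms defines a Levi-Civita connection. A family of this
  kind exists on every embedded ambient structure (\<open>levi_civita_connection_exists\<close>): the projection \<open>P\<close> to the
  tangent spaces is smooth, and \<open>- (D\<^sub>\<xi> P) \<eta> + P g\<^sup>-\<^sup>1 K(\<xi>, \<eta>)\<close>, with the Koszul term \<open>K\<close>, is
  one. Its symmetry is the symmetry of the second derivatives of a parametrization.

  All of this is applied twice, to \<open>(M, g)\<close> and to the tangent bundle with the metric \<open>G\<close>. The bundle is again an
  embedded submanifold, with tangent vectors at \<open>(x, v)\<close> the pairs \<open>(\<delta>, \<tau>)\<close> such that \<open>\<delta>\<close> and \<open>\<tau> + \<Gamma>(\<delta>, v)\<close> are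
  tangent to \<open>M\<close> (\<open>tangent_bundle_tangent_iff\<close>). Every such pair is the sum of a horizontal and a vertical
  lift, and it extends to a sum of lifted vector fields; \<open>G\<close> is block diagonal on these. The stated formula for
  \<open>\<Gamma>\<^sub>G\<close> then satisfies the three conditions (\<open>bundle_christoffel_form\<close>):

  \<^item> Symmetry: the alternating part of \<open>(D\<^sub>\<xi> \<Gamma>)(\<eta>, v) - \<Gamma>(\<eta>, \<Gamma>(\<xi>, v))\<close> is \<open>- R\<^bsub>\<xi>,\<eta>\<^esub> v / 2\<close>.

  \<^item> Compatibility: the terms with \<open>\<alpha>'\<close>, \<open>\<beta>\<close> and \<open>\<beta>'\<close> balance the derivative of \<open>ghat g \<alpha> \<beta>\<close> along the fibre
    (\<open>vertical_part_metric\<close>). The curvature terms cancel by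
    \<open>\<langle>R\<^bsub>a,b\<^esub> c, d\<rangle> = \<langle>R\<^bsub>c,d\<^esub> a, b\<rangle>\<close> and the skew-symmetry in \<open>c\<close> and \<open>d\<close>, and they see only the part \<open>\<alpha> g\<close> of
    \<open>ghat g \<alpha> \<beta>\<close>, because \<open>R\<^bsub>\<xi>,\<eta>\<^esub> v\<close> is orthogonal to \<open>v\<close>.

  \<^item> Tangency: the remaining terms are, up to tangent vectors, exactly what the derivative of a lifted field produces.

  By uniqueness every Christoffel function of \<open>G\<close> is given by this formula on tangent vectors.
\<close>

section \<open>Calculus of smooth maps\<close>

lemma Ck_on_SucD: "Ck_on (Suc k) U f \<Longrightarrow> Ck_on k U f"
proof (induction k arbitrary: f)
  case 0
  then show ?case
    by (auto intro!: continuous_at_imp_continuous_on differentiable_imp_continuous_within)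
next
  case (Suc k)
  then show ?case by (metis Ck_on.simps(2))
qed

lemma Ck_on_subset: "Ck_on k U f \<Longrightarrow> V \<subseteq> U \<Longrightarrow> Ck_on k V f"
  by (induction k arbitrary: f) (auto intro: continuous_on_subset)

lemma Ck_on_cong:
  assumes "open U" "\<And>x. x \<in> U \<Longrightarrow> f x = g x" "Ck_on k U f"
  shows "Ck_on k U g"
  using assms(2,3)
proof (induction k arbitrary: f g)
  case 0
  then show ?case by (simp cong: continuous_on_cong)
next
  case (Suc k)
  have d: "f differentiable (at x)" if "x \<in> U" for x using Suc.prems that by simp
  have d': "g differentiable (at x)" if "x \<in> U" for x
    unfolding differentiable_def
    using has_derivative_transform_within_open[OF d[OF that, unfolded frechet_derivative_works] assms(1) that Suc.prems(1)]
    by blast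
  have e: "frechet_derivative f (at x) = frechet_derivative g (at x)" if "x \<in> U" for x
    by (rule frechet_derivative_transform_within_open[OF d[OF that] assms(1) that Suc.prems(1)])
  have "Ck_on k U (\<lambda>x. frechet_derivative g (at x) v)" for v
    by (rule Suc.IH[of "\<lambda>x. frechet_derivative f (at x) v"]) (use e Suc.prems in auto)
  then show ?case using d' by simp
qed

lemma Ck_on_local:
  assumes "\<And>x. x \<in> U \<Longrightarrow> \<exists>V. open V \<and> x \<in> V \<and> Ck_on k V f"
  shows "Ck_on k U f"
  using assms
proof (induction k arbitrary: f)
  case 0
  show ?case unfolding Ck_on.simps
  proof (rule continuous_at_imp_continuous_on, rule ballI)
    fix x assume "x \<in> U"
    then obtain V where "open V" "x \<in> V" "Ck_on 0 V f" using 0 by blast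
    then show "isCont f x" by (simp add: continuous_on_eq_continuous_at)
  qed
next
  case (Suc k)
  have "\<exists>V. open V \<and> x \<in> V \<and> Ck_on k V (\<lambda>x. frechet_derivative f (at x) v)" if "x \<in> U" for x v
    using Suc.prems[OF that] by auto
  then have "Ck_on k U (\<lambda>x. frechet_derivative f (at x) v)" for v by (rule Suc.IH)
  moreover have "f differentiable (at x)" if "x \<in> U" for x
    using Suc.prems[OF that] by auto
  ultimately show ?case by simp
qed

lemma Ck_on_has_derivative:
  "Ck_on (Suc k) U f \<Longrightarrow> x \<in> U \<Longrightarrow> (f has_derivative frechet_derivative f (at x)) (at x)"
  by (simp add: frechet_derivative_works[symmetric])

lemma Ck_on_const: "Ck_on k U (\<lambda>x. c)"
  by (induction k arbitrary: c) (auto simp: frechet_derivative_const)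

lemma Ck_on_add:
  assumes "open U" "Ck_on k U f" "Ck_on k U g"
  shows "Ck_on k U (\<lambda>x. f x + g x)"
  using assms(2,3)
proof (induction k arbitrary: f g)
  case 0
  then show ?case by (auto intro: continuous_intros)
next
  case (Suc k)
  have e: "frechet_derivative (\<lambda>x. f x + g x) (at x) =
      (\<lambda>v. frechet_derivative f (at x) v + frechet_derivative g (at x) v)" if "x \<in> U" for x
    by (rule frechet_derivative_at[symmetric], rule has_derivative_add)
       (rule Ck_on_has_derivative, rule Suc.prems, rule that)+
  have "Ck_on k U (\<lambda>x. frechet_derivative (\<lambda>x. f x + g x) (at x) v)" for v
    by (rule Ck_on_cong[OF assms(1) _ Suc.IH]) (use e Suc.prems in auto)
  then show ?case using Suc.prems by (auto intro: differentiable_add)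
qed

lemma (in bounded_linear) Ck_on:
  assumes "open U" "Ck_on k U g"
  shows "Ck_on k U (\<lambda>x. f (g x))"
  using assms(2)
proof (induction k arbitrary: g)
  case 0
  then show ?case by (auto intro: continuous_on)
next
  case (Suc k)
  have D: "((\<lambda>x. f (g x)) has_derivative (\<lambda>v. f (frechet_derivative g (at x) v))) (at x)"
    if "x \<in> U" for x
    by (rule has_derivative) (rule Ck_on_has_derivative, rule Suc.prems, rule that)+
  have "Ck_on k U (\<lambda>x. frechet_derivative (\<lambda>x. f (g x)) (at x) v)" for v
    by (rule Ck_on_cong[OF assms(1) _ Suc.IH])
      (use frechet_derivative_at[OF D] Suc.prems in \<open>auto simp: fun_eq_iff\<close>)
  then show ?case using D by (auto simp: differentiable_def)
qed

lemma (in bounded_bilinear) Ck_on: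
  assumes "open U" "Ck_on k U f" "Ck_on k U g"
  shows "Ck_on k U (\<lambda>x. prod (f x) (g x))"
  using assms(2,3)
proof (induction k arbitrary: f g)
  case 0
  then show ?case by (auto intro: continuous_on)
next
  case (Suc k)
  have D: "((\<lambda>x. prod (f x) (g x)) has_derivative
      (\<lambda>v. prod (f x) (frechet_derivative g (at x) v) + prod (frechet_derivative f (at x) v) (g x))) (at x)"
    if "x \<in> U" for x
    by (rule FDERIV) (rule Ck_on_has_derivative, rule Suc.prems, rule that)+
  have "Ck_on k U f" "Ck_on k U g" using Suc.prems Ck_on_SucD by blast+
  then have "Ck_on k U (\<lambda>x. prod (f x) (frechet_derivative g (at x) v) + prod (frechet_derivative f (at x) v) (g x))" for v
    using Suc.prems by (intro Ck_on_add[OF assms(1)] Suc.IH) auto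
  then have "Ck_on k U (\<lambda>x. frechet_derivative (\<lambda>x. prod (f x) (g x)) (at x) v)" for v
    by (rule Ck_on_cong[OF assms(1), rotated])
      (use frechet_derivative_at[OF D] in \<open>auto simp: fun_eq_iff\<close>)
  then show ?case using D by (auto simp: differentiable_def)
qed

lemma Ck_on_ident: "Ck_on k U (\<lambda>x. x)"
  by (cases k) (auto simp: Ck_on_const)

lemma Ck_on_sum:
  assumes "open U" "\<And>i. i \<in> I \<Longrightarrow> Ck_on k U (f i)"
  shows "Ck_on k U (\<lambda>x. \<Sum>i\<in>I. f i x)"
  using assms(2) by (induction I rule: infinite_finite_induct) (auto simp: Ck_on_const intro: Ck_on_add[OF assms(1)])

lemmas blinfun_linear = bounded_linear.linear[OF blinfun.bounded_linear_right]

lemma linear_componentwise: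
  fixes f :: "'a::euclidean_space \<Rightarrow> 'b::real_vector"
  assumes "linear f"
  shows "f v = (\<Sum>e\<in>Basis. (v \<bullet> e) *\<^sub>R f e)"
proof -
  have "f v = f (\<Sum>e\<in>Basis. (v \<bullet> e) *\<^sub>R e)" by (simp add: euclidean_representation)
  then show ?thesis by (simp add: linear_sum[OF assms] linear_cmul[OF assms])
qed

text \<open>\<open>Ck_on\<close> differentiates in fixed directions, whereas in the chain rule the direction \<open>g' x v\<close> varies with the
  point. Expanding it in a basis reduces to fixed directions; hence the Euclidean intermediate space.\<close>

lemma Ck_on_compose:
  fixes g :: "'a::real_normed_vector \<Rightarrow> 'b::euclidean_space" and f :: "'b \<Rightarrow> 'c::real_normed_vector"
  assumes "open U" "open V" "g ` U \<subseteq> V" "Ck_on k V f" "Ck_on k U g"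
  shows "Ck_on k U (\<lambda>x. f (g x))"
  using assms(4,5)
proof (induction k arbitrary: f)
  case 0
  then show ?case using assms(3) by (auto intro: continuous_on_compose2)
next
  case (Suc k)
  have df: "(f has_derivative frechet_derivative f (at (g x))) (at (g x))" if "x \<in> U" for x
    by (rule Ck_on_has_derivative[OF Suc.prems(1)]) (use that assms(3) in blast)
  have dg: "(g has_derivative frechet_derivative g (at x)) (at x)" if "x \<in> U" for x
    by (rule Ck_on_has_derivative[OF Suc.prems(2) that])
  have D: "((\<lambda>x. f (g x)) has_derivative
      (\<lambda>v. frechet_derivative f (at (g x)) (frechet_derivative g (at x) v))) (at x)" if "x \<in> U" for x
    using has_derivative_compose[OF dg[OF that] df[OF that]] .
  have e: "frechet_derivative f (at (g x)) w = (\<Sum>e\<in>Basis. (w \<bullet> e) *\<^sub>R frechet_derivative f (at (g x)) e)"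
    if "x \<in> U" for x w
    by (rule linear_componentwise[OF has_derivative_linear[OF df[OF that]]])
  have "Ck_on k U (\<lambda>x. \<Sum>e\<in>Basis. (frechet_derivative g (at x) v \<bullet> e) *\<^sub>R frechet_derivative f (at (g x)) e)" for v
    using Suc.prems Ck_on_SucD[OF Suc.prems(2)]
    by (intro Ck_on_sum bounded_bilinear.Ck_on[OF bounded_bilinear_scaleR] assms(1)
        bounded_linear.Ck_on[OF bounded_linear_inner_left] Suc.IH) auto
  then have "Ck_on k U (\<lambda>x. frechet_derivative (\<lambda>x. f (g x)) (at x) v)" for v
    by (rule Ck_on_cong[OF assms(1), rotated])
      (use frechet_derivative_at[OF D] e in \<open>auto simp: fun_eq_iff\<close>)
  then show ?case using D by (auto simp: differentiable_def)
qed

text \<open>A product whose differentiable factor vanishes at \<open>x\<close> is differentiable there as soon as the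
  other factor is continuous. This gives the derivative of the operator inverse without first
  knowing that the inverse is differentiable.\<close>

lemma (in bounded_bilinear) has_derivative_vanishing_factor:
  assumes c: "isCont c x" and d: "(d has_derivative d') (at x)" and d0: "d x = 0"
  shows "((\<lambda>y. prod (c y) (d y)) has_derivative (\<lambda>h. prod (c x) (d' h))) (at x)"
proof -
  obtain K where K: "K > 0" "\<And>a b. norm (prod a b) \<le> norm a * norm b * K" using pos_bounded by blast
  have bl: "bounded_linear d'" using d by (rule has_derivative_bounded_linear)
  then obtain B where B: "B > 0" "\<And>h. norm (d' h) \<le> norm h * B" using bounded_linear.pos_bounded by blast
  have "((\<lambda>y. prod (c y - c x) (d y)) has_derivative (\<lambda>h. 0)) (at x)"
    unfolding has_derivative_at_alt
  proof (intro conjI allI impI)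
    fix e :: real assume e: "e > 0"
    define \<epsilon> where "\<epsilon> = e / (K * (1 + B))"
    have ep: "\<epsilon> > 0" using e K B by (simp add: \<epsilon>_def)
    obtain r1 where r1: "r1 > 0" "\<And>y. dist y x < r1 \<Longrightarrow> dist (c y) (c x) < \<epsilon>"
      using c ep unfolding continuous_at_eps_delta by (auto simp: dist_norm)
    obtain r2 where r2: "r2 > 0" "\<And>y. norm (y - x) < r2 \<Longrightarrow> norm (d y - d x - d' (y - x)) \<le> 1 * norm (y - x)"
      using d zero_less_one unfolding has_derivative_at_alt by blast
    show "\<exists>r>0. \<forall>y. norm (y - x) < r \<longrightarrow>
        norm (prod (c y - c x) (d y) - prod (c x - c x) (d x) - 0) \<le> e * norm (y - x)"
    proof (intro exI[of _ "min r1 r2"] conjI allI impI)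
      fix y assume y: "norm (y - x) < min r1 r2"
      have "norm (d y) \<le> norm (d' (y - x)) + norm (d y - d x - d' (y - x))"
        using norm_triangle_ineq[of "d' (y - x)" "d y - d x - d' (y - x)"] d0 by simp
      also have "\<dots> \<le> (1 + B) * norm (y - x)"
        using B(2)[of "y - x"] r2(2)[of y] y by (simp add: algebra_simps)
      finally have 1: "norm (d y) \<le> (1 + B) * norm (y - x)" .
      have 2: "norm (c y - c x) \<le> \<epsilon>" using r1(2)[of y] y by (simp add: dist_norm)
      have "norm (prod (c y - c x) (d y)) \<le> norm (c y - c x) * norm (d y) * K" by (rule K)
      also have "\<dots> \<le> \<epsilon> * ((1 + B) * norm (y - x)) * K"
        using 1 2 K B ep by (intro mult_right_mono mult_mono) auto
      also have "\<dots> = e * norm (y - x)" using K B by (simp add: \<epsilon>_def)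
      finally show "norm (prod (c y - c x) (d y) - prod (c x - c x) (d x) - 0) \<le> e * norm (y - x)"
        by (simp add: d0 zero_right)
    qed (use r1 r2 in auto)
  qed simp
  moreover have "((\<lambda>y. prod (c x) (d y)) has_derivative (\<lambda>h. prod (c x) (d' h))) (at x)"
    by (rule bounded_linear.has_derivative[OF bounded_linear_right d])
  ultimately have "((\<lambda>y. prod (c y - c x) (d y) + prod (c x) (d y)) has_derivative
      (\<lambda>h. 0 + prod (c x) (d' h))) (at x)"
    by (rule has_derivative_add)
  then show ?thesis by (simp add: diff_left)
qed

lemma has_derivative_blinfun_inverse:
  fixes B :: "'c::real_normed_vector \<Rightarrow> 'a::real_normed_vector \<Rightarrow>\<^sub>L 'b::real_normed_vector" and L :: "'c \<Rightarrow> 'b \<Rightarrow>\<^sub>L 'a"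
  assumes U: "open U" "x \<in> U"
    and inv: "\<And>y. y \<in> U \<Longrightarrow> L y o\<^sub>L B y = id_blinfun" "\<And>y. y \<in> U \<Longrightarrow> B y o\<^sub>L L y = id_blinfun"
    and B: "(B has_derivative B') (at x)"
  shows "(L has_derivative (\<lambda>h. - (L x o\<^sub>L B' h o\<^sub>L L x))) (at x)"
proof -
  have inv': "L y (B y w) = w" "B y (L y z) = z" if "y \<in> U" for y w z
    using arg_cong[OF inv(1)[OF that], of "\<lambda>A. blinfun_apply A w"] arg_cong[OF inv(2)[OF that], of "\<lambda>A. blinfun_apply A z"]
    by simp_all
  have eq: "L y = L x - (L y o\<^sub>L ((B y - B x) o\<^sub>L L x))" if "y \<in> U" for y
  proof (rule blinfun_eqI)
    fix w
    show "L y w = (L x - (L y o\<^sub>L ((B y - B x) o\<^sub>L L x))) w"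
      using inv'[OF that] inv'[OF U(2)] by (simp add: blinfun.diff_left blinfun.diff_right)
  qed
  have cB: "isCont B x" using B by (rule has_derivative_continuous)
  define K where "K = norm (L x) + 1"
  have K: "K > 0" by (simp add: K_def add_nonneg_pos)
  \<comment> \<open>Near \<open>x\<close> the inverses are bounded by \<open>2 K\<close>, because there \<open>B\<close> moves by less than \<open>1 / (2 K)\<close>.\<close>
  have ev: "\<forall>\<^sub>F y in at x. y \<in> U \<and> dist (B y) (B x) < 1 / (2 * K)"
    using tendstoD[OF isContD[OF cB], of "1 / (2 * K)"] K
    by (intro eventually_conj eventually_at_in_open'[OF U]) simp
  have lip: "norm (L y - L x) \<le> 2 * K * K * norm (B y - B x)"
    if y: "y \<in> U" "dist (B y) (B x) < 1 / (2 * K)" for y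
  proof -
    have LxK: "norm (L x) \<le> K" by (simp add: K_def)
    have "norm (L y) \<le> norm (L x) + norm (L y o\<^sub>L ((B y - B x) o\<^sub>L L x))"
      by (subst eq[OF y(1)]) (rule norm_triangle_ineq4)
    also have "norm (L y o\<^sub>L ((B y - B x) o\<^sub>L L x)) \<le> norm (L y) * (norm (B y - B x) * norm (L x))"
      by (rule order_trans[OF norm_blinfun_compose mult_left_mono[OF norm_blinfun_compose norm_ge_zero]])
    also have "\<dots> \<le> norm (L y) * (1 / (2 * K) * K)"
      using y K LxK by (intro mult_left_mono mult_mono) (auto simp: dist_norm)
    finally have "norm (L y) \<le> norm (L x) + norm (L y) / 2" using K by simp
    then have Ly: "norm (L y) \<le> 2 * K" using LxK by simp
    have "norm (L y - L x) = norm (L y o\<^sub>L ((B y - B x) o\<^sub>L L x))"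
      by (subst eq[OF y(1)]) simp
    also have "\<dots> \<le> norm (L y) * (norm (B y - B x) * norm (L x))"
      by (rule order_trans[OF norm_blinfun_compose mult_left_mono[OF norm_blinfun_compose norm_ge_zero]])
    also have "\<dots> \<le> (2 * K) * (norm (B y - B x) * K)"
      using Ly LxK K by (intro mult_mono mult_left_mono) auto
    finally show ?thesis by (simp add: mult_ac)
  qed
  have "((\<lambda>y. 2 * K * K * norm (B y - B x)) \<longlongrightarrow> 2 * K * K * norm (B x - B x)) (at x)"
    by (intro tendsto_intros isContD[OF cB])
  then have "((\<lambda>y. L y - L x) \<longlongrightarrow> 0) (at x)"
    by (intro Lim_null_comparison[OF eventually_mono[OF ev lip]]) auto
  then have cL: "isCont L x" by (simp add: isCont_def LIM_zero_iff)
  have "((\<lambda>y. (B y - B x) o\<^sub>L L x) has_derivative (\<lambda>h. B' h o\<^sub>L L x)) (at x)"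
    using has_derivative_diff[OF B has_derivative_const[of "B x"]]
    by (intro bounded_linear.has_derivative[OF bounded_bilinear.bounded_linear_left[OF bounded_bilinear_blinfun_compose]]) simp
  then have "((\<lambda>y. L y o\<^sub>L ((B y - B x) o\<^sub>L L x)) has_derivative (\<lambda>h. L x o\<^sub>L (B' h o\<^sub>L L x))) (at x)"
    by (rule bounded_bilinear.has_derivative_vanishing_factor[OF bounded_bilinear_blinfun_compose cL])
       (simp add: bounded_bilinear.zero_left[OF bounded_bilinear_blinfun_compose])
  then have "((\<lambda>y. L x - (L y o\<^sub>L ((B y - B x) o\<^sub>L L x))) has_derivative (\<lambda>h. 0 - (L x o\<^sub>L (B' h o\<^sub>L L x)))) (at x)"
    by (intro has_derivative_diff has_derivative_const)
  then have "(L has_derivative (\<lambda>h. 0 - (L x o\<^sub>L (B' h o\<^sub>L L x)))) (at x)"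
    by (rule has_derivative_transform_within_open[OF _ U]) (rule eq[symmetric])
  moreover have "(\<lambda>h. 0 - (L x o\<^sub>L (B' h o\<^sub>L L x))) = (\<lambda>h. - (L x o\<^sub>L B' h o\<^sub>L L x))"
    by (auto intro!: blinfun_eqI simp: blinfun.minus_left)
  ultimately show ?thesis by simp
qed

text \<open>The derivative \<open>- L B' L\<close> of the inverse \<open>L\<close> is again built from \<open>L\<close>, so regularity climbs by induction.\<close>

lemma Ck_on_blinfun_inverse:
  fixes B :: "'c::real_normed_vector \<Rightarrow> 'a::real_normed_vector \<Rightarrow>\<^sub>L 'b::real_normed_vector" and L :: "'c \<Rightarrow> 'b \<Rightarrow>\<^sub>L 'a"
  assumes U: "open U"
    and inv: "\<And>y. y \<in> U \<Longrightarrow> L y o\<^sub>L B y = id_blinfun" "\<And>y. y \<in> U \<Longrightarrow> B y o\<^sub>L L y = id_blinfun"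
    and "\<And>k. Ck_on k U B"
  shows "Ck_on k U L"
proof (induction k)
  have D: "(L has_derivative (\<lambda>h. - (L x o\<^sub>L frechet_derivative B (at x) h o\<^sub>L L x))) (at x)" if "x \<in> U" for x
    using assms(4)[of 1] that
    by (intro has_derivative_blinfun_inverse[OF U _ inv]) (auto simp: frechet_derivative_works)
  {
    case 0
    show ?case unfolding Ck_on.simps
      by (intro continuous_at_imp_continuous_on ballI has_derivative_continuous[OF D])
  next
    case (Suc k)
    have "Ck_on k U (\<lambda>x. - (L x o\<^sub>L frechet_derivative B (at x) v o\<^sub>L L x))" for v
      using assms(4)[of "Suc k"] Suc.IH
      by (intro bounded_linear.Ck_on[OF bounded_linear_minus[OF bounded_linear_ident]]
          bounded_bilinear.Ck_on[OF bounded_bilinear_blinfun_compose] U) auto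
    then have "Ck_on k U (\<lambda>x. frechet_derivative L (at x) v)" for v
      by (rule Ck_on_cong[OF U, rotated])
        (use frechet_derivative_at[OF D] in \<open>auto simp: fun_eq_iff\<close>)
    then show ?case using D by (auto simp: differentiable_def)
  }
qed


subsection \<open>Smooth maps on arbitrary sets\<close>

text \<open>On an open set \<open>f\<close> coincides near each point with its local extension there.\<close>

lemma smooth_on_open_iff:
  assumes "open U"
  shows "smooth_on U f \<longleftrightarrow> (\<forall>k. Ck_on k U f)"
proof
  assume f: "smooth_on U f"
  show "\<forall>k. Ck_on k U f"
  proof (intro allI Ck_on_local)
    fix k x assume "x \<in> U"
    then obtain V F where V: "open V" "x \<in> V" "\<forall>k. Ck_on k V F" "\<forall>y\<in>U \<inter> V. F y = f y"
      using f unfolding smooth_on_def by blast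
    have "Ck_on k (U \<inter> V) f"
      by (rule Ck_on_cong[of _ F]) (use V assms Ck_on_subset[of k V F "U \<inter> V"] in auto)
    then show "\<exists>V. open V \<and> x \<in> V \<and> Ck_on k V f"
      using V assms \<open>x \<in> U\<close> by (intro exI[of _ "U \<inter> V"]) auto
  qed
next
  assume "\<forall>k. Ck_on k U f"
  then show "smooth_on U f" unfolding smooth_on_def using assms by (intro ballI exI[of _ U] exI[of _ f]) auto
qed

lemma smooth_onD:
  assumes "smooth_on S f" "x \<in> S"
  shows "\<exists>U F. open U \<and> x \<in> U \<and> smooth_on U F \<and> (\<forall>y\<in>S \<inter> U. F y = f y)"
proof -
  obtain U F where "open U" "x \<in> U" "\<forall>k. Ck_on k U F" "\<forall>y\<in>S \<inter> U. F y = f y"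
    using assms unfolding smooth_on_def by blast
  then show ?thesis by (intro exI[of _ U] exI[of _ F]) (auto simp: smooth_on_open_iff)
qed

lemma smooth_onI:
  assumes "\<And>x. x \<in> S \<Longrightarrow> \<exists>U F. open U \<and> x \<in> U \<and> smooth_on U F \<and> (\<forall>y\<in>S \<inter> U. F y = f y)"
  shows "smooth_on S f"
  unfolding smooth_on_def
proof
  fix x assume "x \<in> S"
  obtain U F where U: "open U" "x \<in> U" "smooth_on U F" "\<forall>y\<in>S \<inter> U. F y = f y"
    using assms[OF \<open>x \<in> S\<close>] by auto
  then have "\<forall>k. Ck_on k U F" by (simp add: smooth_on_open_iff)
  then show "\<exists>U F. open U \<and> x \<in> U \<and> (\<forall>k. Ck_on k U F) \<and> (\<forall>y\<in>S \<inter> U. F y = f y)"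
    using U by blast
qed

lemma smooth_on_subset:
  assumes "smooth_on S f" "T \<subseteq> S"
  shows "smooth_on T f"
proof (rule smooth_onI)
  fix x assume "x \<in> T"
  then have "x \<in> S" using assms(2) by blast
  obtain U F where "open U" "x \<in> U" "smooth_on U F" "\<forall>y\<in>S \<inter> U. F y = f y"
    using smooth_onD[OF assms(1) \<open>x \<in> S\<close>] by blast
  then show "\<exists>U F. open U \<and> x \<in> U \<and> smooth_on U F \<and> (\<forall>y\<in>T \<inter> U. F y = f y)"
    using assms(2) by (intro exI[of _ U] exI[of _ F]) auto
qed

lemma smooth_on_cong:
  assumes "smooth_on S f" "\<And>x. x \<in> S \<Longrightarrow> f x = g x"
  shows "smooth_on S g"
proof (rule smooth_onI)
  fix x assume "x \<in> S"
  obtain U F where "open U" "x \<in> U" "smooth_on U F" "\<forall>y\<in>S \<inter> U. F y = f y"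
    using smooth_onD[OF assms(1) \<open>x \<in> S\<close>] by blast
  then show "\<exists>U F. open U \<and> x \<in> U \<and> smooth_on U F \<and> (\<forall>y\<in>S \<inter> U. F y = g y)"
    using assms(2) by (intro exI[of _ U] exI[of _ F]) auto
qed

lemma smooth_on_locally:
  assumes "\<And>x. x \<in> M \<Longrightarrow> \<exists>U. open U \<and> x \<in> U \<and> smooth_on (M \<inter> U) f"
  shows "smooth_on M f"
proof (rule smooth_onI)
  fix x assume "x \<in> M"
  then obtain U where U: "open U" "x \<in> U" "smooth_on (M \<inter> U) f" using assms by blast
  obtain V F where V: "open V" "x \<in> V" "smooth_on V F" "\<forall>y\<in>M \<inter> U \<inter> V. F y = f y"
    using smooth_onD[OF U(3), of x] \<open>x \<in> M\<close> U(2) by blast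
  have "smooth_on (U \<inter> V) F" by (rule smooth_on_subset[OF V(3)]) auto
  then show "\<exists>U F. open U \<and> x \<in> U \<and> smooth_on U F \<and> (\<forall>y\<in>M \<inter> U. F y = f y)"
    using U V by (intro exI[of _ "U \<inter> V"] exI[of _ F]) auto
qed

lemma smooth_on_const: "smooth_on S (\<lambda>x. c)"
  by (rule smooth_onI) (auto intro!: exI[of _ UNIV] exI[of _ "\<lambda>x. c"] simp: smooth_on_open_iff Ck_on_const)

lemma smooth_on_ident: "smooth_on S (\<lambda>x. x)"
  by (rule smooth_onI) (auto intro!: exI[of _ UNIV] exI[of _ "\<lambda>x. x"] simp: smooth_on_open_iff Ck_on_ident)

lemma (in bounded_linear) smooth_on:
  assumes "smooth_on S g"
  shows "smooth_on S (\<lambda>x. f (g x))"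
proof (rule smooth_onI)
  fix x assume "x \<in> S"
  obtain U F where U: "open U" "x \<in> U" "smooth_on U F" "\<forall>y\<in>S \<inter> U. F y = g y"
    using smooth_onD[OF assms \<open>x \<in> S\<close>] by blast
  then have "smooth_on U (\<lambda>y. f (F y))" by (simp add: smooth_on_open_iff Ck_on)
  then show "\<exists>U F. open U \<and> x \<in> U \<and> smooth_on U F \<and> (\<forall>y\<in>S \<inter> U. F y = f (g y))"
    using U by (intro exI[of _ U] exI[of _ "\<lambda>y. f (F y)"]) auto
qed

lemma smooth_on_common_extension:
  assumes "smooth_on S f" "smooth_on S g" "x \<in> S"
  obtains U F H where "open U" "x \<in> U" "smooth_on U F" "smooth_on U H" "\<forall>y\<in>S \<inter> U. F y = f y \<and> H y = g y"
proof -
  obtain U F where U: "open U" "x \<in> U" "smooth_on U F" "\<forall>y\<in>S \<inter> U. F y = f y"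
    using smooth_onD[OF assms(1,3)] by blast
  obtain V H where V: "open V" "x \<in> V" "smooth_on V H" "\<forall>y\<in>S \<inter> V. H y = g y"
    using smooth_onD[OF assms(2,3)] by blast
  show thesis
    by (rule that[of "U \<inter> V" F H]) (use U V in \<open>auto elim: smooth_on_subset\<close>)
qed

lemma (in bounded_bilinear) smooth_on:
  assumes "smooth_on S f" "smooth_on S g"
  shows "smooth_on S (\<lambda>x. prod (f x) (g x))"
proof (rule smooth_onI)
  fix x assume "x \<in> S"
  obtain U F H where U: "open U" "x \<in> U" "smooth_on U F" "smooth_on U H" "\<forall>y\<in>S \<inter> U. F y = f y \<and> H y = g y"
    using smooth_on_common_extension[OF assms \<open>x \<in> S\<close>] .
  have "smooth_on U (\<lambda>y. prod (F y) (H y))"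
    using U(1,3,4) by (simp add: smooth_on_open_iff Ck_on)
  then show "\<exists>U F. open U \<and> x \<in> U \<and> smooth_on U F \<and> (\<forall>y\<in>S \<inter> U. F y = prod (f y) (g y))"
    using U by (intro exI[of _ U] exI[of _ "\<lambda>y. prod (F y) (H y)"]) auto
qed

lemma smooth_on_Pair:
  assumes "smooth_on S f" "smooth_on S g"
  shows "smooth_on S (\<lambda>x. (f x, g x))"
proof (rule smooth_onI)
  fix x assume "x \<in> S"
  obtain U F H where U: "open U" "x \<in> U" "smooth_on U F" "smooth_on U H" "\<forall>y\<in>S \<inter> U. F y = f y \<and> H y = g y"
    using smooth_on_common_extension[OF assms \<open>x \<in> S\<close>] .
  then have k: "Ck_on k U F" "Ck_on k U H" for k by (simp_all add: smooth_on_open_iff)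
  have "smooth_on U (\<lambda>y. (F y, 0) + (0, H y))"
    unfolding smooth_on_open_iff[OF U(1)]
    by (intro allI Ck_on_add U(1) k bounded_linear.Ck_on[OF bounded_linear_Pair[OF bounded_linear_ident bounded_linear_zero]]
        bounded_linear.Ck_on[OF bounded_linear_Pair[OF bounded_linear_zero bounded_linear_ident]])
  then show "\<exists>U F. open U \<and> x \<in> U \<and> smooth_on U F \<and> (\<forall>y\<in>S \<inter> U. F y = (f y, g y))"
    using U by (intro exI[of _ U] exI[of _ "\<lambda>y. (F y, 0) + (0, H y)"]) auto
qed

lemma smooth_on_add:
  assumes "smooth_on S f" "smooth_on S g"
  shows "smooth_on S (\<lambda>x. f x + g x)"
  using bounded_linear.smooth_on[OF bounded_linear_add[OF bounded_linear_fst bounded_linear_snd] smooth_on_Pair[OF assms]]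
  by simp

lemma smooth_on_minus: "smooth_on S f \<Longrightarrow> smooth_on S (\<lambda>x. - f x)"
  by (rule bounded_linear.smooth_on[OF bounded_linear_minus[OF bounded_linear_ident]])

lemma smooth_on_diff: "smooth_on S f \<Longrightarrow> smooth_on S g \<Longrightarrow> smooth_on S (\<lambda>x. f x - g x)"
  using smooth_on_add[OF _ smooth_on_minus, of S f g] by simp

lemma smooth_on_sum:
  "(\<And>i. i \<in> I \<Longrightarrow> smooth_on S (f i)) \<Longrightarrow> smooth_on S (\<lambda>x. \<Sum>i\<in>I. f i x)"
  by (induction I rule: infinite_finite_induct) (auto simp: smooth_on_const intro: smooth_on_add)

lemma smooth_on_imp_continuous_on: "smooth_on S f \<Longrightarrow> open S \<Longrightarrow> continuous_on S f"
  using smooth_on_open_iff[of S f] Ck_on.simps(1)[of S f] by blast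

lemma smooth_on_compose:
  fixes g :: "'a::real_normed_vector \<Rightarrow> 'b::euclidean_space" and f :: "'b \<Rightarrow> 'c::real_normed_vector"
  assumes "smooth_on T f" "smooth_on S g" "g ` S \<subseteq> T"
  shows "smooth_on S (\<lambda>x. f (g x))"
proof (rule smooth_onI)
  fix x assume "x \<in> S"
  obtain U G where U: "open U" "x \<in> U" "smooth_on U G" "\<forall>y\<in>S \<inter> U. G y = g y"
    using smooth_onD[OF assms(2) \<open>x \<in> S\<close>] by blast
  have gx: "g x \<in> T" using \<open>x \<in> S\<close> assms(3) by auto
  obtain V F where V: "open V" "g x \<in> V" "smooth_on V F" "\<forall>y\<in>T \<inter> V. F y = f y"
    using smooth_onD[OF assms(1) gx] by blast
  define W where "W = U \<inter> G -` V"
  have W: "open W" unfolding W_def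
    by (rule continuous_open_preimage[OF smooth_on_imp_continuous_on[OF U(3,1)] U(1) V(1)])
  have GW: "G ` W \<subseteq> V" by (auto simp: W_def)
  have "smooth_on W G" by (rule smooth_on_subset[OF U(3)]) (simp add: W_def)
  then have k: "Ck_on k W G" "Ck_on k V F" for k
    using V(1,3) W by (simp_all add: smooth_on_open_iff)
  have "smooth_on W (\<lambda>y. F (G y))"
    unfolding smooth_on_open_iff[OF W] using Ck_on_compose[OF W V(1) GW k(2,1)] by (rule allI)
  moreover have "x \<in> W" using U(2,4) V(2) \<open>x \<in> S\<close> by (simp add: W_def)
  moreover have "\<forall>y\<in>S \<inter> W. F (G y) = f (g y)"
  proof
    fix y assume y: "y \<in> S \<inter> W"
    then have "G y = g y" "G y \<in> V" using U(4) by (auto simp: W_def)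
    moreover have "g y \<in> T" using y assms(3) by auto
    ultimately show "F (G y) = f (g y)" using V(4) by simp
  qed
  ultimately show "\<exists>U F. open U \<and> x \<in> U \<and> smooth_on U F \<and> (\<forall>y\<in>S \<inter> U. F y = f (g y))"
    using W by blast
qed

lemmas smooth_on_fst = bounded_linear.smooth_on[OF bounded_linear_fst]
lemmas smooth_on_snd = bounded_linear.smooth_on[OF bounded_linear_snd]
lemmas smooth_on_apply = bounded_bilinear.smooth_on[OF bounded_bilinear_blinfun_apply]
lemmas smooth_on_inner = bounded_bilinear.smooth_on[OF bounded_bilinear_inner]
lemmas smooth_on_mult = bounded_bilinear.smooth_on[OF bounded_bilinear_mult]
lemmas smooth_on_scaleR = bounded_bilinear.smooth_on[OF bounded_bilinear_scaleR]
lemmas smooth_on_blinfun_compose = bounded_bilinear.smooth_on[OF bounded_bilinear_blinfun_compose]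

lemmas smooth_intros =
  smooth_on_const smooth_on_ident smooth_on_add smooth_on_minus smooth_on_diff smooth_on_sum smooth_on_Pair
  smooth_on_fst smooth_on_snd smooth_on_apply smooth_on_inner smooth_on_mult smooth_on_scaleR
  smooth_on_blinfun_compose

lemma smooth_on_blinfunI:
  fixes f :: "'c::real_normed_vector \<Rightarrow> 'a::euclidean_space \<Rightarrow>\<^sub>L 'b::real_normed_vector"
  assumes "\<And>e. e \<in> Basis \<Longrightarrow> smooth_on S (\<lambda>x. f x e)"
  shows "smooth_on S f"
proof (rule smooth_on_cong)
  show "smooth_on S (\<lambda>x. \<Sum>e\<in>Basis. blinfun_scaleR_left (f x e) o\<^sub>L blinfun_inner_left e)"
    by (intro smooth_on_sum bounded_linear.smooth_on[OF bounded_linear_blinfun_scaleR_left]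
        smooth_on_const smooth_on_blinfun_compose assms)
  show "(\<Sum>e\<in>Basis. blinfun_scaleR_left (f x e) o\<^sub>L blinfun_inner_left e) = f x" for x
  proof (rule blinfun_eqI)
    fix w
    show "(\<Sum>e\<in>Basis. blinfun_scaleR_left (f x e) o\<^sub>L blinfun_inner_left e) w = f x w"
      using linear_componentwise[OF blinfun_linear, of "f x" w]
      by (simp add: blinfun.sum_left inner_commute)
  qed
qed

lemma smooth_on_frechet_derivative:
  assumes "open U" "smooth_on U F"
  shows "smooth_on U (\<lambda>y. frechet_derivative F (at y) v)"
proof -
  have "Ck_on (Suc k) U F" for k using assms(2) unfolding smooth_on_open_iff[OF assms(1)] by blast
  then show ?thesis unfolding smooth_on_open_iff[OF assms(1)] by simp
qed

lemma smooth_on_has_derivative: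
  assumes "open U" "smooth_on U F" "x \<in> U"
  shows "(F has_derivative frechet_derivative F (at x)) (at x)"
  using Ck_on_has_derivative[OF _ assms(3)] assms(2) unfolding smooth_on_open_iff[OF assms(1)] by blast

definition deriv_blinfun :: "('a::real_normed_vector \<Rightarrow> 'b::real_normed_vector) \<Rightarrow> 'a \<Rightarrow> 'a \<Rightarrow>\<^sub>L 'b" where
  "deriv_blinfun F x = Blinfun (frechet_derivative F (at x))"

lemma deriv_blinfun_apply:
  assumes "open U" "smooth_on U F" "x \<in> U"
  shows "deriv_blinfun F x v = frechet_derivative F (at x) v"
  unfolding deriv_blinfun_def
  by (simp add: bounded_linear_Blinfun_apply[OF has_derivative_bounded_linear[OF smooth_on_has_derivative[OF assms]]])

lemma deriv_blinfun_has_derivative: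
  assumes "open U" "smooth_on U F" "x \<in> U"
  shows "(F has_derivative deriv_blinfun F x) (at x)"
  using smooth_on_has_derivative[OF assms] deriv_blinfun_apply[OF assms] by (metis (no_types) ext)

lemma smooth_on_deriv_blinfun:
  fixes F :: "'a::euclidean_space \<Rightarrow> 'b::real_normed_vector"
  assumes "open U" "smooth_on U F"
  shows "smooth_on U (deriv_blinfun F)"
  by (intro smooth_on_blinfunI smooth_on_cong[OF smooth_on_frechet_derivative[OF assms]])
     (simp add: deriv_blinfun_apply[OF assms])

lemma smooth_on_blinfun_inverse:
  fixes B :: "'c::real_normed_vector \<Rightarrow> 'a::real_normed_vector \<Rightarrow>\<^sub>L 'b::real_normed_vector" and L :: "'c \<Rightarrow> 'b \<Rightarrow>\<^sub>L 'a"
  assumes "open U" "smooth_on U B"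
    and "\<And>y. y \<in> U \<Longrightarrow> L y o\<^sub>L B y = id_blinfun" "\<And>y. y \<in> U \<Longrightarrow> B y o\<^sub>L L y = id_blinfun"
  shows "smooth_on U L"
  using assms Ck_on_blinfun_inverse[OF assms(1), of L B] by (simp add: smooth_on_open_iff)

subsection \<open>Symmetry of second derivatives\<close>

text \<open>The second difference of \<open>F\<close> over the parallelogram with sides \<open>t \<xi>\<close> and \<open>t \<eta>\<close> is symmetric in the two
  sides, and it is \<open>t\<^sup>2 D (D F \<xi>) \<eta>\<close> up to \<open>o(t\<^sup>2)\<close>.\<close>

lemma second_difference_estimate:
  fixes F :: "'a::real_normed_vector \<Rightarrow> 'b::real_normed_vector" and F' :: "'a \<Rightarrow> 'a \<Rightarrow>\<^sub>L 'b"
  assumes U: "open U" "x \<in> U" and F: "\<And>y. y \<in> U \<Longrightarrow> (F has_derivative F' y) (at y)"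
    and F': "(F' has_derivative F'') (at x)" and e: "e > 0"
  shows "\<exists>r>0. \<forall>t. 0 < t \<and> t < r \<longrightarrow>
    norm (F (x + t *\<^sub>R \<xi> + t *\<^sub>R \<eta>) - F (x + t *\<^sub>R \<xi>) - F (x + t *\<^sub>R \<eta>) + F x - t\<^sup>2 *\<^sub>R F'' \<eta> \<xi>) \<le> e * t\<^sup>2"
proof -
  have lin: "linear F''" using F' by (rule has_derivative_linear)
  define K where "K = norm \<xi> + norm \<eta> + 1"
  have K: "K > 0" "norm \<xi> + norm \<eta> \<le> K" "norm \<xi> \<le> K" by (simp_all add: K_def add_nonneg_pos)
  \<comment> \<open>All points of the parallelogram are within \<open>t K\<close> of \<open>x\<close>; two errors of size \<open>e1 t K\<close>, applied to a
    vector of norm at most \<open>K\<close>, add up to \<open>e t\<close>.\<close>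
  define e1 where "e1 = e / (2 * K * K)"
  have e1: "e1 > 0" using e K by (simp add: e1_def)
  obtain d1 where d1: "d1 > 0" "\<And>y. norm (y - x) < d1 \<Longrightarrow> norm (F' y - F' x - F'' (y - x)) \<le> e1 * norm (y - x)"
    using F' e1 unfolding has_derivative_at_alt by blast
  obtain d2 where d2: "d2 > 0" "ball x d2 \<subseteq> U" using U openE by blast
  define r where "r = min d1 d2 / K"
  have r: "r > 0" using d1 d2 K by (simp add: r_def)
  show ?thesis
  proof (intro exI[of _ r] conjI allI impI r)
    fix t :: real assume t: "0 < t \<and> t < r"
    have tK: "t * K < d1" "t * K < d2" using t K by (auto simp: r_def field_simps)
    define h where "h s = F (x + s *\<^sub>R \<xi> + t *\<^sub>R \<eta>) - F (x + s *\<^sub>R \<xi>) - (s * t) *\<^sub>R F'' \<eta> \<xi>" for s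
    define h' where "h' s = F' (x + s *\<^sub>R \<xi> + t *\<^sub>R \<eta>) \<xi> - F' (x + s *\<^sub>R \<xi>) \<xi> - t *\<^sub>R F'' \<eta> \<xi>" for s
    have small: "norm (s *\<^sub>R \<xi> + t *\<^sub>R \<eta>) \<le> t * K" "norm (s *\<^sub>R \<xi>) \<le> t * K" if "s \<in> {0..t}" for s
    proof -
      have "norm (s *\<^sub>R \<xi> + t *\<^sub>R \<eta>) \<le> s * norm \<xi> + t * norm \<eta>"
        using norm_triangle_ineq[of "s *\<^sub>R \<xi>" "t *\<^sub>R \<eta>"] that t by simp
      also have "\<dots> \<le> t * norm \<xi> + t * norm \<eta>" using that by (simp add: mult_right_mono)
      also have "\<dots> \<le> t * K" using K t by (simp add: distrib_left[symmetric])
      finally show "norm (s *\<^sub>R \<xi> + t *\<^sub>R \<eta>) \<le> t * K" .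
      show "norm (s *\<^sub>R \<xi>) \<le> t * K" using that t K by (simp add: mult_mono)
    qed
    have inU: "x + s *\<^sub>R \<xi> + t *\<^sub>R \<eta> \<in> U" "x + s *\<^sub>R \<xi> \<in> U" if "s \<in> {0..t}" for s
      using small[OF that] tK d2(2) by (auto simp: subset_iff dist_norm add.assoc norm_minus_commute)
    have "(h has_vector_derivative h' s) (at s within {0..t})" if s: "s \<in> {0..t}" for s
    proof -
      have a: "((\<lambda>s. F (x + s *\<^sub>R \<xi> + c)) has_vector_derivative F' (x + s *\<^sub>R \<xi> + c) \<xi>) (at s within {0..t})"
        if "x + s *\<^sub>R \<xi> + c \<in> U" for c
      proof -
        have "((\<lambda>s. x + s *\<^sub>R \<xi> + c) has_derivative (\<lambda>h. h *\<^sub>R \<xi>)) (at s within {0..t})"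
          by (auto intro!: derivative_eq_intros)
        from has_derivative_compose[OF this F[OF that]] show ?thesis
          by (simp add: has_vector_derivative_def blinfun.scaleR_right)
      qed
      show ?thesis unfolding h_def h'_def
        using a[OF inU(1)[OF s]] a[of 0] inU(2)[OF s]
        by (auto intro!: derivative_eq_intros)
    qed
    then have D: "(h has_derivative (\<lambda>u. u *\<^sub>R h' s)) (at s within {0..t})" if "s \<in> {0..t}" for s
      using that by (simp add: has_vector_derivative_def)
    have bound: "norm (h' s) \<le> e * t" if s: "s \<in> {0..t}" for s
    proof -
      define A where "A = F' (x + (s *\<^sub>R \<xi> + t *\<^sub>R \<eta>)) - F' x - F'' (s *\<^sub>R \<xi> + t *\<^sub>R \<eta>)"
      define B where "B = F' (x + s *\<^sub>R \<xi>) - F' x - F'' (s *\<^sub>R \<xi>)"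
      have A: "norm A \<le> e1 * (t * K)" unfolding A_def
        using d1(2)[of "x + (s *\<^sub>R \<xi> + t *\<^sub>R \<eta>)"] small(1)[OF s] tK e1
        by (simp) (meson le_less_trans mult_left_mono order_trans less_imp_le)
      have B: "norm B \<le> e1 * (t * K)" unfolding B_def
        using d1(2)[of "x + s *\<^sub>R \<xi>"] small(2)[OF s] tK e1
        by (simp) (meson le_less_trans mult_left_mono order_trans less_imp_le)
      have "h' s = (A - B) \<xi>"
        unfolding h'_def A_def B_def
        by (simp add: linear_add[OF lin] linear_cmul[OF lin] blinfun.diff_left blinfun.add_left blinfun.scaleR_left add.assoc)
      then have "norm (h' s) \<le> norm (A - B) * norm \<xi>" by (simp add: norm_blinfun)
      also have "\<dots> \<le> (2 * (e1 * (t * K))) * K"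
        using A B norm_triangle_ineq4[of A B] K e1 t by (intro mult_mono) auto
      also have "\<dots> = e * t" using K by (simp add: e1_def)
      finally show ?thesis .
    qed
    \<comment> \<open>The second difference is the increment of \<open>h\<close>, to which the mean value inequality applies.\<close>
    have "norm (h t - h 0) \<le> (e * t) * norm (t - 0)"
    proof (rule differentiable_bound[OF convex_real_interval(5) D])
      show "onorm (\<lambda>u. u *\<^sub>R h' s) \<le> e * t" if "s \<in> {0..t}" for s
        by (rule onorm_le) (use bound[OF that] in \<open>simp add: mult.commute mult_left_mono\<close>)
    qed (use t in auto)
    then show "norm (F (x + t *\<^sub>R \<xi> + t *\<^sub>R \<eta>) - F (x + t *\<^sub>R \<xi>) - F (x + t *\<^sub>R \<eta>) + F x - t\<^sup>2 *\<^sub>R F'' \<eta> \<xi>) \<le> e * t\<^sup>2"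
      using t by (simp add: h_def power2_eq_square algebra_simps)
  qed
qed

lemma second_derivative_symmetric:
  fixes F :: "'a::real_normed_vector \<Rightarrow> 'b::real_normed_vector" and F' :: "'a \<Rightarrow> 'a \<Rightarrow>\<^sub>L 'b"
  assumes "open U" "x \<in> U" "\<And>y. y \<in> U \<Longrightarrow> (F has_derivative F' y) (at y)"
    and "(F' has_derivative F'') (at x)"
  shows "F'' \<xi> \<eta> = F'' \<eta> \<xi>"
proof (rule ccontr)
  assume "F'' \<xi> \<eta> \<noteq> F'' \<eta> \<xi>"
  define e where "e = norm (F'' \<xi> \<eta> - F'' \<eta> \<xi>) / 3"
  have e: "e > 0" using \<open>F'' \<xi> \<eta> \<noteq> F'' \<eta> \<xi>\<close> by (simp add: e_def)
  let ?\<Delta> = "\<lambda>t. F (x + t *\<^sub>R \<xi> + t *\<^sub>R \<eta>) - F (x + t *\<^sub>R \<xi>) - F (x + t *\<^sub>R \<eta>) + F x"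
  obtain r1 where r1: "r1 > 0" "\<And>t. 0 < t \<Longrightarrow> t < r1 \<Longrightarrow> norm (?\<Delta> t - t\<^sup>2 *\<^sub>R F'' \<eta> \<xi>) \<le> e * t\<^sup>2"
    using second_difference_estimate[OF assms e, of \<xi> \<eta>] by blast
  obtain r2 where r2: "r2 > 0" "\<And>t. 0 < t \<Longrightarrow> t < r2 \<Longrightarrow> norm (?\<Delta> t - t\<^sup>2 *\<^sub>R F'' \<xi> \<eta>) \<le> e * t\<^sup>2"
    using second_difference_estimate[OF assms e, of \<eta> \<xi>] by (auto simp: algebra_simps)
  define t where "t = min r1 r2 / 2"
  have t: "0 < t" "t < r1" "t < r2" using r1 r2 by (auto simp: t_def)
  have "t\<^sup>2 * norm (F'' \<xi> \<eta> - F'' \<eta> \<xi>) = norm ((?\<Delta> t - t\<^sup>2 *\<^sub>R F'' \<eta> \<xi>) - (?\<Delta> t - t\<^sup>2 *\<^sub>R F'' \<xi> \<eta>))"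
    using norm_scaleR[of "t\<^sup>2" "F'' \<xi> \<eta> - F'' \<eta> \<xi>"] by (simp add: scaleR_diff_right)
  also have "\<dots> \<le> norm (?\<Delta> t - t\<^sup>2 *\<^sub>R F'' \<eta> \<xi>) + norm (?\<Delta> t - t\<^sup>2 *\<^sub>R F'' \<xi> \<eta>)"
    by (rule norm_triangle_ineq4)
  also have "\<dots> \<le> e * t\<^sup>2 + e * t\<^sup>2" using r1 r2 t by (intro add_mono) auto
  also have "\<dots> = t\<^sup>2 * (2 * e)" by simp
  finally have "norm (F'' \<xi> \<eta> - F'' \<eta> \<xi>) \<le> 2 * e" using t by simp
  then show False using e unfolding e_def by simp
qed

section \<open>Tangent vectors and directional derivatives\<close>

lemma tangent_spaceE:
  assumes "\<xi> \<in> tangent_space M x"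
  obtains c e where "0 < e" "smooth_on {-e<..<e} c" "c ` {-e<..<e} \<subseteq> M" "c 0 = x"
    "(c has_vector_derivative \<xi>) (at 0)"
proof -
  from assms obtain c e where "0 < e" "smooth_on {-e<..<e} c" "c ` {-e<..<e} \<subseteq> M" "c (0::real) = x"
    "(c has_vector_derivative \<xi>) (at 0)" unfolding tangent_space_def by auto
  then show thesis by (rule that)
qed

lemma tangent_spaceI:
  assumes "0 < e" "smooth_on {-e<..<e} c" "c ` {-e<..<e} \<subseteq> M" "c (0::real) = x"
    "(c has_vector_derivative \<xi>) (at 0)"
  shows "\<xi> \<in> tangent_space M x"
  unfolding tangent_space_def mem_Collect_eq
  by (intro exI[of _ c] exI[of _ e] conjI assms)

lemma tangent_space_base: "\<xi> \<in> tangent_space M x \<Longrightarrow> x \<in> M"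
  by (auto elim!: tangent_spaceE)

lemma has_derivative_along_curve:
  assumes f: "(f has_derivative D) (at x within M)"
    and c: "0 < e" "c ` {-e<..<e} \<subseteq> M" "c (0::real) = x" "(c has_vector_derivative \<xi>) (at 0)"
  shows "((\<lambda>t. f (c t)) has_vector_derivative D \<xi>) (at 0)"
proof -
  have lin: "linear D" using f by (rule has_derivative_linear)
  have "(c has_derivative (\<lambda>t. t *\<^sub>R \<xi>)) (at 0 within {-e<..<e})"
    using c(4) unfolding has_vector_derivative_def by (rule has_derivative_at_withinI)
  moreover have "(f has_derivative D) (at (c 0) within c ` {-e<..<e})"
    using has_derivative_subset[OF f c(2)] c(3) by simp
  ultimately have "((\<lambda>t. f (c t)) has_derivative (\<lambda>t. D (t *\<^sub>R \<xi>))) (at 0 within {-e<..<e})"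
    by (rule has_derivative_in_compose)
  moreover have "at 0 within {-e<..<e} = at (0::real)"
    using c(1) by (intro at_within_open) auto
  ultimately show ?thesis
    by (simp add: has_vector_derivative_def linear_cmul[OF lin])
qed

text \<open>Any two derivatives within \<open>M\<close> agree on tangent vectors: there they differentiate along a curve.\<close>

lemma dir_deriv_eq:
  assumes "(f has_derivative D) (at x within M)" "\<xi> \<in> tangent_space M x"
  shows "dir_deriv M f x \<xi> = D \<xi>"
proof -
  have "(f has_derivative frechet_derivative f (at x within M)) (at x within M)"
    using assms(1) frechet_derivative_works differentiable_def by blast
  note D' = has_derivative_along_curve[OF this] and D = has_derivative_along_curve[OF assms(1)]
  obtain c e where c: "0 < e" "smooth_on {-e<..<e} c" "c ` {-e<..<e} \<subseteq> M" "c 0 = x"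
    "(c has_vector_derivative \<xi>) (at 0)" using assms(2) by (rule tangent_spaceE)
  show ?thesis
    unfolding dir_deriv_def by (rule vector_derivative_unique_at[OF D'[OF c(1,3-5)] D[OF c(1,3-5)]])
qed

lemma smooth_on_differentiable:
  assumes "smooth_on M f" "x \<in> M"
  shows "f differentiable (at x within M)"
proof -
  obtain U F where U: "open U" "x \<in> U" "smooth_on U F" "\<forall>y\<in>M \<inter> U. F y = f y"
    using smooth_onD[OF assms] by blast
  have "(F has_derivative frechet_derivative F (at x)) (at x within M)"
    by (rule has_derivative_at_withinI[OF smooth_on_has_derivative[OF U(1,3,2)]])
  moreover have "\<forall>\<^sub>F y in at x within M. F y = f y"
    unfolding eventually_at_topological using U by blast
  ultimately have "(f has_derivative frechet_derivative F (at x)) (at x within M)"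
    using U(2,4) assms(2) by (auto intro: has_derivative_transform_eventually)
  then show ?thesis by (rule differentiableI)
qed

lemma dir_deriv_has_derivative:
  assumes "smooth_on M f" "x \<in> M"
  shows "(f has_derivative dir_deriv M f x) (at x within M)"
  using smooth_on_differentiable[OF assms] unfolding dir_deriv_def frechet_derivative_works .

lemma dir_deriv_linear: "smooth_on M f \<Longrightarrow> x \<in> M \<Longrightarrow> linear (dir_deriv M f x)"
  by (rule has_derivative_linear[OF dir_deriv_has_derivative])

lemma dir_deriv_along_curve:
  assumes "smooth_on M f" "x \<in> M"
    and "0 < e" "c ` {-e<..<e} \<subseteq> M" "c (0::real) = x" "(c has_vector_derivative \<xi>) (at 0)"
  shows "((\<lambda>t. f (c t)) has_vector_derivative dir_deriv M f x \<xi>) (at 0)"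
  by (rule has_derivative_along_curve[OF dir_deriv_has_derivative[OF assms(1,2)] assms(3-6)])

lemma dir_deriv_local:
  assumes "smooth_on M f" "\<xi> \<in> tangent_space M x"
    and U: "open U" "x \<in> U" "\<And>y. y \<in> M \<Longrightarrow> y \<in> U \<Longrightarrow> f y = h y"
    and h: "(h has_derivative D) (at x within M)"
  shows "dir_deriv M f x \<xi> = D \<xi>"
proof (rule dir_deriv_eq[OF _ assms(2)])
  have "x \<in> M" using assms(2) by (rule tangent_space_base)
  moreover have "\<forall>\<^sub>F y in at x within M. h y = f y"
    unfolding eventually_at_topological using U by (metis)
  ultimately show "(f has_derivative D) (at x within M)"
    using U h by (auto intro: has_derivative_transform_eventually)
qed

lemma dir_deriv_cong:
  assumes "smooth_on M f" "\<xi> \<in> tangent_space M x" "\<And>y. y \<in> M \<Longrightarrow> f y = h y"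
  shows "dir_deriv M f x \<xi> = dir_deriv M h x \<xi>"
  by (rule dir_deriv_local[OF assms(1,2) open_UNIV UNIV_I assms(3)
        dir_deriv_has_derivative[OF smooth_on_cong[OF assms(1,3)] tangent_space_base[OF assms(2)]]])

lemma dir_deriv_open:
  assumes "open U" "smooth_on U F" "x \<in> U" "\<And>y. y \<in> M \<Longrightarrow> y \<in> U \<Longrightarrow> f y = F y"
    and "smooth_on M f" "\<xi> \<in> tangent_space M x"
  shows "dir_deriv M f x \<xi> = deriv_blinfun F x \<xi>"
  by (rule dir_deriv_local[OF assms(5,6,1,3,4) has_derivative_at_withinI[OF deriv_blinfun_has_derivative[OF assms(1-3)]]])

lemma dir_deriv_ident: "\<xi> \<in> tangent_space M x \<Longrightarrow> dir_deriv M (\<lambda>y. y) x \<xi> = \<xi>"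
  by (rule dir_deriv_eq[OF has_derivative_ident])

lemma dir_deriv_add:
  assumes "smooth_on M f" "smooth_on M h" "\<xi> \<in> tangent_space M x"
  shows "dir_deriv M (\<lambda>y. f y + h y) x \<xi> = dir_deriv M f x \<xi> + dir_deriv M h x \<xi>"
  using tangent_space_base[OF assms(3)]
  by (intro dir_deriv_eq[OF has_derivative_add] dir_deriv_has_derivative assms)

lemma dir_deriv_diff:
  assumes "smooth_on M f" "smooth_on M h" "\<xi> \<in> tangent_space M x"
  shows "dir_deriv M (\<lambda>y. f y - h y) x \<xi> = dir_deriv M f x \<xi> - dir_deriv M h x \<xi>"
  using tangent_space_base[OF assms(3)]
  by (intro dir_deriv_eq[OF has_derivative_diff] dir_deriv_has_derivative assms)

lemma (in bounded_linear) dir_deriv: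
  assumes "smooth_on M g" "\<xi> \<in> tangent_space M x"
  shows "dir_deriv M (\<lambda>y. f (g y)) x \<xi> = f (dir_deriv M g x \<xi>)"
  using tangent_space_base[OF assms(2)]
  by (intro dir_deriv_eq[OF has_derivative] dir_deriv_has_derivative assms)

lemma (in bounded_bilinear) dir_deriv:
  assumes "smooth_on M f" "smooth_on M g" "\<xi> \<in> tangent_space M x"
  shows "dir_deriv M (\<lambda>y. prod (f y) (g y)) x \<xi> = prod (f x) (dir_deriv M g x \<xi>) + prod (dir_deriv M f x \<xi>) (g x)"
  using tangent_space_base[OF assms(3)]
  by (intro dir_deriv_eq[OF FDERIV] dir_deriv_has_derivative assms)

lemmas dir_deriv_apply = bounded_bilinear.dir_deriv[OF bounded_bilinear_blinfun_apply]
lemmas dir_deriv_inner = bounded_bilinear.dir_deriv[OF bounded_bilinear_inner]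
lemmas dir_deriv_mult = bounded_bilinear.dir_deriv[OF bounded_bilinear_mult]
lemmas dir_deriv_scaleR = bounded_bilinear.dir_deriv[OF bounded_bilinear_scaleR]

lemma dir_deriv_apply_const:
  assumes "smooth_on M f" "\<xi> \<in> tangent_space M x"
  shows "dir_deriv M (\<lambda>y. blinfun_apply (f y) w) x \<xi> = dir_deriv M f x \<xi> w"
  by (rule bounded_linear.dir_deriv[OF blinfun.bounded_linear_left assms])

lemma dir_deriv_Pair:
  assumes "smooth_on M f" "smooth_on M h" "\<xi> \<in> tangent_space M x"
  shows "dir_deriv M (\<lambda>y. (f y, h y)) x \<xi> = (dir_deriv M f x \<xi>, dir_deriv M h x \<xi>)"
  using tangent_space_base[OF assms(3)]
  by (intro dir_deriv_eq[OF has_derivative_Pair] dir_deriv_has_derivative assms)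

text \<open>Smooth maps push tangent vectors forward, and the chain rule holds on tangent vectors.\<close>

lemma dir_deriv_in_tangent_space:
  fixes h :: "'a::euclidean_space \<Rightarrow> 'b::euclidean_space"
  assumes "smooth_on M h" "h ` M \<subseteq> M'" "\<xi> \<in> tangent_space M x"
  shows "dir_deriv M h x \<xi> \<in> tangent_space M' (h x)"
proof -
  have x: "x \<in> M" using assms(3) by (rule tangent_space_base)
  obtain c e where c: "0 < e" "smooth_on {-e<..<e} c" "c ` {-e<..<e} \<subseteq> M" "c 0 = x"
    "(c has_vector_derivative \<xi>) (at 0)" using assms(3) by (rule tangent_spaceE)
  show ?thesis
  proof (rule tangent_spaceI[OF c(1)])
    show "smooth_on {-e<..<e} (\<lambda>t. h (c t))" by (rule smooth_on_compose[OF assms(1) c(2,3)])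
    show "(\<lambda>t. h (c t)) ` {-e<..<e} \<subseteq> M'" using c(3) assms(2) by auto
    show "((\<lambda>t. h (c t)) has_vector_derivative dir_deriv M h x \<xi>) (at 0)"
      by (rule dir_deriv_along_curve[OF assms(1) x c(1,3,4,5)])
  qed (simp add: c)
qed

lemma dir_deriv_compose:
  fixes h :: "'a::euclidean_space \<Rightarrow> 'b::euclidean_space"
  assumes "smooth_on M' f" "smooth_on M h" "h ` M \<subseteq> M'" "\<xi> \<in> tangent_space M x"
  shows "dir_deriv M (\<lambda>y. f (h y)) x \<xi> = dir_deriv M' f (h x) (dir_deriv M h x \<xi>)"
proof (rule dir_deriv_eq[OF _ assms(4)])
  have x: "x \<in> M" using assms(4) by (rule tangent_space_base)
  have "(f has_derivative dir_deriv M' f (h x)) (at (h x) within M')"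
    using x assms(3) by (intro dir_deriv_has_derivative assms(1)) auto
  then show "((\<lambda>y. f (h y)) has_derivative (\<lambda>v. dir_deriv M' f (h x) (dir_deriv M h x v))) (at x within M)"
    using has_derivative_in_compose[OF dir_deriv_has_derivative[OF assms(2) x] has_derivative_subset[OF _ assms(3)]]
    by blast
qed

lemma vector_field_smooth: "X \<in> vector_fields M \<Longrightarrow> smooth_on M X"
  by (simp add: vector_fields_def)

lemma vector_field_tangent: "X \<in> vector_fields M \<Longrightarrow> x \<in> M \<Longrightarrow> X x \<in> tangent_space M x"
  by (simp add: vector_fields_def)

text \<open>The derivative of \<open>f\<close> along a vector field is the local expression \<open>y \<mapsto> F' y (X y)\<close>, with \<open>F\<close> a local
  extension of \<open>f\<close>, so it is smooth again.\<close>

lemma smooth_on_dir_deriv: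
  fixes f :: "'a::euclidean_space \<Rightarrow> 'b::real_normed_vector"
  assumes "smooth_on M f" "X \<in> vector_fields M"
  shows "smooth_on M (\<lambda>y. dir_deriv M f y (X y))"
proof (rule smooth_onI)
  fix x assume "x \<in> M"
  obtain U F where U: "open U" "x \<in> U" "smooth_on U F" "\<forall>y\<in>M \<inter> U. F y = f y"
    using smooth_onD[OF assms(1) \<open>x \<in> M\<close>] by blast
  obtain V Y where V: "open V" "x \<in> V" "smooth_on V Y" "\<forall>y\<in>M \<inter> V. Y y = X y"
    using smooth_onD[OF vector_field_smooth[OF assms(2)] \<open>x \<in> M\<close>] by blast
  have "smooth_on (U \<inter> V) (\<lambda>y. deriv_blinfun F y (Y y))"
    by (intro smooth_on_apply smooth_on_subset[OF smooth_on_deriv_blinfun[OF U(1,3)]] smooth_on_subset[OF V(3)]) auto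
  moreover have "deriv_blinfun F y (Y y) = dir_deriv M f y (X y)" if "y \<in> M \<inter> (U \<inter> V)" for y
    using U V that vector_field_tangent[OF assms(2)]
    by (subst dir_deriv_open[OF U(1,3) _ _ assms(1)]) auto
  ultimately show "\<exists>U F. open U \<and> x \<in> U \<and> smooth_on U F \<and> (\<forall>y\<in>M \<inter> U. F y = dir_deriv M f y (X y))"
    using U V by (intro exI[of _ "U \<inter> V"] exI[of _ "\<lambda>y. deriv_blinfun F y (Y y)"]) auto
qed

lemma tangent_space_Int_open:
  assumes "open U" "x \<in> U"
  shows "tangent_space (M \<inter> U) x = tangent_space M x"
proof (intro equalityI subsetI)
  fix \<xi> assume "\<xi> \<in> tangent_space (M \<inter> U) x"
  then obtain c e where c: "0 < e" "smooth_on {-e<..<e} c" "c ` {-e<..<e} \<subseteq> M \<inter> U" "c 0 = x"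
    "(c has_vector_derivative \<xi>) (at 0)" by (rule tangent_spaceE)
  show "\<xi> \<in> tangent_space M x" by (rule tangent_spaceI[OF c(1,2) _ c(4,5)]) (use c(3) in auto)
next
  fix \<xi> assume "\<xi> \<in> tangent_space M x"
  then obtain c e where c: "0 < e" "smooth_on {-e<..<e} c" "c ` {-e<..<e} \<subseteq> M" "c 0 = x"
    "(c has_vector_derivative \<xi>) (at 0)" by (rule tangent_spaceE)
  have "continuous_on {-e<..<e} c" by (rule smooth_on_imp_continuous_on[OF c(2)]) simp
  then have "open ({-e<..<e} \<inter> c -` U)" by (rule continuous_open_preimage) (use assms(1) in auto)
  then obtain d where d: "d > 0" "ball 0 d \<subseteq> {-e<..<e} \<inter> c -` U"
    by (rule openE[of _ 0]) (use c(1,4) assms(2) in auto)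
  let ?r = "min d e"
  show "\<xi> \<in> tangent_space (M \<inter> U) x"
  proof (rule tangent_spaceI[of ?r])
    show "0 < ?r" using c d by simp
    show "smooth_on {-?r<..<?r} c" by (rule smooth_on_subset[OF c(2)]) auto
    show "c ` {-?r<..<?r} \<subseteq> M \<inter> U" using c(3) d(2) by (auto simp: image_subset_iff subset_iff)
  qed (use c in auto)
qed

lemma orthogonal_projection_exists:
  fixes S :: "'a::euclidean_space set"
  assumes "subspace S"
  obtains Q :: "'a \<Rightarrow>\<^sub>L 'a"
  where "\<And>w. Q w \<in> S" "\<And>w. w \<in> S \<Longrightarrow> Q w = w" "\<And>u w. Q u \<bullet> w = u \<bullet> Q w"
proof -
  obtain B where B: "B \<subseteq> S" "pairwise orthogonal B" "\<And>b. b \<in> B \<Longrightarrow> norm b = 1" "independent B" "span B = S"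
    using orthonormal_basis_subspace[OF assms] by metis
  have fin: "finite B" using B(4) independent_bound by blast
  define Q where "Q = Blinfun (\<lambda>w. \<Sum>b\<in>B. (w \<bullet> b) *\<^sub>R b)"
  have Q: "Q w = (\<Sum>b\<in>B. (w \<bullet> b) *\<^sub>R b)" for w
    unfolding Q_def by (subst bounded_linear_Blinfun_apply) (auto intro!: bounded_linear_intros)
  show thesis
  proof
    show "Q w \<in> S" for w unfolding Q
      using B(1) by (intro subspace_sum[OF assms] subspace_mul[OF assms]) auto
    have basis: "Q b = b" if "b \<in> B" for b
    proof -
      have "Q b = (\<Sum>b'\<in>B. if b' = b then b else 0)" unfolding Q
        using B(2,3) that by (intro sum.cong) (auto simp: pairwise_def orthogonal_def norm_eq_1)
      then show ?thesis using that fin by simp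
    qed
    show "Q w = w" if "w \<in> S" for w
      using that unfolding B(5)[symmetric]
      by (induction rule: span_induct_alt) (simp_all add: blinfun.zero_right blinfun.add_right blinfun.scaleR_right basis)
    show "Q u \<bullet> w = u \<bullet> Q w" for u w
      unfolding Q by (simp add: inner_sum_left inner_sum_right inner_commute mult.commute)
  qed
qed

lemma tangent_space_subspace_subset:
  fixes S :: "'a::euclidean_space set"
  assumes "subspace S"
  shows "tangent_space S z \<subseteq> S"
proof
  fix \<xi> assume \<xi>: "\<xi> \<in> tangent_space S z"
  obtain Q :: "'a \<Rightarrow>\<^sub>L 'a" where Q: "\<And>w. Q w \<in> S" "\<And>w. w \<in> S \<Longrightarrow> Q w = w"
    using orthogonal_projection_exists[OF assms] by metis
  have "Q \<xi> = dir_deriv S (\<lambda>y. Q y) z \<xi>"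
    by (simp add: bounded_linear.dir_deriv[OF blinfun.bounded_linear_right smooth_on_ident \<xi>] dir_deriv_ident[OF \<xi>])
  also have "\<dots> = dir_deriv S (\<lambda>y. y) z \<xi>"
    by (rule dir_deriv_cong[OF smooth_on_apply[OF smooth_on_const smooth_on_ident] \<xi> Q(2)])
  also have "\<dots> = \<xi>" by (rule dir_deriv_ident[OF \<xi>])
  finally show "\<xi> \<in> S" using Q(1)[of \<xi>] by simp
qed

section \<open>Charts of an embedded submanifold\<close>

definition submanifold_chart ::
  "'a::euclidean_space set \<Rightarrow> 'a set \<Rightarrow> 'a set \<Rightarrow> 'a set \<Rightarrow> ('a \<Rightarrow> 'a) \<Rightarrow> ('a \<Rightarrow> 'a) \<Rightarrow> bool" where
  "submanifold_chart M U V S \<phi> \<psi> \<longleftrightarrow>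
     open U \<and> open V \<and> homeomorphism U V \<phi> \<psi> \<and> smooth_on U \<phi> \<and> smooth_on V \<psi> \<and>
     subspace S \<and> \<phi> ` (U \<inter> M) = V \<inter> S"

lemma embedded_submanifold_chart:
  assumes "embedded_submanifold M" "x \<in> M"
  shows "\<exists>U V S \<phi> \<psi>. x \<in> U \<and> submanifold_chart M U V S \<phi> \<psi>"
  using assms unfolding embedded_submanifold_def submanifold_chart_def
  by (elim exE) (drule bspec, assumption, elim exE conjE, intro exI conjI, assumption+)

context
  fixes M U V S :: "'a::euclidean_space set" and \<phi> \<psi> :: "'a \<Rightarrow> 'a"
  assumes chart: "submanifold_chart M U V S \<phi> \<psi>"
begin

lemma chart_open: "open U" "open V"
  and chart_smooth: "smooth_on U \<phi>" "smooth_on V \<psi>"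
  and chart_subspace: "subspace S"
  and chart_homeomorphism: "homeomorphism U V \<phi> \<psi>"
  and chart_image: "\<phi> ` (U \<inter> M) = V \<inter> S"
  using chart by (simp_all add: submanifold_chart_def)

lemma chart_inverse: "y \<in> U \<Longrightarrow> \<psi> (\<phi> y) = y" "z \<in> V \<Longrightarrow> \<phi> (\<psi> z) = z"
  and chart_mem: "y \<in> U \<Longrightarrow> \<phi> y \<in> V" "z \<in> V \<Longrightarrow> \<psi> z \<in> U"
  using chart_homeomorphism unfolding homeomorphism_def by blast+

lemma chart_mem_submanifold:
  "y \<in> U \<Longrightarrow> y \<in> M \<Longrightarrow> \<phi> y \<in> S" "z \<in> V \<Longrightarrow> z \<in> S \<Longrightarrow> \<psi> z \<in> M"
proof -
  show "\<phi> y \<in> S" if "y \<in> U" "y \<in> M" using that chart_image by auto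
  show "\<psi> z \<in> M" if "z \<in> V" "z \<in> S"
  proof -
    have "z \<in> \<phi> ` (U \<inter> M)" using that chart_image by simp
    then obtain y where "y \<in> U" "y \<in> M" "z = \<phi> y" by blast
    then show ?thesis using chart_inverse(1) by simp
  qed
qed

lemma chart_deriv_inverse:
  "y \<in> U \<Longrightarrow> deriv_blinfun \<psi> (\<phi> y) (deriv_blinfun \<phi> y w) = w"
  "z \<in> V \<Longrightarrow> deriv_blinfun \<phi> (\<psi> z) (deriv_blinfun \<psi> z w) = w"
proof -
  have *: "deriv_blinfun g (f y) (deriv_blinfun f y w) = w"
    if "open A" "open B" "smooth_on A f" "smooth_on B g" "y \<in> A" "f y \<in> B" "\<And>y. y \<in> A \<Longrightarrow> g (f y) = y"
    for A B f y and g :: "'a \<Rightarrow> 'a"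
  proof -
    have "((\<lambda>y. g (f y)) has_derivative (\<lambda>w. deriv_blinfun g (f y) (deriv_blinfun f y w))) (at y)"
      by (rule has_derivative_compose[OF deriv_blinfun_has_derivative[OF that(1,3,5)] deriv_blinfun_has_derivative[OF that(2,4,6)]])
    then have "((\<lambda>y. y) has_derivative (\<lambda>w. deriv_blinfun g (f y) (deriv_blinfun f y w))) (at y)"
      by (rule has_derivative_transform_within_open[OF _ that(1,5,7)])
    from fun_cong[OF has_derivative_unique[OF this has_derivative_ident]] show ?thesis .
  qed
  show "deriv_blinfun \<psi> (\<phi> y) (deriv_blinfun \<phi> y w) = w" if "y \<in> U"
    by (rule *[OF chart_open chart_smooth that chart_mem(1)[OF that] chart_inverse(1)])
  show "deriv_blinfun \<phi> (\<psi> z) (deriv_blinfun \<psi> z w) = w" if "z \<in> V"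
    by (rule *[OF chart_open(2,1) chart_smooth(2,1) that chart_mem(2)[OF that] chart_inverse(2)])
qed

lemma subspace_slice_tangent:
  assumes "z \<in> V" "z \<in> S"
  shows "tangent_space (V \<inter> S) z = S"
proof -
  have "tangent_space (V \<inter> S) z = tangent_space S z"
    using tangent_space_Int_open[OF chart_open(2) assms(1), of S] by (simp add: Int_commute)
  moreover have "w \<in> tangent_space S z" if "w \<in> S" for w
    by (rule tangent_spaceI[of 1 "\<lambda>t. z + t *\<^sub>R w"])
      (use assms(2) that in \<open>auto intro!: smooth_intros subspace_add subspace_mul chart_subspace derivative_eq_intros\<close>)
  ultimately show ?thesis using tangent_space_subspace_subset[OF chart_subspace] by blast
qed

lemma chart_inverse_slice: "smooth_on (V \<inter> S) \<psi>" "\<psi> ` (V \<inter> S) \<subseteq> M"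
  using smooth_on_subset[OF chart_smooth(2)] chart_mem_submanifold(2) by auto

lemma dir_deriv_chart_inverse:
  assumes "z \<in> V" "z \<in> S" "w \<in> S"
  shows "dir_deriv (V \<inter> S) \<psi> z w = deriv_blinfun \<psi> z w"
  by (rule dir_deriv_open[OF chart_open(2) chart_smooth(2) assms(1) refl chart_inverse_slice(1)])
    (simp add: subspace_slice_tangent assms)

text \<open>A curve in \<open>M\<close> is mapped by \<open>\<phi>\<close> into the linear slice, and lines in the slice are mapped by \<open>\<psi>\<close> into \<open>M\<close>.\<close>

lemma chart_tangent_space:
  assumes "y \<in> U" "y \<in> M"
  shows "tangent_space M y = deriv_blinfun \<psi> (\<phi> y) ` S"
proof (intro equalityI subsetI)
  fix \<xi> assume "\<xi> \<in> tangent_space M y"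
  then have \<xi>: "\<xi> \<in> tangent_space (M \<inter> U) y" by (simp add: tangent_space_Int_open chart_open assms)
  have sm: "smooth_on (M \<inter> U) \<phi>" using smooth_on_subset[OF chart_smooth(1)] by blast
  have "dir_deriv (M \<inter> U) \<phi> y \<xi> \<in> tangent_space (V \<inter> S) (\<phi> y)"
    by (rule dir_deriv_in_tangent_space[OF sm _ \<xi>]) (use chart_image in auto)
  moreover have "dir_deriv (M \<inter> U) \<phi> y \<xi> = deriv_blinfun \<phi> y \<xi>"
    by (rule dir_deriv_open[OF chart_open(1) chart_smooth(1) assms(1) refl sm \<xi>])
  ultimately have "deriv_blinfun \<phi> y \<xi> \<in> S"
    using subspace_slice_tangent assms chart_mem(1) chart_mem_submanifold(1) by simp
  then show "\<xi> \<in> deriv_blinfun \<psi> (\<phi> y) ` S"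
    using chart_deriv_inverse(1)[OF assms(1), of \<xi>] by force
next
  fix \<xi> assume "\<xi> \<in> deriv_blinfun \<psi> (\<phi> y) ` S"
  then obtain w where w: "w \<in> S" "\<xi> = deriv_blinfun \<psi> (\<phi> y) w" by blast
  have z: "\<phi> y \<in> V" "\<phi> y \<in> S" using assms chart_mem(1) chart_mem_submanifold(1) by auto
  have "dir_deriv (V \<inter> S) \<psi> (\<phi> y) w \<in> tangent_space M (\<psi> (\<phi> y))"
    by (rule dir_deriv_in_tangent_space[OF chart_inverse_slice]) (simp add: subspace_slice_tangent[OF z] w)
  then show "\<xi> \<in> tangent_space M y"
    by (simp add: dir_deriv_chart_inverse[OF z w(1)] chart_inverse(1)[OF assms(1)] w(2))
qed

text \<open>Differentiating \<open>P (\<psi> z) (\<psi>' z w) = \<psi>' z w\<close> along the slice expresses \<open>(D P) \<xi>\<close> on tangent vectors by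
  the second derivative of \<open>\<psi>\<close>, which is symmetric.\<close>

lemma chart_projection_derivative_symmetric:
  fixes P :: "'a \<Rightarrow> 'a \<Rightarrow>\<^sub>L 'a"
  assumes P: "smooth_on M P" "\<And>y \<xi>. y \<in> M \<Longrightarrow> \<xi> \<in> tangent_space M y \<Longrightarrow> P y \<xi> = \<xi>"
    and x: "x \<in> U" "x \<in> M" and \<xi>: "\<xi> \<in> tangent_space M x" and \<eta>: "\<eta> \<in> tangent_space M x"
  shows "dir_deriv M P x \<xi> \<eta> = dir_deriv M P x \<eta> \<xi>"
proof -
  define z where "z = \<phi> x"
  have z: "z \<in> V" "z \<in> S" "\<psi> z = x"
    using x chart_mem(1) chart_mem_submanifold(1) chart_inverse(1) by (auto simp: z_def)
  let ?A = "V \<inter> S" and ?D = "deriv_blinfun \<psi>"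
  have T: "tangent_space ?A z = S" by (rule subspace_slice_tangent[OF z(1,2)])
  have sD: "smooth_on V ?D" by (rule smooth_on_deriv_blinfun[OF chart_open(2) chart_smooth(2)])
  then have sDA: "smooth_on ?A ?D" by (rule smooth_on_subset) auto
  have sPA: "smooth_on ?A (\<lambda>z. P (\<psi> z))"
    by (rule smooth_on_compose[OF P(1) chart_inverse_slice])
  have key: "dir_deriv M P x (?D z b) (?D z a) = deriv_blinfun ?D z b a - P x (deriv_blinfun ?D z b a)"
    if a: "a \<in> S" and b: "b \<in> S" for a b
  proof -
    have bT: "b \<in> tangent_space ?A z" using T b by simp
    have Db: "dir_deriv ?A (\<lambda>z. ?D z a) z b = deriv_blinfun ?D z b a"
      by (simp add: dir_deriv_apply_const[OF sDA bT] dir_deriv_open[OF chart_open(2) sD z(1) refl sDA bT])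
    have "deriv_blinfun ?D z b a = dir_deriv ?A (\<lambda>z. ?D z a) z b" by (rule Db[symmetric])
    also have "\<dots> = dir_deriv ?A (\<lambda>z. P (\<psi> z) (?D z a)) z b"
    proof (rule dir_deriv_cong[OF _ bT])
      show "smooth_on ?A (\<lambda>z. ?D z a)" by (intro smooth_intros sDA)
      fix y assume y: "y \<in> ?A"
      then have "\<psi> y \<in> U" "\<psi> y \<in> M" "\<phi> (\<psi> y) = y"
        using chart_mem(2) chart_mem_submanifold(2) chart_inverse(2) by auto
      then show "?D y a = P (\<psi> y) (?D y a)"
        using chart_tangent_space[of "\<psi> y"] P(2)[of "\<psi> y" "?D y a"] a by auto
    qed
    also have "\<dots> = P x (deriv_blinfun ?D z b a) + dir_deriv ?A (\<lambda>z. P (\<psi> z)) z b (?D z a)"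
      using dir_deriv_apply[OF sPA smooth_on_apply[OF sDA smooth_on_const] bT, of a] by (simp add: Db z(3))
    also have "dir_deriv ?A (\<lambda>z. P (\<psi> z)) z b = dir_deriv M P x (?D z b)"
      using dir_deriv_compose[OF P(1) chart_inverse_slice bT] by (simp add: z(3) dir_deriv_chart_inverse[OF z(1,2) b])
    finally show ?thesis by (simp add: algebra_simps)
  qed
  have sym: "deriv_blinfun ?D z b a = deriv_blinfun ?D z a b" for a b
    by (rule second_derivative_symmetric[OF chart_open(2) z(1)])
      (rule deriv_blinfun_has_derivative[OF chart_open(2) chart_smooth(2)], assumption,
       rule deriv_blinfun_has_derivative[OF chart_open(2) sD z(1)])
  obtain a b where a: "a \<in> S" "\<xi> = ?D z a" and b: "b \<in> S" "\<eta> = ?D z b"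
    using \<xi> \<eta> unfolding chart_tangent_space[OF x] z_def by blast
  show ?thesis
    unfolding a(2) b(2) key[OF a(1) b(1)] key[OF b(1) a(1)] sym[of a b] ..
qed

end

lemma tangent_space_is_subspace:
  assumes "embedded_submanifold M" "x \<in> M"
  shows "subspace (tangent_space M x)"
proof -
  obtain U V S \<phi> \<psi> where x: "x \<in> U" and chart: "submanifold_chart M U V S \<phi> \<psi>"
    using embedded_submanifold_chart[OF assms] by blast
  show ?thesis
    unfolding chart_tangent_space[OF chart x assms(2)]
    by (rule linear_subspace_image[OF blinfun_linear chart_subspace[OF chart]])
qed

lemma projection_derivative_symmetric:
  fixes P :: "'a::euclidean_space \<Rightarrow> 'a \<Rightarrow>\<^sub>L 'a"
  assumes "embedded_submanifold M" "smooth_on M P"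
    and "\<And>y \<xi>. y \<in> M \<Longrightarrow> \<xi> \<in> tangent_space M y \<Longrightarrow> P y \<xi> = \<xi>"
    and "\<xi> \<in> tangent_space M x" "\<eta> \<in> tangent_space M x"
  shows "dir_deriv M P x \<xi> \<eta> = dir_deriv M P x \<eta> \<xi>"
proof -
  have x: "x \<in> M" by (rule tangent_space_base[OF assms(4)])
  obtain U V S \<phi> \<psi> where U: "x \<in> U" and chart: "submanifold_chart M U V S \<phi> \<psi>"
    using embedded_submanifold_chart[OF assms(1) x] by blast
  show ?thesis
    by (rule chart_projection_derivative_symmetric[OF chart assms(2,3) U x assms(4,5)])
qed

section \<open>Metric projections\<close>

lemma adjoint_operator_apply_left: "adjoint_operator A \<eta> \<bullet> \<xi> = \<eta> \<bullet> A \<xi>"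
  using adjoint_operator_apply[of \<xi> A \<eta>] by (simp add: inner_commute)

lemma spd_symmetric: "self_adjoint_pos_def h \<Longrightarrow> \<xi> \<bullet> h \<eta> = \<eta> \<bullet> h \<xi>"
  unfolding self_adjoint_pos_def_def by (metis inner_commute)

lemma spd_eq_zero: "self_adjoint_pos_def h \<Longrightarrow> \<xi> \<bullet> h \<xi> = 0 \<Longrightarrow> \<xi> = 0"
  unfolding self_adjoint_pos_def_def by (metis less_irrefl)

lemma spd_nonneg: "self_adjoint_pos_def h \<Longrightarrow> 0 \<le> \<xi> \<bullet> h \<xi>"
  unfolding self_adjoint_pos_def_def by (metis inner_zero_left less_imp_le order_refl)

lemma spd_inj: "self_adjoint_pos_def h \<Longrightarrow> inj (blinfun_apply h)"
  using spd_eq_zero[of h]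
  by (simp add: linear_injective_0[OF blinfun_linear])

text \<open>The value \<open>inv_blinfun h\<close> is the inverse operator only for invertible \<open>h\<close>.\<close>

definition inv_blinfun :: "('a::euclidean_space \<Rightarrow>\<^sub>L 'a) \<Rightarrow> 'a \<Rightarrow>\<^sub>L 'a" where
  "inv_blinfun h = Blinfun (inv (blinfun_apply h))"

lemma blinfun_inj_imp_bij:
  fixes h :: "'a::euclidean_space \<Rightarrow>\<^sub>L 'a"
  assumes "inj (blinfun_apply h)"
  shows "bij (blinfun_apply h)"
  using assms linear_injective_imp_surjective[OF blinfun_linear assms]
  by (simp add: bij_def)

lemma inv_blinfun:
  fixes h :: "'a::euclidean_space \<Rightarrow>\<^sub>L 'a"
  assumes "inj (blinfun_apply h)"
  shows "blinfun_apply (inv_blinfun h) = inv (blinfun_apply h)"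
    and "inv_blinfun h (h w) = w" and "h (inv_blinfun h w) = w"
proof -
  have bij: "bij (blinfun_apply h)" by (rule blinfun_inj_imp_bij[OF assms])
  show inv: "blinfun_apply (inv_blinfun h) = inv (blinfun_apply h)"
    unfolding inv_blinfun_def
    by (rule bounded_linear_Blinfun_apply[OF inj_linear_imp_inv_bounded_linear[OF blinfun.bounded_linear_right assms]])
  show "inv_blinfun h (h w) = w" "h (inv_blinfun h w) = w"
    unfolding inv using bij by (simp_all add: bij_is_inj bij_is_surj surj_f_inv_f)
qed

text \<open>A vector \<open>w\<close> in the kernel of \<open>B\<close> satisfies \<open>w = - L (B - A) w\<close>, which is shorter than \<open>w\<close> unless \<open>w = 0\<close>.\<close>

lemma inj_blinfun_nearby:
  fixes A B L :: "'a::euclidean_space \<Rightarrow>\<^sub>L 'a"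
  assumes "\<And>w. L (A w) = w" "norm L * norm (B - A) < 1"
  shows "inj (blinfun_apply B)"
proof -
  have "w = 0" if "B w = 0" for w
  proof (rule ccontr)
    assume "w \<noteq> 0"
    have "norm w = norm (L ((B - A) w))" by (simp add: blinfun.diff_left blinfun.minus_right that assms(1))
    also have "\<dots> \<le> norm L * (norm (B - A) * norm w)"
      by (rule order_trans[OF norm_blinfun mult_left_mono[OF norm_blinfun norm_ge_zero]])
    also have "\<dots> = (norm L * norm (B - A)) * norm w" by simp
    also have "\<dots> < 1 * norm w" using assms(2) \<open>w \<noteq> 0\<close> by (intro mult_strict_right_mono) auto
    finally show False by simp
  qed
  then show ?thesis
    by (simp add: linear_injective_0[OF blinfun_linear])
qed

lemma smooth_on_inv_blinfun:
  fixes B :: "'c::real_normed_vector \<Rightarrow> 'a::euclidean_space \<Rightarrow>\<^sub>L 'a"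
  assumes "smooth_on S B" "\<And>y. y \<in> S \<Longrightarrow> inj (blinfun_apply (B y))"
  shows "smooth_on S (\<lambda>y. inv_blinfun (B y))"
proof (rule smooth_onI)
  fix x assume "x \<in> S"
  obtain U H where U: "open U" "x \<in> U" "smooth_on U H" "\<forall>y\<in>S \<inter> U. H y = B y"
    using smooth_onD[OF assms(1) \<open>x \<in> S\<close>] by blast
  have Hx: "H x = B x" using U \<open>x \<in> S\<close> by simp
  let ?L = "inv_blinfun (B x)"
  define W where "W = U \<inter> (\<lambda>y. norm ?L * norm (H y - H x)) -` {..<1}"
  have "continuous_on U (\<lambda>y. norm ?L * norm (H y - H x))"
    by (intro continuous_intros smooth_on_imp_continuous_on[OF U(3,1)])
  then have W: "open W" unfolding W_def by (rule continuous_open_preimage) (use U in auto)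
  have inj: "inj (blinfun_apply (H y))" if "y \<in> W" for y
    by (rule inj_blinfun_nearby[of ?L "H x"])
      (use that inv_blinfun(2)[OF assms(2)[OF \<open>x \<in> S\<close>]] in \<open>auto simp: Hx W_def\<close>)
  have "smooth_on W H" by (rule smooth_on_subset[OF U(3)]) (simp add: W_def)
  then have "smooth_on W (\<lambda>y. inv_blinfun (H y))"
    by (rule smooth_on_blinfun_inverse[OF W]) (auto intro!: blinfun_eqI simp: inv_blinfun(2,3)[OF inj])
  then show "\<exists>U F. open U \<and> x \<in> U \<and> smooth_on U F \<and> (\<forall>y\<in>S \<inter> U. F y = inv_blinfun (B y))"
    using W U by (intro exI[of _ W] exI[of _ "\<lambda>y. inv_blinfun (H y)"]) (auto simp: W_def)
qed

lemma smooth_on_adjoint_operator: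
  fixes A :: "'c::real_normed_vector \<Rightarrow> 'a::euclidean_space \<Rightarrow>\<^sub>L 'a"
  assumes "smooth_on S A"
  shows "smooth_on S (\<lambda>x. adjoint_operator (A x))"
proof (rule smooth_on_blinfunI)
  fix e :: 'a
  have "adjoint_operator B e = (\<Sum>b\<in>Basis. (B b \<bullet> e) *\<^sub>R b)" for B :: "'a \<Rightarrow>\<^sub>L 'a"
    using euclidean_representation[of "adjoint_operator B e"]
    unfolding adjoint_operator_apply_left inner_commute[of e] by simp
  then show "smooth_on S (\<lambda>x. adjoint_operator (A x) e)"
    by (simp only:) (intro smooth_intros assms)
qed

lemma metric_projection_eqI:
  assumes "self_adjoint_pos_def h" "subspace T" "is_metric_projection h T P"
  shows "metric_projection h T = P"
  unfolding metric_projection_def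
proof (rule the_equality[where P = "is_metric_projection h T", OF assms(3)])
  fix P' assume P': "is_metric_projection h T P'"
  show "P' = P"
  proof
    fix \<omega>
    have "P' \<omega> - P \<omega> \<in> T" (is "?d \<in> T") using P' assms(3) by (simp add: is_metric_projection_def subspace_diff[OF assms(2)])
    then have "?d \<bullet> h (\<omega> - P \<omega>) = 0" "?d \<bullet> h (\<omega> - P' \<omega>) = 0"
      using P' assms(3) by (simp_all add: is_metric_projection_def)
    then have "?d \<bullet> h ?d = 0" by (simp add: blinfun.diff_right inner_diff_right)
    then have "?d = 0" by (rule spd_eq_zero[OF assms(1)])
    then show "P' \<omega> = P \<omega>" by simp
  qed
qed

text \<open>For an injective parametrization \<open>A\<close> of the subspace, extended by \<open>0\<close> from the range of the orthogonal
  projection \<open>Q\<close>, this is the weighted least squares formula \<open>A (A\<^sup>T h A)\<^sup>-\<^sup>1 A\<^sup>T h\<close>; adding \<open>id - Q\<close>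
  makes the Gram operator invertible on the whole space.\<close>

definition range_projection :: "('a::euclidean_space \<Rightarrow>\<^sub>L 'a) \<Rightarrow> ('a \<Rightarrow>\<^sub>L 'a) \<Rightarrow> ('a \<Rightarrow>\<^sub>L 'a) \<Rightarrow> 'a \<Rightarrow>\<^sub>L 'a" where
  "range_projection h A Q =
     A o\<^sub>L inv_blinfun ((adjoint_operator A o\<^sub>L h o\<^sub>L A) + (id_blinfun - Q)) o\<^sub>L adjoint_operator A o\<^sub>L h"

context
  fixes h A Q :: "'a::euclidean_space \<Rightarrow>\<^sub>L 'a"
  assumes h: "self_adjoint_pos_def h"
    and Q: "\<And>w. Q (Q w) = Q w" "\<And>u w. Q u \<bullet> w = u \<bullet> Q w"
    and AQ: "\<And>w. A (Q w) = A w" and A0: "\<And>w. A w = 0 \<Longrightarrow> Q w = 0"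
begin

lemma gram_inj: "inj (blinfun_apply ((adjoint_operator A o\<^sub>L h o\<^sub>L A) + (id_blinfun - Q)))"
proof -
  let ?B = "(adjoint_operator A o\<^sub>L h o\<^sub>L A) + (id_blinfun - Q)"
  have "w = 0" if "?B w = 0" for w
  proof -
    have Qw: "Q w \<bullet> (w - Q w) = 0" unfolding Q(2) by (simp add: blinfun.diff_right Q(1))
    have eq: "w \<bullet> ?B w = A w \<bullet> h (A w) + (w - Q w) \<bullet> (w - Q w)"
      using Qw by (simp add: blinfun.add_left blinfun.diff_left inner_add_right adjoint_operator_apply inner_diff_left)
    moreover have "0 \<le> A w \<bullet> h (A w)" "0 \<le> (w - Q w) \<bullet> (w - Q w)" by (simp_all add: spd_nonneg[OF h])
    moreover have "w \<bullet> ?B w = 0" by (simp only: that inner_zero_right)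
    ultimately have "A w \<bullet> h (A w) = 0" and w: "(w - Q w) \<bullet> (w - Q w) = 0" by linarith+
    then have "Q w = 0" using spd_eq_zero[OF h] A0 by blast
    then show "w = 0" using w by simp
  qed
  then show ?thesis
    by (simp add: linear_injective_0[OF blinfun_linear])
qed

lemma range_projection: "is_metric_projection h (range (blinfun_apply A)) (range_projection h A Q)"
  unfolding is_metric_projection_def
proof (intro conjI allI ballI)
  show "linear (blinfun_apply (range_projection h A Q))"
    by (rule blinfun_linear)
  fix \<omega>
  show "range_projection h A Q \<omega> \<in> range (blinfun_apply A)" by (simp add: range_projection_def)
  fix t assume "t \<in> range (blinfun_apply A)"
  then obtain w where w: "t = A w" by blast
  define u where "u = inv_blinfun ((adjoint_operator A o\<^sub>L h o\<^sub>L A) + (id_blinfun - Q)) (adjoint_operator A (h \<omega>))"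
  have u: "adjoint_operator A (h (A u)) + (u - Q u) = adjoint_operator A (h \<omega>)"
    using inv_blinfun(3)[OF gram_inj, of "adjoint_operator A (h \<omega>)"]
    by (simp add: u_def[symmetric] blinfun.add_left blinfun.diff_left)
  have "Q w \<bullet> adjoint_operator A (h (A u)) + Q w \<bullet> (u - Q u) = Q w \<bullet> adjoint_operator A (h \<omega>)"
    by (simp only: u[symmetric] inner_add_right)
  moreover have "Q w \<bullet> (u - Q u) = 0"
    unfolding Q(2) by (simp add: blinfun.diff_right Q(1))
  ultimately have "A w \<bullet> h (A u) = A w \<bullet> h \<omega>"
    by (simp add: adjoint_operator_apply AQ)
  then show "t \<bullet> h (\<omega> - range_projection h A Q \<omega>) = 0"
    by (simp add: w range_projection_def u_def[symmetric] blinfun.diff_right inner_diff_right)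
qed

end

lemma metric_projection_exists:
  assumes "self_adjoint_pos_def h" "subspace T"
  shows "is_metric_projection h T (metric_projection h T)"
proof -
  obtain Q :: "'a \<Rightarrow>\<^sub>L 'a" where Q: "\<And>w. Q w \<in> T" "\<And>w. w \<in> T \<Longrightarrow> Q w = w" "\<And>u w. Q u \<bullet> w = u \<bullet> Q w"
    using orthogonal_projection_exists[OF assms(2)] by metis
  have "is_metric_projection h (range (blinfun_apply Q)) (range_projection h Q Q)"
    by (rule range_projection[OF assms(1)]) (use Q in auto)
  moreover have "range (blinfun_apply Q) = T" using Q(1,2) by (auto intro: range_eqI[OF sym])
  ultimately show ?thesis using metric_projection_eqI[OF assms] by simp
qed

section \<open>Extending tangent vectors to vector fields\<close>

definition tangent_projection :: "'a::euclidean_space set \<Rightarrow> ('a \<Rightarrow> 'a \<Rightarrow>\<^sub>L 'a) \<Rightarrow> 'a \<Rightarrow> 'a \<Rightarrow>\<^sub>L 'a" where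
  "tangent_projection M g y = Blinfun (metric_projection (g y) (tangent_space M y))"

lemma levi_civita_connectionD:
  assumes "levi_civita_connection M g N" "X \<in> vector_fields M" "Y \<in> vector_fields M"
  shows "N X Y \<in> vector_fields M"
    and "Z \<in> vector_fields M \<Longrightarrow> x \<in> M \<Longrightarrow>
      dir_deriv M (\<lambda>y. Y y \<bullet> g y (Z y)) x (X x) = N X Y x \<bullet> g x (Z x) + Y x \<bullet> g x (N X Z x)"
    and "x \<in> M \<Longrightarrow> N X Y x - N Y X x = lie_bracket M X Y x"
  using assms unfolding levi_civita_connection_def affine_connection_def by simp_all

lemma christoffel_functionD:
  assumes "christoffel_function M N \<Gamma>" "X \<in> vector_fields M" "Y \<in> vector_fields M" "x \<in> M"
  shows "N X Y x = dir_deriv M Y x (X x) + \<Gamma> x (X x) (Y x)"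
  using assms unfolding christoffel_function_def by simp

locale ambient_structure =
  fixes M :: "'a::euclidean_space set" and g :: "'a \<Rightarrow> 'a \<Rightarrow>\<^sub>L 'a"
  assumes ambient: "embedded_ambient_structure M g"
begin

abbreviation "T \<equiv> tangent_space M"
abbreviation "VF \<equiv> vector_fields M"
abbreviation "D \<equiv> dir_deriv M"
abbreviation "P \<equiv> tangent_projection M g"

lemma embedded: "embedded_submanifold M"
  and smooth_metric: "smooth_on M g"
  and spd: "x \<in> M \<Longrightarrow> self_adjoint_pos_def (g x)"
  using ambient by (auto simp: embedded_ambient_structure_def)

lemma T_subspace: "x \<in> M \<Longrightarrow> subspace (T x)"
  by (rule tangent_space_is_subspace[OF embedded])

lemma metric_commute: "x \<in> M \<Longrightarrow> \<xi> \<bullet> g x \<eta> = \<eta> \<bullet> g x \<xi>"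
  by (rule spd_symmetric[OF spd])

lemma tangent_projection:
  assumes "y \<in> M"
  shows "P y w \<in> T y" and "t \<in> T y \<Longrightarrow> t \<bullet> g y (w - P y w) = 0" and "t \<in> T y \<Longrightarrow> P y t = t"
proof -
  let ?P = "metric_projection (g y) (T y)"
  have p: "is_metric_projection (g y) (T y) ?P"
    by (rule metric_projection_exists[OF spd[OF assms] T_subspace[OF assms]])
  then have "blinfun_apply (P y) = ?P"
    unfolding tangent_projection_def is_metric_projection_def
    by (intro bounded_linear_Blinfun_apply) (simp add: linear_conv_bounded_linear)
  with p have q: "is_metric_projection (g y) (T y) (P y)" by simp
  show 1: "P y w \<in> T y" for w using q by (simp add: is_metric_projection_def)
  show 2: "t \<bullet> g y (w - P y w) = 0" if "t \<in> T y" for t w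
    using q that by (simp add: is_metric_projection_def)
  show "P y t = t" if "t \<in> T y"
  proof -
    have "t - P y t \<in> T y" using that 1 T_subspace[OF assms] by (intro subspace_diff)
    then have "(t - P y t) \<bullet> g y (t - P y t) = 0" by (rule 2)
    then show ?thesis using spd_eq_zero[OF spd[OF assms]] by fastforce
  qed
qed

text \<open>In a chart the tangent spaces are the ranges of \<open>\<psi>' (\<phi> y)\<close> on a fixed subspace, so the least squares formula
  expresses the projection by smooth operations.\<close>

lemma smooth_tangent_projection: "smooth_on M P"
proof (rule smooth_on_locally)
  fix x assume "x \<in> M"
  then obtain U V S \<phi> \<psi> where x: "x \<in> U" and chart: "submanifold_chart M U V S \<phi> \<psi>"
    using embedded_submanifold_chart[OF embedded] by blast
  note [simp] = chart_open[OF chart]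
  obtain Q :: "'a \<Rightarrow>\<^sub>L 'a" where Q: "\<And>w. Q w \<in> S" "\<And>w. w \<in> S \<Longrightarrow> Q w = w" "\<And>u w. Q u \<bullet> w = u \<bullet> Q w"
    using orthogonal_projection_exists[OF chart_subspace[OF chart]] by metis
  define A where "A y = deriv_blinfun \<psi> (\<phi> y) o\<^sub>L Q" for y
  have AQ: "A y (Q w) = A y w" for y w by (simp add: A_def Q)
  have A0: "Q w = 0" if "y \<in> U" "A y w = 0" for y w
    using chart_deriv_inverse(2)[OF chart chart_mem(1)[OF chart that(1)], of "Q w"] that(2)
    by (simp add: A_def blinfun.zero_right)
  have eq: "range_projection (g y) (A y) Q = P y" if y: "y \<in> M \<inter> U" for y
  proof -
    have "Q ` UNIV = S"
    proof (intro equalityI subsetI)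
      show "w \<in> Q ` UNIV" if "w \<in> S" for w using Q(2)[OF that] by (metis rangeI)
    qed (use Q(1) in auto)
    then have "range (blinfun_apply (A y)) = T y"
      using chart_tangent_space[OF chart, of y] y by (simp add: A_def image_image[symmetric])
    moreover have "is_metric_projection (g y) (range (blinfun_apply (A y))) (range_projection (g y) (A y) Q)"
      by (rule range_projection[OF spd]) (use y Q AQ A0 in auto)
    ultimately have "metric_projection (g y) (T y) = range_projection (g y) (A y) Q"
      using metric_projection_eqI[OF spd T_subspace] y by simp
    then show ?thesis by (simp add: tangent_projection_def blinfun_apply_inverse)
  qed
  have sg: "smooth_on (M \<inter> U) g" by (rule smooth_on_subset[OF smooth_metric]) auto
  have "smooth_on (M \<inter> U) \<phi>" by (rule smooth_on_subset[OF chart_smooth(1)[OF chart]]) auto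
  then have "smooth_on (M \<inter> U) (\<lambda>y. deriv_blinfun \<psi> (\<phi> y))"
    by (rule smooth_on_compose[OF smooth_on_deriv_blinfun[OF chart_open(2)[OF chart] chart_smooth(2)[OF chart]]])
      (use chart_mem(1)[OF chart] in auto)
  then have sA: "smooth_on (M \<inter> U) A"
    unfolding A_def by (intro smooth_on_blinfun_compose smooth_on_const)
  have inj: "inj (blinfun_apply ((adjoint_operator (A y) o\<^sub>L g y o\<^sub>L A y) + (id_blinfun - Q)))" if "y \<in> M \<inter> U" for y
    by (rule gram_inj[OF spd]) (use that Q AQ A0 in auto)
  have "smooth_on (M \<inter> U) (\<lambda>y. range_projection (g y) (A y) Q)"
    unfolding range_projection_def
    by (intro smooth_on_blinfun_compose smooth_on_inv_blinfun smooth_on_add smooth_on_adjoint_operator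
        smooth_on_const sA sg inj)
  then have "smooth_on (M \<inter> U) P" by (rule smooth_on_cong) (rule eq)
  then show "\<exists>U. open U \<and> x \<in> U \<and> smooth_on (M \<inter> U) P" using x by (intro exI[of _ U]) simp
qed

text \<open>Every tangent vector extends to a vector field, by projecting the constant field.\<close>

lemma projected_vector_field: "(\<lambda>y. P y w) \<in> VF"
  unfolding vector_fields_def using tangent_projection(1)
  by (auto intro!: smooth_intros smooth_tangent_projection)

text \<open>Differentiate \<open>Y = P Y\<close>.\<close>

lemma vector_field_derivative_split:
  assumes "Y \<in> VF" "\<xi> \<in> T x"
  shows "D Y x \<xi> = P x (D Y x \<xi>) + D P x \<xi> (Y x)"
proof -
  have "D Y x \<xi> = D (\<lambda>y. P y (Y y)) x \<xi>"
    by (rule dir_deriv_cong[OF vector_field_smooth[OF assms(1)] assms(2)])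
      (simp add: tangent_projection(3) vector_field_tangent[OF assms(1)])
  also have "\<dots> = P x (D Y x \<xi>) + D P x \<xi> (Y x)"
    by (rule dir_deriv_apply[OF smooth_tangent_projection vector_field_smooth[OF assms(1)] assms(2)])
  finally show ?thesis .
qed

text \<open>Hence the non-tangential part of a derivative of a vector field only depends on the value of the
  field at the point.\<close>

lemma vector_field_derivative_diff:
  assumes "Y \<in> VF" "Z \<in> VF" "Y x = Z x" "\<xi> \<in> T x"
  shows "D Y x \<xi> - D Z x \<xi> \<in> T x"
proof -
  have x: "x \<in> M" by (rule tangent_space_base[OF assms(4)])
  have "D Y x \<xi> - D Z x \<xi> = P x (D Y x \<xi>) - P x (D Z x \<xi>)"
    using vector_field_derivative_split[OF assms(1,4)] vector_field_derivative_split[OF assms(2,4)] assms(3)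
    by (metis add_diff_cancel_right)
  then show ?thesis using tangent_projection(1)[OF x] T_subspace[OF x] by (simp add: subspace_diff)
qed

lemma dir_deriv_metric:
  assumes "smooth_on M Y" "smooth_on M Z" "\<xi> \<in> T x"
  shows "D (\<lambda>y. Y y \<bullet> g y (Z y)) x \<xi> =
    D Y x \<xi> \<bullet> g x (Z x) + Y x \<bullet> D g x \<xi> (Z x) + Y x \<bullet> g x (D Z x \<xi>)"
  by (subst dir_deriv_inner[OF assms(1) smooth_on_apply[OF smooth_metric assms(2)] assms(3)])
     (simp add: dir_deriv_apply[OF smooth_metric assms(2,3)] inner_add_right)

section \<open>The Levi-Civita connection at a point\<close>

text \<open>What the Christoffel function of a Levi-Civita connection has to satisfy at a single point:
  torsion-freeness, compatibility with the metric, and tangency of covariant derivatives.\<close>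

definition levi_civita_form :: "'a \<Rightarrow> ('a \<Rightarrow> 'a \<Rightarrow> 'a) \<Rightarrow> bool" where
  "levi_civita_form x B \<longleftrightarrow>
     (\<forall>\<xi>\<in>T x. \<forall>\<eta>\<in>T x. B \<xi> \<eta> = B \<eta> \<xi>) \<and>
     (\<forall>\<xi>\<in>T x. \<forall>\<eta>\<in>T x. \<forall>\<zeta>\<in>T x. \<eta> \<bullet> D g x \<xi> \<zeta> = B \<xi> \<eta> \<bullet> g x \<zeta> + \<eta> \<bullet> g x (B \<xi> \<zeta>)) \<and>
     (\<forall>\<xi>\<in>T x. \<forall>Y\<in>VF. D Y x \<xi> + B \<xi> (Y x) \<in> T x)"

lemma levi_civita_formD:
  assumes "levi_civita_form x B" "\<xi> \<in> T x"
  shows "\<eta> \<in> T x \<Longrightarrow> B \<xi> \<eta> = B \<eta> \<xi>"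
    and "\<eta> \<in> T x \<Longrightarrow> \<zeta> \<in> T x \<Longrightarrow> \<eta> \<bullet> D g x \<xi> \<zeta> = B \<xi> \<eta> \<bullet> g x \<zeta> + \<eta> \<bullet> g x (B \<xi> \<zeta>)"
    and "Y \<in> VF \<Longrightarrow> D Y x \<xi> + B \<xi> (Y x) \<in> T x"
  using assms unfolding levi_civita_form_def by simp_all

text \<open>It suffices to test the three conditions on one extension \<open>W \<eta>\<close> of each tangent vector \<open>\<eta>\<close>.\<close>

lemma levi_civita_formI:
  assumes x: "x \<in> M"
    and W: "\<And>\<eta>. \<eta> \<in> T x \<Longrightarrow> W \<eta> \<in> VF" "\<And>\<eta>. \<eta> \<in> T x \<Longrightarrow> W \<eta> x = \<eta>"
    and sym: "\<And>\<xi> \<eta>. \<xi> \<in> T x \<Longrightarrow> \<eta> \<in> T x \<Longrightarrow> B \<xi> \<eta> = B \<eta> \<xi>"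
    and metric: "\<And>\<xi> \<eta> \<zeta>. \<xi> \<in> T x \<Longrightarrow> \<eta> \<in> T x \<Longrightarrow> \<zeta> \<in> T x \<Longrightarrow>
      D (\<lambda>y. W \<eta> y \<bullet> g y (W \<zeta> y)) x \<xi> =
        (D (W \<eta>) x \<xi> + B \<xi> \<eta>) \<bullet> g x \<zeta> + \<eta> \<bullet> g x (D (W \<zeta>) x \<xi> + B \<xi> \<zeta>)"
    and tangent: "\<And>\<xi> \<eta>. \<xi> \<in> T x \<Longrightarrow> \<eta> \<in> T x \<Longrightarrow> D (W \<eta>) x \<xi> + B \<xi> \<eta> \<in> T x"
  shows "levi_civita_form x B"
  unfolding levi_civita_form_def
proof (intro conjI ballI)
  fix \<xi> assume \<xi>: "\<xi> \<in> T x"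
  show "B \<xi> \<eta> = B \<eta> \<xi>" if "\<eta> \<in> T x" for \<eta> by (rule sym[OF \<xi> that])
  show "\<eta> \<bullet> D g x \<xi> \<zeta> = B \<xi> \<eta> \<bullet> g x \<zeta> + \<eta> \<bullet> g x (B \<xi> \<zeta>)" if "\<eta> \<in> T x" "\<zeta> \<in> T x" for \<eta> \<zeta>
    using metric[OF \<xi> that]
      dir_deriv_metric[OF vector_field_smooth[OF W(1)] vector_field_smooth[OF W(1)] \<xi>, OF that]
    by (simp add: W(2) that inner_add_left inner_add_right blinfun.add_right)
  show "D Y x \<xi> + B \<xi> (Y x) \<in> T x" if Y: "Y \<in> VF" for Y
  proof -
    have Yx: "Y x \<in> T x" using Y x by (rule vector_field_tangent)
    have "D Y x \<xi> + B \<xi> (Y x) =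
        (D (W (Y x)) x \<xi> + B \<xi> (Y x)) + (D Y x \<xi> - D (W (Y x)) x \<xi>)" by simp
    also have "\<dots> \<in> T x"
      by (intro subspace_add[OF T_subspace[OF x]] tangent \<xi> Yx vector_field_derivative_diff Y W(1))
         (simp add: W(2)[OF Yx])
    finally show ?thesis .
  qed
qed

text \<open>The difference of two such forms is tangent, symmetric in its two arguments, and skew with respect
  to the metric, and a trilinear form symmetric in one pair and skew in another one vanishes.\<close>

lemma levi_civita_form_unique:
  assumes x: "x \<in> M" and B: "levi_civita_form x B" and B': "levi_civita_form x B'"
    and \<xi>: "\<xi> \<in> T x" and \<eta>: "\<eta> \<in> T x"
  shows "B \<xi> \<eta> = B' \<xi> \<eta>"
proof -
  define d where "d \<xi> \<eta> = B \<xi> \<eta> - B' \<xi> \<eta>" for \<xi> \<eta>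
  have dT: "d \<xi> \<eta> \<in> T x" if "\<xi> \<in> T x" "\<eta> \<in> T x" for \<xi> \<eta>
  proof -
    have "(D (\<lambda>y. P y \<eta>) x \<xi> + B \<xi> (P x \<eta>)) - (D (\<lambda>y. P y \<eta>) x \<xi> + B' \<xi> (P x \<eta>)) \<in> T x"
      by (intro subspace_diff[OF T_subspace[OF x]] levi_civita_formD(3)[OF B that(1) projected_vector_field]
          levi_civita_formD(3)[OF B' that(1) projected_vector_field])
    then show ?thesis by (simp add: d_def tangent_projection(3)[OF x that(2)])
  qed
  have sym: "d \<xi> \<eta> = d \<eta> \<xi>" if "\<xi> \<in> T x" "\<eta> \<in> T x" for \<xi> \<eta>
    unfolding d_def levi_civita_formD(1)[OF B that] levi_civita_formD(1)[OF B' that] ..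
  have skew: "d \<xi> \<eta> \<bullet> g x \<zeta> = - (d \<xi> \<zeta> \<bullet> g x \<eta>)" if "\<xi> \<in> T x" "\<eta> \<in> T x" "\<zeta> \<in> T x" for \<xi> \<eta> \<zeta>
    using levi_civita_formD(2)[OF B that] levi_civita_formD(2)[OF B' that]
      metric_commute[OF x, of \<eta> "B \<xi> \<zeta>"] metric_commute[OF x, of \<eta> "B' \<xi> \<zeta>"]
    by (simp add: d_def inner_diff_left)
  have "d \<xi> \<eta> \<bullet> g x \<zeta> = 0" if \<zeta>: "\<zeta> \<in> T x" for \<zeta>
    using skew[OF \<xi> \<eta> \<zeta>] skew[OF \<zeta> \<xi> \<eta>] skew[OF \<eta> \<zeta> \<xi>] sym[OF \<xi> \<zeta>] sym[OF \<zeta> \<eta>] sym[OF \<eta> \<xi>]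
    by simp
  from this[OF dT[OF \<xi> \<eta>]] have "d \<xi> \<eta> = 0" by (rule spd_eq_zero[OF spd[OF x]])
  then show ?thesis by (simp add: d_def)
qed

lemma levi_civita_form_metric:
  assumes "levi_civita_form x B" "Y \<in> VF" "Z \<in> VF" "\<xi> \<in> T x"
  shows "D (\<lambda>y. Y y \<bullet> g y (Z y)) x \<xi> =
    (D Y x \<xi> + B \<xi> (Y x)) \<bullet> g x (Z x) + Y x \<bullet> g x (D Z x \<xi> + B \<xi> (Z x))"
proof -
  have x: "x \<in> M" by (rule tangent_space_base[OF assms(4)])
  show ?thesis
    using levi_civita_formD(2)[OF assms(1,4) vector_field_tangent[OF assms(2) x] vector_field_tangent[OF assms(3) x]]
    by (simp add: dir_deriv_metric vector_field_smooth assms inner_add_left inner_add_right blinfun.add_right)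
qed

lemma christoffel_levi_civita_form:
  fixes \<Gamma> :: "'a \<Rightarrow> 'a \<Rightarrow>\<^sub>L 'a \<Rightarrow>\<^sub>L 'a"
  assumes N: "levi_civita_connection M g N" and \<Gamma>: "christoffel_function M N \<Gamma>" and x: "x \<in> M"
  shows "levi_civita_form x (\<lambda>\<xi> \<eta>. \<Gamma> x \<xi> \<eta>)"
proof -
  have eq: "N X Y x = D Y x (X x) + \<Gamma> x (X x) (Y x)"
    if "X \<in> VF" "Y \<in> VF" for X Y
    by (rule christoffel_functionD[OF \<Gamma> that x])
  let ?W = "\<lambda>w y. P y w"
  have W: "?W w \<in> VF" for w by (rule projected_vector_field)
  have Wx: "P x w = w" if "w \<in> T x" for w by (rule tangent_projection(3)[OF x that])
  show ?thesis
  proof (rule levi_civita_formI[OF x W Wx])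
    fix \<xi> \<eta> assume \<xi>: "\<xi> \<in> T x" and \<eta>: "\<eta> \<in> T x"
    have "N (?W \<xi>) (?W \<eta>) x - N (?W \<eta>) (?W \<xi>) x = lie_bracket M (?W \<xi>) (?W \<eta>) x"
      by (rule levi_civita_connectionD(3)[OF N W W x])
    then show "\<Gamma> x \<xi> \<eta> = \<Gamma> x \<eta> \<xi>" by (simp add: eq[OF W W] lie_bracket_def Wx \<xi> \<eta>)
    have "N (?W \<xi>) (?W \<eta>) \<in> VF"
      by (rule levi_civita_connectionD(1)[OF N W W])
    from vector_field_tangent[OF this x] show "D (?W \<eta>) x \<xi> + \<Gamma> x \<xi> \<eta> \<in> T x"
      by (simp add: eq[OF W W] Wx \<xi> \<eta>)
    fix \<zeta> assume \<zeta>: "\<zeta> \<in> T x"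
    have "D (\<lambda>y. ?W \<eta> y \<bullet> g y (?W \<zeta> y)) x (?W \<xi> x)
          = N (?W \<xi>) (?W \<eta>) x \<bullet> g x (?W \<zeta> x) + ?W \<eta> x \<bullet> g x (N (?W \<xi>) (?W \<zeta>) x)"
      by (rule levi_civita_connectionD(2)[OF N W W W x])
    then show "D (\<lambda>y. ?W \<eta> y \<bullet> g y (?W \<zeta> y)) x \<xi> =
        (D (?W \<eta>) x \<xi> + \<Gamma> x \<xi> \<eta>) \<bullet> g x \<zeta> + \<eta> \<bullet> g x (D (?W \<zeta>) x \<xi> + \<Gamma> x \<xi> \<zeta>)"
      by (simp add: eq[OF W W] Wx \<xi> \<eta> \<zeta>)
  qed
qed

lemma levi_civita_connection_from_form:
  fixes \<Gamma> :: "'a \<Rightarrow> 'a \<Rightarrow>\<^sub>L 'a \<Rightarrow>\<^sub>L 'a"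
  assumes \<Gamma>: "smooth_on M \<Gamma>" and form: "\<And>x. x \<in> M \<Longrightarrow> levi_civita_form x (\<lambda>\<xi> \<eta>. \<Gamma> x \<xi> \<eta>)"
  defines "N \<equiv> \<lambda>X Y y. D Y y (X y) + \<Gamma> y (X y) (Y y)"
  shows "levi_civita_connection M g N" "christoffel_function M N \<Gamma>"
proof -
  have vT: "X x \<in> T x" if "X \<in> VF" "x \<in> M" for X x
    using that by (rule vector_field_tangent)
  have vS: "smooth_on M X" if "X \<in> VF" for X
    using that by (rule vector_field_smooth)
  have "affine_connection M N"
    unfolding affine_connection_def
  proof (intro conjI ballI allI impI)
    fix X Y assume X: "X \<in> VF" and Y: "Y \<in> VF"
    have "smooth_on M (N X Y)"
      unfolding N_def by (intro smooth_on_add smooth_on_dir_deriv smooth_on_apply \<Gamma> vS X Y)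
    then show "N X Y \<in> VF"
      using levi_civita_formD(3)[OF form vT[OF X] Y] by (simp add: vector_fields_def N_def)
    fix x assume x: "x \<in> M"
    show "N (\<lambda>y. X y + X' y) Y x = N X Y x + N X' Y x" for X'
      by (simp add: N_def linear_add[OF dir_deriv_linear[OF vS[OF Y] x]] blinfun.add_left blinfun.add_right)
    show "N X (\<lambda>y. Y y + Y' y) x = N X Y x + N X Y' x" if "Y' \<in> VF" for Y'
      by (simp add: N_def dir_deriv_add[OF vS[OF Y] vS[OF that] vT[OF X x]] blinfun.add_right)
    fix f :: "'a \<Rightarrow> real" assume f: "smooth_on M f"
    show "N (\<lambda>y. f y *\<^sub>R X y) Y x = f x *\<^sub>R N X Y x"
      by (simp add: N_def linear_cmul[OF dir_deriv_linear[OF vS[OF Y] x]] blinfun.scaleR_left blinfun.scaleR_right scaleR_add_right)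
    show "N X (\<lambda>y. f y *\<^sub>R Y y) x = D f x (X x) *\<^sub>R Y x + f x *\<^sub>R N X Y x"
      by (simp add: N_def dir_deriv_scaleR[OF f vS[OF Y] vT[OF X x]] blinfun.scaleR_right scaleR_add_right)
  qed
  moreover have "D (\<lambda>y. Y y \<bullet> g y (Z y)) x (X x) = N X Y x \<bullet> g x (Z x) + Y x \<bullet> g x (N X Z x)"
    if "X \<in> VF" "Y \<in> VF" "Z \<in> VF" "x \<in> M" for X Y Z x
    unfolding N_def by (rule levi_civita_form_metric[OF form[OF that(4)] that(2,3) vT[OF that(1,4)]])
  moreover have "N X Y x - N Y X x = lie_bracket M X Y x"
    if "X \<in> VF" "Y \<in> VF" "x \<in> M" for X Y x
    using levi_civita_formD(1)[OF form[OF that(3)] vT[OF that(1,3)] vT[OF that(2,3)]]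
    by (simp add: N_def lie_bracket_def)
  ultimately show "levi_civita_connection M g N"
    unfolding levi_civita_connection_def by blast
  show "christoffel_function M N \<Gamma>"
    unfolding christoffel_function_def N_def using \<Gamma> by blast
qed

section \<open>Existence of the Levi-Civita connection\<close>

text \<open>The Koszul term: for tangent \<open>\<zeta>\<close>, its inner product with \<open>\<zeta>\<close> is half the sum
  \<open>\<langle>(D\<^sub>\<xi> g) \<eta>, \<zeta>\<rangle> + \<langle>(D\<^sub>\<eta> g) \<xi>, \<zeta>\<rangle> - \<langle>(D\<^sub>\<zeta> g) \<xi>, \<eta>\<rangle>\<close>. The projections make it bilinear on the whole space.\<close>

definition koszul :: "'a \<Rightarrow> 'a \<Rightarrow> 'a \<Rightarrow> 'a" where
  "koszul x \<xi> \<eta> = (1 / 2) *\<^sub>R (D g x (P x \<xi>) \<eta> + D g x (P x \<eta>) \<xi>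
     - (\<Sum>e\<in>Basis. (\<xi> \<bullet> D g x (P x e) \<eta>) *\<^sub>R e))"

text \<open>Solving the Koszul formula with the projection \<open>P\<close> gives \<open>\<nabla>\<^sub>\<xi> Y = P (D\<^sub>\<xi> Y) + P g\<^sup>-\<^sup>1 K(\<xi>, Y)\<close>, and
  \<open>P (D\<^sub>\<xi> Y) = D\<^sub>\<xi> Y - (D\<^sub>\<xi> P) Y\<close> because \<open>P Y = Y\<close>.\<close>

definition koszul_christoffel :: "'a \<Rightarrow> 'a \<Rightarrow>\<^sub>L 'a \<Rightarrow>\<^sub>L 'a" where
  "koszul_christoffel x = Blinfun (\<lambda>\<xi>. Blinfun (\<lambda>\<eta>.
     P x (inv_blinfun (g x) (koszul x \<xi> \<eta>)) - D P x (P x \<xi>) \<eta>))"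

lemma metric_derivative_symmetric:
  assumes "\<xi> \<in> T x"
  shows "\<eta> \<bullet> D g x \<xi> \<zeta> = \<zeta> \<bullet> D g x \<xi> \<eta>"
proof -
  have *: "D (\<lambda>y. \<eta> \<bullet> g y \<zeta>) x \<xi> = \<eta> \<bullet> D g x \<xi> \<zeta>" for \<eta> \<zeta>
    by (simp add: bounded_linear.dir_deriv[OF bounded_linear_inner_right _ assms] dir_deriv_apply_const
        smooth_intros smooth_metric assms)
  have "D (\<lambda>y. \<eta> \<bullet> g y \<zeta>) x \<xi> = D (\<lambda>y. \<zeta> \<bullet> g y \<eta>) x \<xi>"
    by (rule dir_deriv_cong[OF _ assms metric_commute]) (intro smooth_intros smooth_metric)
  then show ?thesis by (simp add: *)
qed

lemma koszul_bilinear: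
  assumes x: "x \<in> M"
  shows "koszul x (\<xi> + \<xi>') \<eta> = koszul x \<xi> \<eta> + koszul x \<xi>' \<eta>"
    and "koszul x \<xi> (\<eta> + \<eta>') = koszul x \<xi> \<eta> + koszul x \<xi> \<eta>'"
    and "koszul x (c *\<^sub>R \<xi>) \<eta> = c *\<^sub>R koszul x \<xi> \<eta>"
    and "koszul x \<xi> (c *\<^sub>R \<eta>) = c *\<^sub>R koszul x \<xi> \<eta>"
proof -
  note L = linear_add[OF dir_deriv_linear[OF smooth_metric x]] linear_cmul[OF dir_deriv_linear[OF smooth_metric x]]
    blinfun.add_left blinfun.add_right blinfun.scaleR_left blinfun.scaleR_right inner_add_left inner_add_right
  show "koszul x (\<xi> + \<xi>') \<eta> = koszul x \<xi> \<eta> + koszul x \<xi>' \<eta>"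
    "koszul x \<xi> (\<eta> + \<eta>') = koszul x \<xi> \<eta> + koszul x \<xi> \<eta>'"
    unfolding koszul_def by (simp_all add: L algebra_simps sum.distrib)
  show "koszul x (c *\<^sub>R \<xi>) \<eta> = c *\<^sub>R koszul x \<xi> \<eta>"
    "koszul x \<xi> (c *\<^sub>R \<eta>) = c *\<^sub>R koszul x \<xi> \<eta>"
    unfolding koszul_def by (simp_all add: L algebra_simps scaleR_sum_right)
qed

lemma koszul_christoffel_apply:
  assumes x: "x \<in> M"
  shows "koszul_christoffel x \<xi> \<eta> = P x (inv_blinfun (g x) (koszul x \<xi> \<eta>)) - D P x (P x \<xi>) \<eta>"
proof -
  define b where "b \<xi> \<eta> = P x (inv_blinfun (g x) (koszul x \<xi> \<eta>)) - D P x (P x \<xi>) \<eta>" for \<xi> \<eta>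
  note L = linear_add[OF dir_deriv_linear[OF smooth_tangent_projection x]]
    linear_cmul[OF dir_deriv_linear[OF smooth_tangent_projection x]]
    blinfun.add_left blinfun.add_right blinfun.scaleR_left blinfun.scaleR_right scaleR_diff_right
  have add: "b \<xi> (\<eta> + \<eta>') = b \<xi> \<eta> + b \<xi> \<eta>'" "b (\<xi> + \<xi>') \<eta> = b \<xi> \<eta> + b \<xi>' \<eta>" for \<xi> \<xi>' \<eta> \<eta>'
    by (simp_all add: b_def koszul_bilinear[OF x] L)
  have cmul: "b \<xi> (c *\<^sub>R \<eta>) = c *\<^sub>R b \<xi> \<eta>" "b (c *\<^sub>R \<xi>) \<eta> = c *\<^sub>R b \<xi> \<eta>" for c \<xi> \<eta>
    by (simp_all add: b_def koszul_bilinear[OF x] L)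
  have "linear (b \<xi>)" for \<xi> by (rule linearI) (simp_all add: add cmul)
  then have b: "blinfun_apply (Blinfun (b \<xi>)) = b \<xi>" for \<xi>
    by (intro bounded_linear_Blinfun_apply) (simp add: linear_conv_bounded_linear)
  have "linear (\<lambda>\<xi>. Blinfun (b \<xi>))"
    by (rule linearI; rule blinfun_eqI) (simp_all add: b add cmul blinfun.add_left blinfun.scaleR_left)
  then have "blinfun_apply (koszul_christoffel x) = (\<lambda>\<xi>. Blinfun (b \<xi>))"
    unfolding koszul_christoffel_def b_def[symmetric]
    by (intro bounded_linear_Blinfun_apply) (simp add: linear_conv_bounded_linear)
  then show ?thesis by (simp add: b) (simp add: b_def)
qed

lemma smooth_koszul_christoffel: "smooth_on M koszul_christoffel"
proof (intro smooth_on_blinfunI)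
  fix e f :: 'a
  have Dg: "smooth_on M (\<lambda>x. D g x (P x w))" for w
    by (rule smooth_on_dir_deriv[OF smooth_metric projected_vector_field])
  have DP: "smooth_on M (\<lambda>x. D P x (P x w))" for w
    by (rule smooth_on_dir_deriv[OF smooth_tangent_projection projected_vector_field])
  have "smooth_on M (\<lambda>x. inv_blinfun (g x))"
    by (rule smooth_on_inv_blinfun[OF smooth_metric spd_inj[OF spd]])
  then have "smooth_on M (\<lambda>x. P x (inv_blinfun (g x) (koszul x e f)) - D P x (P x e) f)"
    unfolding koszul_def by (intro smooth_intros smooth_tangent_projection Dg DP)
  then show "smooth_on M (\<lambda>x. koszul_christoffel x e f)"
    by (rule smooth_on_cong) (simp add: koszul_christoffel_apply)
qed

lemma koszul_inner:
  assumes \<xi>: "\<xi> \<in> T x" and \<eta>: "\<eta> \<in> T x" and \<zeta>: "\<zeta> \<in> T x"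
  shows "\<zeta> \<bullet> koszul x \<xi> \<eta> =
    (\<zeta> \<bullet> D g x \<xi> \<eta> + \<zeta> \<bullet> D g x \<eta> \<xi> - \<xi> \<bullet> D g x \<zeta> \<eta>) / 2"
proof -
  have x: "x \<in> M" by (rule tangent_space_base[OF \<xi>])
  have "linear (\<lambda>e. \<xi> \<bullet> D g x (P x e) \<eta>)"
    by (rule linearI)
       (simp_all add: blinfun.add_right blinfun.scaleR_right blinfun.add_left blinfun.scaleR_left inner_add_right
         linear_add[OF dir_deriv_linear[OF smooth_metric x]] linear_cmul[OF dir_deriv_linear[OF smooth_metric x]])
  from linear_componentwise[OF this, of \<zeta>]
  have "\<zeta> \<bullet> (\<Sum>e\<in>Basis. (\<xi> \<bullet> D g x (P x e) \<eta>) *\<^sub>R e) = \<xi> \<bullet> D g x \<zeta> \<eta>"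
    by (simp add: inner_sum_right mult.commute tangent_projection(3)[OF x \<zeta>])
  then show ?thesis
    by (simp add: koszul_def inner_diff_right inner_add_right tangent_projection(3)[OF x] \<xi> \<eta>)
qed

text \<open>By \<open>vector_field_derivative_split\<close>, \<open>(D\<^sub>\<xi> P) \<eta>\<close> is the normal part of the derivative of a vector field with
  value \<open>\<eta>\<close>: it is a second fundamental form.\<close>

lemma projection_derivative_normal:
  assumes \<xi>: "\<xi> \<in> T x" and \<eta>: "\<eta> \<in> T x" and t: "t \<in> T x"
  shows "t \<bullet> g x (D P x \<xi> \<eta>) = 0"
proof -
  have x: "x \<in> M" by (rule tangent_space_base[OF \<xi>])
  have "P x (D P x \<xi> \<eta>) = 0"
    using vector_field_derivative_split[OF projected_vector_field \<xi>, of \<eta>]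
    by (simp add: dir_deriv_apply_const[OF smooth_tangent_projection \<xi>] tangent_projection(3)[OF x \<eta>])
  then show ?thesis using tangent_projection(2)[OF x t, of "D P x \<xi> \<eta>"] by simp
qed

lemma koszul_christoffel_form:
  assumes x: "x \<in> M"
  shows "levi_civita_form x (\<lambda>\<xi> \<eta>. koszul_christoffel x \<xi> \<eta>)"
  unfolding levi_civita_form_def
proof (intro conjI ballI)
  note app = koszul_christoffel_apply[OF x]
  have inv: "t \<bullet> g x (P x (inv_blinfun (g x) k)) = t \<bullet> k" if "t \<in> T x" for t k
    using tangent_projection(2)[OF x that, of "inv_blinfun (g x) k"]
    by (simp add: blinfun.diff_right inner_diff_right inv_blinfun(3)[OF spd_inj[OF spd[OF x]]])
  fix \<xi> assume \<xi>: "\<xi> \<in> T x"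
  have P\<xi>: "P x \<xi> = \<xi>" by (rule tangent_projection(3)[OF x \<xi>])
  show "koszul_christoffel x \<xi> \<eta> = koszul_christoffel x \<eta> \<xi>" if \<eta>: "\<eta> \<in> T x" for \<eta>
  proof -
    have P\<eta>: "P x \<eta> = \<eta>" by (rule tangent_projection(3)[OF x \<eta>])
    have "koszul x \<xi> \<eta> = koszul x \<eta> \<xi>"
      unfolding koszul_def sum.cong[OF refl arg_cong[where f = "\<lambda>r. r *\<^sub>R _", OF
          metric_derivative_symmetric[OF tangent_projection(1)[OF x], of \<xi> _ \<eta>]]]
      by (simp add: add.commute)
    then show ?thesis
      using projection_derivative_symmetric[OF embedded smooth_tangent_projection tangent_projection(3) \<xi> \<eta>]
      by (simp add: app P\<xi> P\<eta>)
  qed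
  show "\<eta> \<bullet> D g x \<xi> \<zeta> =
      koszul_christoffel x \<xi> \<eta> \<bullet> g x \<zeta> + \<eta> \<bullet> g x (koszul_christoffel x \<xi> \<zeta>)"
    if \<eta>: "\<eta> \<in> T x" and \<zeta>: "\<zeta> \<in> T x" for \<eta> \<zeta>
  proof -
    have *: "t \<bullet> g x (koszul_christoffel x \<xi> w) = t \<bullet> koszul x \<xi> w" if "t \<in> T x" "w \<in> T x" for t w
      by (simp add: app P\<xi> blinfun.diff_right inner_diff_right inv projection_derivative_normal[OF \<xi>] that)
    have "koszul_christoffel x \<xi> \<eta> \<bullet> g x \<zeta> + \<eta> \<bullet> g x (koszul_christoffel x \<xi> \<zeta>)
        = \<zeta> \<bullet> koszul x \<xi> \<eta> + \<eta> \<bullet> koszul x \<xi> \<zeta>"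
      by (simp add: metric_commute[OF x, of _ \<zeta>] * \<eta> \<zeta>)
    also have "\<dots> = \<eta> \<bullet> D g x \<xi> \<zeta>"
      using metric_derivative_symmetric[OF \<xi>, of \<zeta> \<eta>] metric_derivative_symmetric[OF \<eta>, of \<zeta> \<xi>]
        metric_derivative_symmetric[OF \<zeta>, of \<xi> \<eta>]
      by (simp add: koszul_inner \<xi> \<eta> \<zeta> field_simps)
    finally show ?thesis by simp
  qed
  show "D Y x \<xi> + koszul_christoffel x \<xi> (Y x) \<in> T x" if Y: "Y \<in> VF" for Y
  proof -
    have "D Y x \<xi> + koszul_christoffel x \<xi> (Y x) =
        P x (D Y x \<xi>) + P x (inv_blinfun (g x) (koszul x \<xi> (Y x)))"
      using vector_field_derivative_split[OF Y \<xi>] by (simp add: app P\<xi>) (simp add: algebra_simps)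
    then show ?thesis using tangent_projection(1)[OF x] T_subspace[OF x] by (simp add: subspace_add)
  qed
qed

lemma levi_civita_connection_exists:
  "\<exists>N \<Gamma>. levi_civita_connection M g N \<and> christoffel_function M N \<Gamma>"
  using levi_civita_connection_from_form[OF smooth_koszul_christoffel koszul_christoffel_form] by blast

end

section \<open>Curvature\<close>

locale levi_civita = ambient_structure M g
  for M :: "'a::euclidean_space set" and g +
  fixes N :: "('a \<Rightarrow> 'a) \<Rightarrow> ('a \<Rightarrow> 'a) \<Rightarrow> ('a \<Rightarrow> 'a)" and \<Gamma> :: "'a \<Rightarrow> 'a \<Rightarrow>\<^sub>L 'a \<Rightarrow>\<^sub>L 'a"
  assumes levi_civita: "levi_civita_connection M g N" and christoffel: "christoffel_function M N \<Gamma>"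
begin

lemma smooth_christoffel: "smooth_on M \<Gamma>"
  using christoffel by (simp add: christoffel_function_def)

lemma christoffel_form: "x \<in> M \<Longrightarrow> levi_civita_form x (\<lambda>\<xi> \<eta>. \<Gamma> x \<xi> \<eta>)"
  by (rule christoffel_levi_civita_form[OF levi_civita christoffel])

lemma christoffel_symmetric: "\<xi> \<in> T x \<Longrightarrow> \<eta> \<in> T x \<Longrightarrow> \<Gamma> x \<xi> \<eta> = \<Gamma> x \<eta> \<xi>"
  using levi_civita_formD(1)[OF christoffel_form[OF tangent_space_base]] by simp

lemma christoffel_tangent: "\<xi> \<in> T x \<Longrightarrow> Y \<in> VF \<Longrightarrow> D Y x \<xi> + \<Gamma> x \<xi> (Y x) \<in> T x"
  using levi_civita_formD(3)[OF christoffel_form[OF tangent_space_base]] by simp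

lemmas connection_eq = christoffel_functionD[OF christoffel]
lemmas connection_vector_field = levi_civita_connectionD(1)[OF levi_civita]

lemma lie_bracket_vector_field:
  assumes "X \<in> VF" "Y \<in> VF"
  shows "lie_bracket M X Y \<in> VF"
proof -
  have eq: "lie_bracket M X Y y = N X Y y - N Y X y" if "y \<in> M" for y
    using levi_civita_connectionD(3)[OF levi_civita assms that] by simp
  have 1: "N X Y \<in> VF" and 2: "N Y X \<in> VF"
    by (rule connection_vector_field[OF assms(1,2)], rule connection_vector_field[OF assms(2,1)])
  have "smooth_on M (lie_bracket M X Y)"
    by (rule smooth_on_cong[OF smooth_on_diff[OF vector_field_smooth[OF 1] vector_field_smooth[OF 2]]])
      (simp add: eq)
  moreover have "lie_bracket M X Y y \<in> T y" if "y \<in> M" for y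
    unfolding eq[OF that] using that
    by (intro subspace_diff T_subspace vector_field_tangent 1 2)
  ultimately show ?thesis by (simp add: vector_fields_def)
qed

text \<open>The second-order parts are both \<open>F'' x (X x) (Y x)\<close> for a local extension \<open>F\<close> of \<open>f\<close>; the first-order parts
  leave \<open>F' x (D\<^sub>X Y - D\<^sub>Y X)\<close>, and the bracket is tangent, so this is a derivative along \<open>M\<close>.\<close>

lemma dir_deriv_commutator:
  fixes f :: "'a \<Rightarrow> 'b::real_normed_vector"
  assumes f: "smooth_on M f" and X: "X \<in> VF" and Y: "Y \<in> VF" and x: "x \<in> M"
  shows "D (\<lambda>y. D f y (Y y)) x (X x) - D (\<lambda>y. D f y (X y)) x (Y x)
    = D f x (lie_bracket M X Y x)"
proof -
  obtain U F where U: "open U" "x \<in> U" "smooth_on U F" "\<forall>y\<in>M \<inter> U. F y = f y"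
    using smooth_onD[OF f x] by blast
  let ?D = "deriv_blinfun F"
  have sD: "smooth_on U ?D" by (rule smooth_on_deriv_blinfun[OF U(1,3)])
  have Df: "D f y \<xi> = ?D y \<xi>" if "y \<in> U" "\<xi> \<in> T y" for y \<xi>
    by (rule dir_deriv_open[OF U(1,3) that(1) _ f that(2)]) (use U(4) in auto)
  have key: "D (\<lambda>y. D f y (Z y)) x \<xi> = ?D x (D Z x \<xi>) + deriv_blinfun ?D x \<xi> (Z x)"
    if Z: "Z \<in> VF" and \<xi>: "\<xi> \<in> T x" for Z \<xi>
  proof (rule dir_deriv_local[OF smooth_on_dir_deriv[OF f Z] \<xi> U(1,2)])
    show "D f y (Z y) = ?D y (Z y)" if "y \<in> M" "y \<in> U" for y
      by (rule Df[OF that(2) vector_field_tangent[OF Z that(1)]])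
    show "((\<lambda>y. ?D y (Z y)) has_derivative
        (\<lambda>\<xi>. ?D x (D Z x \<xi>) + deriv_blinfun ?D x \<xi> (Z x))) (at x within M)"
      by (rule bounded_bilinear.FDERIV[OF bounded_bilinear_blinfun_apply
            has_derivative_at_withinI[OF deriv_blinfun_has_derivative[OF U(1) sD U(2)]]
            dir_deriv_has_derivative[OF vector_field_smooth[OF Z] x]])
  qed
  have sym: "deriv_blinfun ?D x a b = deriv_blinfun ?D x b a" for a b
    by (rule second_derivative_symmetric[OF U(1,2)])
      (rule deriv_blinfun_has_derivative[OF U(1,3)], assumption, rule deriv_blinfun_has_derivative[OF U(1) sD U(2)])
  have "D f x (lie_bracket M X Y x) = ?D x (lie_bracket M X Y x)"
    by (rule Df[OF U(2) vector_field_tangent[OF lie_bracket_vector_field[OF X Y] x]])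
  then show ?thesis
    using sym[of "X x" "Y x"]
    by (simp add: key[OF X vector_field_tangent[OF Y x]] key[OF Y vector_field_tangent[OF X x]]
        lie_bracket_def blinfun.diff_right)
qed

text \<open>The curvature as a trilinear expression in the Christoffel function. Outside the tangent space its
  values have no geometric meaning.\<close>

definition christoffel_curvature :: "'a \<Rightarrow> 'a \<Rightarrow> 'a \<Rightarrow> 'a \<Rightarrow> 'a" where
  "christoffel_curvature x \<xi> \<eta> \<zeta> = D \<Gamma> x \<eta> \<xi> \<zeta> - D \<Gamma> x \<xi> \<eta> \<zeta>
     + \<Gamma> x \<eta> (\<Gamma> x \<xi> \<zeta>) - \<Gamma> x \<xi> (\<Gamma> x \<eta> \<zeta>)"

text \<open>The second derivatives of \<open>Z\<close> cancel by \<open>dir_deriv_commutator\<close>, and the first derivatives of \<open>X\<close>, \<open>Y\<close> and \<open>Z\<close>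
  cancel in pairs. Only the values of the fields at \<open>x\<close> remain, which makes \<open>curvature\<close> well defined.\<close>

lemma curvature_vector_fields:
  assumes X: "X \<in> VF" and Y: "Y \<in> VF" and Z: "Z \<in> VF" and x: "x \<in> M"
  shows "N (lie_bracket M X Y) Z x - N X (N Y Z) x + N Y (N X Z) x = christoffel_curvature x (X x) (Y x) (Z x)"
proof -
  note sm = vector_field_smooth and ta = vector_field_tangent[OF _ x]
  have D: "D (N Y Z) x \<xi> = D (\<lambda>y. D Z y (Y y)) x \<xi>
      + (\<Gamma> x (Y x) (D Z x \<xi>) + (\<Gamma> x (D Y x \<xi>) (Z x) + D \<Gamma> x \<xi> (Y x) (Z x)))"
    if Y: "Y \<in> VF" and \<xi>: "\<xi> \<in> T x" for Y \<xi>
  proof -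
    have \<Gamma>Y: "smooth_on M (\<lambda>y. \<Gamma> y (Y y))" by (intro smooth_intros smooth_christoffel sm Y)
    have "D (N Y Z) x \<xi> = D (\<lambda>y. D Z y (Y y) + \<Gamma> y (Y y) (Z y)) x \<xi>"
      by (rule dir_deriv_cong[OF sm[OF connection_vector_field[OF Y Z]] \<xi> connection_eq[OF Y Z]])
    also have "\<dots> = D (\<lambda>y. D Z y (Y y)) x \<xi> + D (\<lambda>y. \<Gamma> y (Y y) (Z y)) x \<xi>"
      by (rule dir_deriv_add[OF smooth_on_dir_deriv[OF sm[OF Z] Y] smooth_on_apply[OF \<Gamma>Y sm[OF Z]] \<xi>])
    also have "D (\<lambda>y. \<Gamma> y (Y y) (Z y)) x \<xi> =
        \<Gamma> x (Y x) (D Z x \<xi>) + (\<Gamma> x (D Y x \<xi>) (Z x) + D \<Gamma> x \<xi> (Y x) (Z x))"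
      by (subst dir_deriv_apply[OF \<Gamma>Y sm[OF Z] \<xi>])
         (simp add: dir_deriv_apply[OF smooth_christoffel sm[OF Y] \<xi>] blinfun.add_left)
    finally show ?thesis .
  qed
  have lb: "lie_bracket M X Y x = D Y x (X x) - D X x (Y x)"
    by (simp add: lie_bracket_def)
  show ?thesis
    using dir_deriv_commutator[OF sm[OF Z] X Y x]
    by (simp add: connection_eq[OF lie_bracket_vector_field[OF X Y] Z x]
        connection_eq[OF X connection_vector_field[OF Y Z] x] connection_eq[OF Y connection_vector_field[OF X Z] x]
        connection_eq[OF Y Z x] connection_eq[OF X Z x]
        D[OF X ta[OF Y]] D[OF Y ta[OF X]] christoffel_curvature_def lb
        blinfun.add_right blinfun.diff_right blinfun.diff_left)
       (simp add: algebra_simps)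
qed

lemma curvature_eq_christoffel:
  assumes \<xi>: "\<xi> \<in> T x" and \<eta>: "\<eta> \<in> T x" and \<zeta>: "\<zeta> \<in> T x"
  shows "curvature M N x \<xi> \<eta> \<zeta> = christoffel_curvature x \<xi> \<eta> \<zeta>"
  unfolding curvature_def
proof (rule the_equality)
  have x: "x \<in> M" by (rule tangent_space_base[OF \<xi>])
  let ?W = "\<lambda>w y. P y w"
  have W: "?W w \<in> VF" for w by (rule projected_vector_field)
  have Wx: "?W w x = w" if "w \<in> T x" for w by (rule tangent_projection(3)[OF x that])
  show "\<exists>X\<in>VF. \<exists>Y\<in>VF. \<exists>Z\<in>VF. X x = \<xi> \<and> Y x = \<eta> \<and> Z x = \<zeta> \<and>
      christoffel_curvature x \<xi> \<eta> \<zeta> = N (lie_bracket M X Y) Z x - N X (N Y Z) x + N Y (N X Z) x"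
    using curvature_vector_fields[OF W W W x, of \<xi> \<eta> \<zeta>] Wx[OF \<xi>] Wx[OF \<eta>] Wx[OF \<zeta>]
    by (intro bexI[of _ "?W \<xi>"] bexI[of _ "?W \<eta>"] bexI[of _ "?W \<zeta>"] W) simp
  show "r = christoffel_curvature x \<xi> \<eta> \<zeta>"
    if "\<exists>X\<in>VF. \<exists>Y\<in>VF. \<exists>Z\<in>VF. X x = \<xi> \<and> Y x = \<eta> \<and> Z x = \<zeta> \<and>
      r = N (lie_bracket M X Y) Z x - N X (N Y Z) x + N Y (N X Z) x" for r
    using that curvature_vector_fields[OF _ _ _ x] by auto
qed

lemma curvature_tangent:
  assumes "\<xi> \<in> T x" "\<eta> \<in> T x" "\<zeta> \<in> T x"
  shows "christoffel_curvature x \<xi> \<eta> \<zeta> \<in> T x"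
proof -
  have x: "x \<in> M" by (rule tangent_space_base[OF assms(1)])
  have W: "(\<lambda>y. P y w) \<in> VF" for w by (rule projected_vector_field)
  have "N (lie_bracket M (\<lambda>y. P y \<xi>) (\<lambda>y. P y \<eta>)) (\<lambda>y. P y \<zeta>) x - N (\<lambda>y. P y \<xi>) (N (\<lambda>y. P y \<eta>) (\<lambda>y. P y \<zeta>)) x
      + N (\<lambda>y. P y \<eta>) (N (\<lambda>y. P y \<xi>) (\<lambda>y. P y \<zeta>)) x \<in> T x"
    by (intro subspace_add subspace_diff T_subspace x vector_field_tangent connection_vector_field
        lie_bracket_vector_field W)
  then show ?thesis by (simp add: curvature_vector_fields[OF W W W x] tangent_projection(3)[OF x] assms)
qed

lemma curvature_skew_first: "christoffel_curvature x \<eta> \<xi> \<zeta> = - christoffel_curvature x \<xi> \<eta> \<zeta>"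
  by (simp add: christoffel_curvature_def)

text \<open>For the function \<open>\<langle>Z, W\<rangle>\<close> the operator \<open>D\<^sub>X D\<^sub>Y - D\<^sub>Y D\<^sub>X - D\<^bsub>[X,Y]\<^esub>\<close> vanishes. Expanded by metric compatibility, it
  is minus \<open>\<langle>R\<^bsub>X,Y\<^esub> Z, W\<rangle> + \<langle>Z, R\<^bsub>X,Y\<^esub> W\<rangle>\<close>: the products of first covariant derivatives cancel.\<close>

lemma curvature_skew_last:
  assumes \<xi>: "\<xi> \<in> T x" and \<eta>: "\<eta> \<in> T x" and \<zeta>: "\<zeta> \<in> T x" and \<omega>: "\<omega> \<in> T x"
  shows "christoffel_curvature x \<xi> \<eta> \<zeta> \<bullet> g x \<omega> = - (christoffel_curvature x \<xi> \<eta> \<omega> \<bullet> g x \<zeta>)"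
proof -
  have x: "x \<in> M" by (rule tangent_space_base[OF \<xi>])
  define X Y Z W where "X = (\<lambda>y. P y \<xi>)" "Y = (\<lambda>y. P y \<eta>)" "Z = (\<lambda>y. P y \<zeta>)" "W = (\<lambda>y. P y \<omega>)"
  have vf: "X \<in> VF" "Y \<in> VF" "Z \<in> VF" "W \<in> VF"
    by (simp_all add: X_Y_Z_W_def projected_vector_field)
  have val: "X x = \<xi>" "Y x = \<eta>" "Z x = \<zeta>" "W x = \<omega>"
    by (simp_all add: X_Y_Z_W_def tangent_projection(3)[OF x] assms)
  let ?f = "\<lambda>y. Z y \<bullet> g y (W y)"
  have metric: "D (\<lambda>y. A y \<bullet> g y (B y)) y (C y) = N C A y \<bullet> g y (B y) + A y \<bullet> g y (N C B y)"
    if "A \<in> VF" "B \<in> VF" "C \<in> VF" "y \<in> M" for A B C y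
    by (rule levi_civita_connectionD(2)[OF levi_civita that(3,1,2,4)])
  have sm: "smooth_on M (\<lambda>y. A y \<bullet> g y (B y))" if "A \<in> VF" "B \<in> VF" for A B
    by (intro smooth_intros smooth_metric vector_field_smooth that)
  have second: "D (\<lambda>y. D ?f y (A y)) x (B x) =
      (N B (N A Z) x \<bullet> g x (W x) + N A Z x \<bullet> g x (N B W x)) + (N B Z x \<bullet> g x (N A W x) + Z x \<bullet> g x (N B (N A W) x))"
    if A: "A \<in> VF" and B: "B \<in> VF" for A B
  proof -
    have "D (\<lambda>y. D ?f y (A y)) x (B x) =
        D (\<lambda>y. N A Z y \<bullet> g y (W y) + Z y \<bullet> g y (N A W y)) x (B x)"
      by (rule dir_deriv_cong[OF smooth_on_dir_deriv[OF sm[OF vf(3,4)] A] vector_field_tangent[OF B x]])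
        (rule metric[OF vf(3,4) A])
    also have "\<dots> = D (\<lambda>y. N A Z y \<bullet> g y (W y)) x (B x) + D (\<lambda>y. Z y \<bullet> g y (N A W y)) x (B x)"
      by (intro dir_deriv_add sm connection_vector_field A vf vector_field_tangent[OF B x])
    finally show ?thesis
      by (simp add: metric[OF connection_vector_field[OF A vf(3)] vf(4) B x]
          metric[OF vf(3) connection_vector_field[OF A vf(4)] B x])
  qed
  have "christoffel_curvature x \<xi> \<eta> \<zeta> \<bullet> g x \<omega> + \<zeta> \<bullet> g x (christoffel_curvature x \<xi> \<eta> \<omega>) = 0"
    using dir_deriv_commutator[OF sm[OF vf(3,4)] vf(1,2) x, unfolded second[OF vf(1,2)] second[OF vf(2,1)]
        metric[OF vf(3,4) lie_bracket_vector_field[OF vf(1,2)] x], unfolded val]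
    by (simp add: curvature_vector_fields[OF vf(1-3) x, symmetric, unfolded val]
        curvature_vector_fields[OF vf(1,2,4) x, symmetric, unfolded val]
        val inner_add_left inner_diff_left inner_add_right inner_diff_right blinfun.add_right blinfun.diff_right)
  then show ?thesis by (simp add: metric_commute[OF x, of \<zeta>])
qed

text \<open>Outside the tangent space \<open>\<Gamma>\<close> need not be symmetric, so neither is its derivative; the defect comes
  from the non-tangential parts of the derivatives of the extensions.\<close>

lemma christoffel_derivative_defect:
  assumes \<xi>: "\<xi> \<in> T x" and \<eta>: "\<eta> \<in> T x" and \<zeta>: "\<zeta> \<in> T x"
  shows "D \<Gamma> x \<xi> \<eta> \<zeta> - D \<Gamma> x \<xi> \<zeta> \<eta> =
    (\<Gamma> x (\<Gamma> x \<xi> \<eta>) \<zeta> - \<Gamma> x \<zeta> (\<Gamma> x \<xi> \<eta>)) + (\<Gamma> x \<eta> (\<Gamma> x \<xi> \<zeta>) - \<Gamma> x (\<Gamma> x \<xi> \<zeta>) \<eta>)"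
proof -
  have x: "x \<in> M" by (rule tangent_space_base[OF \<xi>])
  have W: "(\<lambda>y. P y w) \<in> VF" for w by (rule projected_vector_field)
  have sW: "smooth_on M (\<lambda>y. P y w)" for w by (rule vector_field_smooth[OF W])
  have val: "P x \<eta> = \<eta>" "P x \<zeta> = \<zeta>" by (simp_all add: tangent_projection(3)[OF x] assms)
  define a where "a = D (\<lambda>y. P y \<eta>) x \<xi>"
  define b where "b = D (\<lambda>y. P y \<zeta>) x \<xi>"
  have D: "D (\<lambda>y. \<Gamma> y (P y u) (P y w)) x \<xi> = \<Gamma> x (P x u) (D (\<lambda>y. P y w) x \<xi>)
      + (\<Gamma> x (D (\<lambda>y. P y u) x \<xi>) (P x w) + D \<Gamma> x \<xi> (P x u) (P x w))" for u w
    by (subst dir_deriv_apply[OF smooth_on_apply[OF smooth_christoffel sW] sW \<xi>])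
       (simp add: dir_deriv_apply[OF smooth_christoffel sW \<xi>] blinfun.add_left)
  have "D (\<lambda>y. \<Gamma> y (P y \<eta>) (P y \<zeta>)) x \<xi> = D (\<lambda>y. \<Gamma> y (P y \<zeta>) (P y \<eta>)) x \<xi>"
    by (rule dir_deriv_cong[OF _ \<xi> christoffel_symmetric[OF tangent_projection(1) tangent_projection(1)]])
      (intro smooth_on_apply smooth_christoffel sW)
  then have 1: "\<Gamma> x \<eta> b + (\<Gamma> x a \<zeta> + D \<Gamma> x \<xi> \<eta> \<zeta>) = \<Gamma> x \<zeta> a + (\<Gamma> x b \<eta> + D \<Gamma> x \<xi> \<zeta> \<eta>)"
    by (simp add: D val a_def b_def)
  have "a + \<Gamma> x \<xi> \<eta> \<in> T x" "b + \<Gamma> x \<xi> \<zeta> \<in> T x"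
    using christoffel_tangent[OF \<xi> W] val by (metis a_def, metis b_def)
  then have "\<Gamma> x (a + \<Gamma> x \<xi> \<eta>) \<zeta> = \<Gamma> x \<zeta> (a + \<Gamma> x \<xi> \<eta>)" "\<Gamma> x \<eta> (b + \<Gamma> x \<xi> \<zeta>) = \<Gamma> x (b + \<Gamma> x \<xi> \<zeta>) \<eta>"
    using christoffel_symmetric \<eta> \<zeta> by blast+
  then have 2: "\<Gamma> x a \<zeta> = \<Gamma> x \<zeta> a + \<Gamma> x \<zeta> (\<Gamma> x \<xi> \<eta>) - \<Gamma> x (\<Gamma> x \<xi> \<eta>) \<zeta>"
    and 3: "\<Gamma> x \<eta> b = \<Gamma> x b \<eta> + \<Gamma> x (\<Gamma> x \<xi> \<zeta>) \<eta> - \<Gamma> x \<eta> (\<Gamma> x \<xi> \<zeta>)"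
    by (simp_all add: blinfun.add_left blinfun.add_right algebra_simps)
  show ?thesis using 1 unfolding 2 3 by (simp add: algebra_simps)
qed

text \<open>The derivatives of \<open>\<Gamma>\<close> enter the cyclic sum through their alternating parts only, and the defects cancel
  against each other by the symmetry of \<open>\<Gamma>\<close> on tangent vectors.\<close>

lemma curvature_bianchi:
  assumes \<xi>: "\<xi> \<in> T x" and \<eta>: "\<eta> \<in> T x" and \<zeta>: "\<zeta> \<in> T x"
  shows "christoffel_curvature x \<xi> \<eta> \<zeta> + christoffel_curvature x \<eta> \<zeta> \<xi> + christoffel_curvature x \<zeta> \<xi> \<eta> = 0"
proof -
  note D = christoffel_derivative_defect[unfolded diff_eq_eq]
  show ?thesis
    unfolding christoffel_curvature_def D[OF \<xi> \<eta> \<zeta>] D[OF \<eta> \<zeta> \<xi>] D[OF \<zeta> \<xi> \<eta>]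
      christoffel_symmetric[OF \<eta> \<xi>] christoffel_symmetric[OF \<zeta> \<eta>] christoffel_symmetric[OF \<zeta> \<xi>]
    by (simp add: algebra_simps)
qed

text \<open>The classical consequence of both skew-symmetries and the first Bianchi identity: combine the four Bianchi
  identities that omit one of \<open>a\<close>, \<open>b\<close>, \<open>c\<close>, \<open>d\<close> from the cycle.\<close>

lemma curvature_pair_symmetric:
  assumes a: "a \<in> T x" and b: "b \<in> T x" and c: "c \<in> T x" and d: "d \<in> T x"
  shows "christoffel_curvature x a b c \<bullet> g x d = christoffel_curvature x c d a \<bullet> g x b"
proof -
  define R where "R a b c d = christoffel_curvature x a b c \<bullet> g x d" for a b c d
  have bianchi: "R a b c d + R b c a d + R c a b d = 0" if "a \<in> T x" "b \<in> T x" "c \<in> T x" for a b c d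
    using arg_cong[OF curvature_bianchi[OF that], of "\<lambda>v. v \<bullet> g x d"] by (simp add: R_def inner_add_left)
  have skew: "R a b c d = - R b a c d" for a b c d
    using curvature_skew_first[of x b a c] by (simp add: R_def)
  have skew': "R a b c d = - R a b d c" if "a \<in> T x" "b \<in> T x" "c \<in> T x" "d \<in> T x" for a b c d
    unfolding R_def by (rule curvature_skew_last[OF that])
  have "R a b c d = R c d a b"
    using bianchi[OF a b c, of d] bianchi[OF b c d, of a] bianchi[OF c d a, of b] bianchi[OF d a b, of c]
      skew'[OF a b c d] skew'[OF b c d a] skew'[OF c d a b] skew'[OF d a b c] skew'[OF a c b d] skew'[OF b d a c]
      skew[of c a b d] skew[of d b c a] skew[of a c d b] skew[of b d a c] skew[of a b c d] skew[of b c a d]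
      skew[of c d a b] skew[of d a b c] skew[of a b d c] skew[of b c d a] skew[of c d b a] skew[of d a c b]
    by linarith
  then show ?thesis by (simp add: R_def)
qed

end

section \<open>The tangent bundle\<close>

lemma tangent_bundle_iff: "(x, v) \<in> tangent_bundle M \<longleftrightarrow> v \<in> tangent_space M x"
  using tangent_space_base[of v M x] by (auto simp: tangent_bundle_def)

lemma fst_tangent_bundle: "fst ` tangent_bundle M \<subseteq> M"
  by (auto simp: tangent_bundle_def)

text \<open>The tangent map of a chart flattens the bundle: it maps the pairs \<open>(y, u)\<close> with \<open>u \<in> \<psi>' (\<phi> y) ` S\<close> to pairs in
  \<open>S \<times> S\<close>.\<close>

lemma tangent_bundle_chart:
  assumes chart: "submanifold_chart M U V S \<phi> \<psi>"
  shows "submanifold_chart (tangent_bundle M) (U \<times> UNIV) (V \<times> UNIV) (S \<times> S)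
    (\<lambda>p. (\<phi> (fst p), deriv_blinfun \<phi> (fst p) (snd p))) (\<lambda>q. (\<psi> (fst q), deriv_blinfun \<psi> (fst q) (snd q)))"
    (is "submanifold_chart _ _ _ _ ?\<Phi> ?\<Psi>")
proof -
  note op = chart_open[OF chart] and sm = chart_smooth[OF chart] and inv = chart_inverse[OF chart]
    and mem = chart_mem[OF chart] and dinv = chart_deriv_inverse[OF chart]
  have smooth: "smooth_on (A \<times> UNIV) (\<lambda>p. (f (fst p), deriv_blinfun f (fst p) (snd p)))"
    if "open A" "smooth_on A f" for A and f :: "'a \<Rightarrow> 'a"
  proof -
    have "fst ` (A \<times> (UNIV :: 'a set)) \<subseteq> A" by auto
    note c = smooth_on_compose[OF _ smooth_on_fst[OF smooth_on_ident] this]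
    show ?thesis
      by (intro smooth_intros c[OF that(2)] c[OF smooth_on_deriv_blinfun[OF that]])
  qed
  have s1: "smooth_on (U \<times> UNIV) ?\<Phi>" and s2: "smooth_on (V \<times> UNIV) ?\<Psi>"
    by (rule smooth[OF op(1) sm(1)], rule smooth[OF op(2) sm(2)])
  have o: "open (U \<times> (UNIV :: 'a set))" "open (V \<times> (UNIV :: 'a set))" using op by (auto intro: open_Times)
  have i1: "?\<Psi> (?\<Phi> p) = p" and m1: "?\<Phi> p \<in> V \<times> UNIV" if "p \<in> U \<times> UNIV" for p
    using that by (auto simp: inv(1) dinv(1) mem(1))
  have i2: "?\<Phi> (?\<Psi> q) = q" and m2: "?\<Psi> q \<in> U \<times> UNIV" if "q \<in> V \<times> UNIV" for q
    using that by (auto simp: inv(2) dinv(2) mem(2))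
  have "homeomorphism (U \<times> UNIV) (V \<times> UNIV) ?\<Phi> ?\<Psi>"
  proof (rule homeomorphismI)
    show "continuous_on (U \<times> UNIV) ?\<Phi>" "continuous_on (V \<times> UNIV) ?\<Psi>"
      by (rule smooth_on_imp_continuous_on[OF s1 o(1)], rule smooth_on_imp_continuous_on[OF s2 o(2)])
    show "?\<Phi> ` (U \<times> UNIV) \<subseteq> V \<times> UNIV" using m1 by (rule image_subsetI)
    show "?\<Psi> ` (V \<times> UNIV) \<subseteq> U \<times> UNIV" using m2 by (rule image_subsetI)
  qed (rule i1, assumption, rule i2, assumption)
  moreover have "?\<Phi> ` (U \<times> UNIV \<inter> tangent_bundle M) = V \<times> UNIV \<inter> S \<times> S"
  proof (intro equalityI subsetI)
    fix q assume "q \<in> ?\<Phi> ` (U \<times> UNIV \<inter> tangent_bundle M)"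
    then obtain y u where y: "y \<in> U" "y \<in> M" "u \<in> tangent_space M y" and q: "q = (\<phi> y, deriv_blinfun \<phi> y u)"
      by (auto simp: tangent_bundle_def)
    obtain w where "w \<in> S" "u = deriv_blinfun \<psi> (\<phi> y) w"
      using y(3) unfolding chart_tangent_space[OF chart y(1,2)] by blast
    then have "deriv_blinfun \<phi> y u = w" using dinv(2)[OF mem(1)[OF y(1)], of w] by (simp add: inv(1)[OF y(1)])
    then show "q \<in> V \<times> UNIV \<inter> S \<times> S"
      using q \<open>w \<in> S\<close> mem(1)[OF y(1)] chart_mem_submanifold(1)[OF chart y(1,2)] by simp
  next
    fix q assume q: "q \<in> V \<times> UNIV \<inter> S \<times> S"
    obtain z w where zw: "q = (z, w)" "z \<in> V" "z \<in> S" "w \<in> S" using q by (cases q) auto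
    have y: "\<psi> z \<in> U" "\<psi> z \<in> M" using mem(2)[OF zw(2)] chart_mem_submanifold(2)[OF chart zw(2,3)] by auto
    have "?\<Psi> q \<in> U \<times> UNIV \<inter> tangent_bundle M"
      using y zw(1,4) by (simp add: tangent_bundle_iff chart_tangent_space[OF chart y] inv(2)[OF zw(2)])
    moreover have "q = ?\<Phi> (?\<Psi> q)" using q by (intro i2[symmetric]) auto
    ultimately show "q \<in> ?\<Phi> ` (U \<times> UNIV \<inter> tangent_bundle M)" by (rule rev_image_eqI)
  qed
  ultimately show ?thesis
    unfolding submanifold_chart_def using o s1 s2 subspace_Times[OF chart_subspace[OF chart] chart_subspace[OF chart]]
    by simp
qed

lemma embedded_submanifold_iff_charts:
  "embedded_submanifold M \<longleftrightarrow> (\<exists>d. \<forall>x\<in>M. \<exists>U V S \<phi> \<psi>. x \<in> U \<and> submanifold_chart M U V S \<phi> \<psi> \<and> dim S = d)"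
  unfolding embedded_submanifold_def submanifold_chart_def by (simp add: conj_ac)

lemma tangent_bundle_embedded:
  assumes "embedded_submanifold M"
  shows "embedded_submanifold (tangent_bundle M)"
proof -
  obtain d where d: "\<forall>x\<in>M. \<exists>U V S \<phi> \<psi>. x \<in> U \<and> submanifold_chart M U V S \<phi> \<psi> \<and> dim S = d"
    using assms unfolding embedded_submanifold_iff_charts by (elim exE)
  show ?thesis
    unfolding embedded_submanifold_iff_charts
  proof (intro exI[of _ "d + d"] ballI)
    fix p assume "p \<in> tangent_bundle M"
    then have "fst p \<in> M" by (auto simp: tangent_bundle_def)
    then obtain U V S \<phi> \<psi> where x: "fst p \<in> U" and chart: "submanifold_chart M U V S \<phi> \<psi>" and dim: "dim S = d"
      using d by blast
    have "dim (S \<times> S) = d + d" using dim_Times[OF chart_subspace[OF chart] chart_subspace[OF chart]] dim by simp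
    moreover have "p \<in> U \<times> UNIV" using x by (cases p) simp
    ultimately show "\<exists>U V S \<phi> \<psi>. p \<in> U \<and> submanifold_chart (tangent_bundle M) U V S \<phi> \<psi> \<and> dim S = d + d"
      using tangent_bundle_chart[OF chart] by (intro exI conjI)
  qed
qed

lemma smooth_on_tangent_bundle:
  assumes "smooth_on M f"
  shows "smooth_on (tangent_bundle M) (\<lambda>p. f (fst p))"
  by (rule smooth_on_compose[OF assms smooth_on_fst[OF smooth_on_ident] fst_tangent_bundle])

lemma tangent_bundle_tangent_fst:
  assumes "\<xi> \<in> tangent_space (tangent_bundle M) p"
  shows "fst \<xi> \<in> tangent_space M (fst p)"
    and "dir_deriv (tangent_bundle M) fst p \<xi> = fst \<xi>"
    and "dir_deriv (tangent_bundle M) snd p \<xi> = snd \<xi>"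
proof -
  note D = bounded_linear.dir_deriv[OF _ smooth_on_ident assms] 
  show D1: "dir_deriv (tangent_bundle M) fst p \<xi> = fst \<xi>"
    and "dir_deriv (tangent_bundle M) snd p \<xi> = snd \<xi>"
    using D[OF bounded_linear_fst] D[OF bounded_linear_snd] by (simp_all add: dir_deriv_ident[OF assms])
  show "fst \<xi> \<in> tangent_space M (fst p)"
    using dir_deriv_in_tangent_space[OF smooth_on_fst[OF smooth_on_ident] fst_tangent_bundle assms] D1 by simp
qed

lemma dir_deriv_tangent_bundle:
  assumes "smooth_on M f" "\<xi> \<in> tangent_space (tangent_bundle M) p"
  shows "dir_deriv (tangent_bundle M) (\<lambda>q. f (fst q)) p \<xi> = dir_deriv M f (fst p) (fst \<xi>)"
  using dir_deriv_compose[OF assms(1) smooth_on_fst[OF smooth_on_ident] fst_tangent_bundle assms(2)]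
  by (simp add: tangent_bundle_tangent_fst(2)[OF assms(2)])

context levi_civita
begin

abbreviation "TM \<equiv> tangent_bundle M"

text \<open>A tangent vector \<open>(\<delta>, \<tau>)\<close> of the bundle is the velocity of a curve \<open>(c, w)\<close> with \<open>w = P w\<close>; so
  \<open>\<tau> = (D\<^sub>\<delta> P) v + P \<tau>\<close>, and \<open>(D\<^sub>\<delta> P) v\<close> equals \<open>- \<Gamma>(\<delta>, v)\<close> up to a tangent vector of \<open>M\<close>.\<close>

lemma projection_derivative_christoffel:
  assumes "\<xi> \<in> T x" "v \<in> T x"
  shows "D P x \<xi> v + \<Gamma> x \<xi> v \<in> T x"
  using christoffel_tangent[OF assms(1) projected_vector_field, of v] tangent_space_base[OF assms(1)]
  by (simp add: dir_deriv_apply_const[OF smooth_tangent_projection assms(1)] tangent_projection(3) assms(2))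

lemma tangent_bundle_tangent_iff:
  assumes x: "x \<in> M" and v: "v \<in> T x"
  shows "\<xi> \<in> tangent_space TM (x, v) \<longleftrightarrow> fst \<xi> \<in> T x \<and> snd \<xi> + \<Gamma> x (fst \<xi>) v \<in> T x"
proof
  assume \<xi>: "\<xi> \<in> tangent_space TM (x, v)"
  have m: "fst \<xi> \<in> T x" using tangent_bundle_tangent_fst(1)[OF \<xi>] by simp
  have "snd \<xi> = dir_deriv TM snd (x, v) \<xi>" by (simp add: tangent_bundle_tangent_fst(3)[OF \<xi>])
  also have "\<dots> = dir_deriv TM (\<lambda>p. P (fst p) (snd p)) (x, v) \<xi>"
    by (rule dir_deriv_cong[OF smooth_on_snd[OF smooth_on_ident] \<xi>])
       (auto simp: tangent_bundle_def tangent_projection(3))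
  also have "\<dots> = P x (snd \<xi>) + D P x (fst \<xi>) v"
    by (subst dir_deriv_apply[OF smooth_on_tangent_bundle[OF smooth_tangent_projection] smooth_on_snd[OF smooth_on_ident] \<xi>])
       (simp add: tangent_bundle_tangent_fst(3)[OF \<xi>] dir_deriv_tangent_bundle[OF smooth_tangent_projection \<xi>])
  finally have "snd \<xi> + \<Gamma> x (fst \<xi>) v = P x (snd \<xi>) + (D P x (fst \<xi>) v + \<Gamma> x (fst \<xi>) v)" by simp
  also have "\<dots> \<in> T x"
    by (intro subspace_add[OF T_subspace[OF x]] tangent_projection(1)[OF x] projection_derivative_christoffel m v)
  finally show "fst \<xi> \<in> T x \<and> snd \<xi> + \<Gamma> x (fst \<xi>) v \<in> T x" using m by simp
next
  assume "fst \<xi> \<in> T x \<and> snd \<xi> + \<Gamma> x (fst \<xi>) v \<in> T x"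
  then have m: "fst \<xi> \<in> T x" and t: "snd \<xi> + \<Gamma> x (fst \<xi>) v \<in> T x" by auto
  obtain c e where c: "0 < e" "smooth_on {-e<..<e} c" "c ` {-e<..<e} \<subseteq> M" "c 0 = x"
    "(c has_vector_derivative fst \<xi>) (at 0)" using m by (rule tangent_spaceE)
  define z where "z = snd \<xi> - D P x (fst \<xi>) v"
  have "z = (snd \<xi> + \<Gamma> x (fst \<xi>) v) - (D P x (fst \<xi>) v + \<Gamma> x (fst \<xi>) v)" by (simp add: z_def)
  also have "\<dots> \<in> T x"
    by (rule subspace_diff[OF T_subspace[OF x] t projection_derivative_christoffel[OF m v]])
  finally have z: "P x z = z" by (rule tangent_projection(3)[OF x])
  \<comment> \<open>The velocity of \<open>P (c t) (v + t z)\<close> is \<open>(D\<^sub>\<delta> P) v + P z\<close>, which is \<open>snd \<xi>\<close> for this tangent vector \<open>z\<close>.\<close>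
  let ?w = "\<lambda>t. P (c t) (v + t *\<^sub>R z)"
  have Pc: "((\<lambda>t. P (c t)) has_vector_derivative D P x (fst \<xi>)) (at 0)"
    by (rule dir_deriv_along_curve[OF smooth_tangent_projection x c(1,3-5)])
  have "((\<lambda>t. v + t *\<^sub>R z) has_vector_derivative z) (at 0)"
    by (auto intro!: derivative_eq_intros)
  from bounded_bilinear.has_vector_derivative[OF bounded_bilinear_blinfun_apply Pc this]
  have w': "(?w has_vector_derivative snd \<xi>) (at 0)"
    by (simp add: c(4) z) (simp add: z_def)
  show "\<xi> \<in> tangent_space TM (x, v)"
  proof (rule tangent_spaceI[OF c(1), of "\<lambda>t. (c t, ?w t)"])
    show "smooth_on {-e<..<e} (\<lambda>t. (c t, ?w t))"
      by (intro smooth_intros c(2) smooth_on_compose[OF smooth_tangent_projection c(2,3)])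
    show "(\<lambda>t. (c t, ?w t)) ` {-e<..<e} \<subseteq> TM"
      using c(3) tangent_projection(1) by (auto simp: tangent_bundle_def)
    show "((\<lambda>t. (c t, ?w t)) has_vector_derivative \<xi>) (at 0)"
      using has_vector_derivative_Pair[OF c(5) w'] by simp
  qed (simp add: c tangent_projection(3)[OF x v])
qed

text \<open>The horizontal lift of \<open>H\<close> plus the vertical lift of \<open>V\<close>. Every tangent vector of the bundle is a value of such a
  field.\<close>

definition lift_field :: "('a \<Rightarrow> 'a) \<Rightarrow> ('a \<Rightarrow> 'a) \<Rightarrow> 'a \<times> 'a \<Rightarrow> 'a \<times> 'a" where
  "lift_field H V p = (H (fst p), V (fst p) - \<Gamma> (fst p) (H (fst p)) (snd p))"

lemma lift_field_vector_field:
  assumes "H \<in> VF" "V \<in> VF"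
  shows "lift_field H V \<in> vector_fields TM"
proof -
  have "smooth_on TM (lift_field H V)"
    unfolding lift_field_def
    by (intro smooth_intros smooth_on_tangent_bundle vector_field_smooth assms smooth_christoffel)
  moreover have "lift_field H V p \<in> tangent_space TM p" if "p \<in> TM" for p
  proof -
    from that obtain x v where p: "p = (x, v)" "x \<in> M" "v \<in> T x" by (auto simp: tangent_bundle_def)
    show ?thesis
      unfolding p(1) tangent_bundle_tangent_iff[OF p(2,3)]
      using vector_field_tangent[OF assms(1) p(2)] vector_field_tangent[OF assms(2) p(2)]
      by (simp add: lift_field_def)
  qed
  ultimately show ?thesis by (simp add: vector_fields_def)
qed

lemma dir_deriv_lift_field:
  assumes H: "H \<in> VF" and V: "V \<in> VF" and \<xi>: "\<xi> \<in> tangent_space TM (x, v)"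
  shows "dir_deriv TM (lift_field H V) (x, v) \<xi> = (D H x (fst \<xi>),
    D V x (fst \<xi>) - (\<Gamma> x (H x) (snd \<xi>) + (\<Gamma> x (D H x (fst \<xi>)) v + D \<Gamma> x (fst \<xi>) (H x) v)))"
proof -
  note sH = smooth_on_tangent_bundle[OF vector_field_smooth[OF H]]
    and sV = smooth_on_tangent_bundle[OF vector_field_smooth[OF V]]
    and s\<Gamma> = smooth_on_tangent_bundle[OF smooth_christoffel]
    and ss = smooth_on_snd[OF smooth_on_ident]
  note D = dir_deriv_tangent_bundle[OF _ \<xi>]
  have "dir_deriv TM (\<lambda>p. \<Gamma> (fst p) (H (fst p)) (snd p)) (x, v) \<xi> =
      \<Gamma> x (H x) (snd \<xi>) + (\<Gamma> x (D H x (fst \<xi>)) v + D \<Gamma> x (fst \<xi>) (H x) v)"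
    by (subst dir_deriv_apply[OF smooth_on_apply[OF s\<Gamma> sH] ss \<xi>])
       (simp add: dir_deriv_apply[OF s\<Gamma> sH \<xi>] D[OF smooth_christoffel] D[OF vector_field_smooth[OF H]]
         tangent_bundle_tangent_fst(3)[OF \<xi>] blinfun.add_left)
  then have "dir_deriv TM (\<lambda>p. V (fst p) - \<Gamma> (fst p) (H (fst p)) (snd p)) (x, v) \<xi> = D V x (fst \<xi>) -
      (\<Gamma> x (H x) (snd \<xi>) + (\<Gamma> x (D H x (fst \<xi>)) v + D \<Gamma> x (fst \<xi>) (H x) v))"
    by (simp add: dir_deriv_diff[OF sV smooth_on_apply[OF smooth_on_apply[OF s\<Gamma> sH] ss] \<xi>] D[OF vector_field_smooth[OF V]])
  then show ?thesis
    unfolding lift_field_def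
    by (simp add: dir_deriv_Pair[OF sH smooth_on_diff[OF sV smooth_on_apply[OF smooth_on_apply[OF s\<Gamma> sH] ss]] \<xi>]
        D[OF vector_field_smooth[OF H]])
qed

text \<open>Metric compatibility along the bundle: the covariant derivative of the tautological section \<open>snd\<close> is the
  connection map.\<close>

lemma dir_deriv_bundle_metric:
  assumes \<xi>: "\<xi> \<in> tangent_space TM (x, v)" and A: "smooth_on TM A" "A (x, v) \<in> T x" and B: "smooth_on TM B" "B (x, v) \<in> T x"
  shows "dir_deriv TM (\<lambda>p. A p \<bullet> g (fst p) (B p)) (x, v) \<xi> =
    (dir_deriv TM A (x, v) \<xi> + \<Gamma> x (fst \<xi>) (A (x, v))) \<bullet> g x (B (x, v))
    + A (x, v) \<bullet> g x (dir_deriv TM B (x, v) \<xi> + \<Gamma> x (fst \<xi>) (B (x, v)))"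
proof -
  have m: "fst \<xi> \<in> T x" using tangent_bundle_tangent_fst(1)[OF \<xi>] by simp
  note sg = smooth_on_tangent_bundle[OF smooth_metric]
  have "dir_deriv TM (\<lambda>p. A p \<bullet> g (fst p) (B p)) (x, v) \<xi> = dir_deriv TM A (x, v) \<xi> \<bullet> g x (B (x, v)) +
      A (x, v) \<bullet> D g x (fst \<xi>) (B (x, v)) + A (x, v) \<bullet> g x (dir_deriv TM B (x, v) \<xi>)"
    by (subst dir_deriv_inner[OF A(1) smooth_on_apply[OF sg B(1)] \<xi>])
       (simp add: dir_deriv_apply[OF sg B(1) \<xi>] dir_deriv_tangent_bundle[OF smooth_metric \<xi>] inner_add_right)
  then show ?thesis
    using levi_civita_formD(2)[OF christoffel_form[OF tangent_space_base[OF m]] m A(2) B(2)]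
    by (simp add: inner_add_left inner_add_right blinfun.add_right)
qed

end

section \<open>The bundle metric\<close>

locale bundle_metric = levi_civita M g N \<Gamma>
  for M :: "'a::euclidean_space set" and g N \<Gamma> +
  fixes \<alpha> \<beta> :: "real \<Rightarrow> real"
  assumes smooth_alpha: "smooth_on {0..} \<alpha>" and alpha_pos: "0 \<le> t \<Longrightarrow> 0 < \<alpha> t"
    and smooth_beta: "smooth_on {0..} \<beta>" and beta_nonneg: "0 \<le> t \<Longrightarrow> 0 \<le> \<beta> t"
begin

abbreviation "gh \<equiv> ghat g \<alpha> \<beta>"
abbreviation "G \<equiv> tangent_bundle_metric \<Gamma> g gh"

lemma norm_sq_nonneg: "x \<in> M \<Longrightarrow> 0 \<le> norm_sq g (x, v)"
  by (simp add: norm_sq_def spd_nonneg[OF spd])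

lemma ghat_inner:
  "\<eta> \<bullet> gh (x, v) \<omega> = \<alpha> (norm_sq g (x, v)) * (\<eta> \<bullet> g x \<omega>) + \<beta> (norm_sq g (x, v)) * (v \<bullet> g x \<omega>) * (\<eta> \<bullet> g x v)"
  by (simp add: ghat_apply inner_add_right)

lemma ghat_spd:
  assumes x: "x \<in> M"
  shows "self_adjoint_pos_def (gh (x, v))"
  unfolding self_adjoint_pos_def_def
proof (intro conjI allI impI)
  note n = norm_sq_nonneg[OF x, of v]
  show "gh (x, v) \<xi> \<bullet> \<eta> = \<xi> \<bullet> gh (x, v) \<eta>" for \<xi> \<eta>
    unfolding inner_commute[of _ \<eta>] ghat_inner
    using metric_commute[OF x, of \<eta> \<xi>] metric_commute[OF x, of v] by (simp add: mult.commute mult.left_commute)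
  show "0 < \<xi> \<bullet> gh (x, v) \<xi>" if "\<xi> \<noteq> 0" for \<xi>
  proof -
    have "0 < \<alpha> (norm_sq g (x, v)) * (\<xi> \<bullet> g x \<xi>)"
      using spd[OF x] that alpha_pos[OF n] by (simp add: self_adjoint_pos_def_def)
    moreover have "0 \<le> \<beta> (norm_sq g (x, v)) * (v \<bullet> g x \<xi>) * (\<xi> \<bullet> g x v)"
      using beta_nonneg[OF n] by (simp add: metric_commute[OF x, of \<xi>] mult.assoc)
    ultimately show ?thesis by (simp add: ghat_inner)
  qed
qed

text \<open>The rank-one part of \<open>gh\<close> has range spanned by \<open>g v\<close> with \<open>v\<close> tangent, so it does not change which
  vectors are normal to the tangent space.\<close>

lemma ghat_metric_projection:
  assumes x: "x \<in> M" and v: "v \<in> T x"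
  shows "is_metric_projection (gh (x, v)) (T x) (metric_projection (g x) (T x))"
proof -
  have p: "is_metric_projection (g x) (T x) (metric_projection (g x) (T x))"
    by (rule metric_projection_exists[OF spd[OF x] T_subspace[OF x]])
  then show ?thesis
    unfolding is_metric_projection_def using v by (simp add: ghat_inner)
qed

lemma ghat_bij: "x \<in> M \<Longrightarrow> bij (blinfun_apply (gh (x, v)))"
  by (rule blinfun_inj_imp_bij[OF spd_inj[OF ghat_spd]])

lemma ghat_inverse:
  assumes x: "x \<in> M"
  shows "inv (blinfun_apply (gh (x, v))) \<omega> =
    (1 / \<alpha> (norm_sq g (x, v))) *\<^sub>R inv (blinfun_apply (g x)) \<omega>
    - (\<beta> (norm_sq g (x, v)) / (\<alpha> (norm_sq g (x, v)) * (\<alpha> (norm_sq g (x, v)) + \<beta> (norm_sq g (x, v)) * norm_sq g (x, v)))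
        * (v \<bullet> \<omega>)) *\<^sub>R v"
proof -
  define s a b where "s = norm_sq g (x, v)" "a = \<alpha> s" "b = \<beta> s"
  have s: "s = v \<bullet> g x v" by (simp add: s_a_b_def norm_sq_def)
  have a: "a > 0" and b: "b \<ge> 0" and s0: "s \<ge> 0"
    using norm_sq_nonneg[OF x, of v] alpha_pos beta_nonneg by (simp_all add: s_a_b_def)
  then have ab: "a + b * s > 0" by (simp add: add_pos_nonneg)
  define u where "u = inv (blinfun_apply (g x)) \<omega>"
  have u: "g x u = \<omega>"
    using inv_blinfun(1,3)[OF spd_inj[OF spd[OF x]]] by (simp add: u_def)
  define k where "k = b / (a * (a + b * s)) * (v \<bullet> \<omega>)"
  have "b / (a * c) * (v \<bullet> \<omega>) * c = b / a * (v \<bullet> \<omega>)" if "c > 0" for c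
    using a that by (simp add: field_simps)
  from this[OF ab] have k: "k * (a + b * s) = b / a * (v \<bullet> \<omega>)" by (simp only: k_def)
  let ?r = "(1 / a) *\<^sub>R u - k *\<^sub>R v"
  have "gh (x, v) ?r = \<omega> + (b / a * (v \<bullet> \<omega>) - k * (a + b * s)) *\<^sub>R g x v"
    using a
    by (simp add: ghat_apply s_a_b_def(1)[symmetric] s_a_b_def(2,3)[symmetric] blinfun.diff_right blinfun.scaleR_right u
        inner_diff_right s[symmetric]) (simp add: algebra_simps)
  also have "\<dots> = \<omega>" by (simp add: k)
  finally have "gh (x, v) ?r = \<omega>" .
  then have "inv (blinfun_apply (gh (x, v))) \<omega> = ?r"
    using spd_inj[OF ghat_spd[OF x]] by (metis inv_f_f)
  then show ?thesis by (simp add: s_a_b_def u_def k_def)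
qed

text \<open>In the splitting into horizontal and vertical parts the metric \<open>G\<close> is block diagonal.\<close>

lemma bundle_metric_inner:
  "\<eta> \<bullet> G (x, v) \<omega> =
    fst \<eta> \<bullet> g x (fst \<omega>) + (snd \<eta> + \<Gamma> x (fst \<eta>) v) \<bullet> gh (x, v) (snd \<omega> + \<Gamma> x (fst \<omega>) v)"
proof -
  have "G (x, v) \<omega> = (g x (fst \<omega>) + adjoint_operator (christoffel_at \<Gamma> (x, v)) (gh (x, v) (snd \<omega> + \<Gamma> x (fst \<omega>) v)),
      gh (x, v) (snd \<omega> + \<Gamma> x (fst \<omega>) v))"
    by (simp add: tangent_bundle_metric_def block_operator_apply christoffel_at_apply add.commute)
  then show ?thesis
    by (simp add: inner_prod_def inner_add_left inner_add_right adjoint_operator_apply christoffel_at_apply)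
qed

lemma bundle_metric_spd:
  assumes "x \<in> M"
  shows "self_adjoint_pos_def (G (x, v))"
  unfolding self_adjoint_pos_def_def
proof (intro conjI allI impI)
  note h = ghat_spd[OF assms, of v]
  show "G (x, v) \<xi> \<bullet> \<eta> = \<xi> \<bullet> G (x, v) \<eta>" for \<xi> \<eta>
    unfolding inner_commute[of _ \<eta>] bundle_metric_inner
    using metric_commute[OF assms, of "fst \<eta>" "fst \<xi>"]
      spd_symmetric[OF h, of "snd \<eta> + \<Gamma> x (fst \<eta>) v" "snd \<xi> + \<Gamma> x (fst \<xi>) v"] by simp
  show "0 < \<xi> \<bullet> G (x, v) \<xi>" if "\<xi> \<noteq> 0" for \<xi>
  proof -
    have 1: "0 \<le> fst \<xi> \<bullet> g x (fst \<xi>)" by (rule spd_nonneg[OF spd[OF assms]])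
    have 2: "0 \<le> (snd \<xi> + \<Gamma> x (fst \<xi>) v) \<bullet> gh (x, v) (snd \<xi> + \<Gamma> x (fst \<xi>) v)" by (rule spd_nonneg[OF h])
    have "\<xi> \<bullet> G (x, v) \<xi> \<noteq> 0"
    proof
      assume "\<xi> \<bullet> G (x, v) \<xi> = 0"
      then have "fst \<xi> \<bullet> g x (fst \<xi>) = 0"
        and 3: "(snd \<xi> + \<Gamma> x (fst \<xi>) v) \<bullet> gh (x, v) (snd \<xi> + \<Gamma> x (fst \<xi>) v) = 0"
        using 1 2 unfolding bundle_metric_inner by linarith+
      then have "fst \<xi> = 0" by (intro spd_eq_zero[OF spd[OF assms]])
      moreover have "snd \<xi> + \<Gamma> x (fst \<xi>) v = 0" by (rule spd_eq_zero[OF h 3])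
      ultimately show False using that by (simp add: prod_eq_iff blinfun.zero_left blinfun.zero_right)
    qed
    then show ?thesis using 1 2 unfolding bundle_metric_inner by linarith
  qed
qed

lemma smooth_norm_sq: "smooth_on TM (norm_sq g)"
  unfolding norm_sq_def by (intro smooth_intros smooth_on_tangent_bundle smooth_metric)

lemma norm_sq_image: "norm_sq g ` TM \<subseteq> {0..}"
  using norm_sq_nonneg by (auto simp: tangent_bundle_def)

lemma smooth_on_norm_sq: "smooth_on {0..} f \<Longrightarrow> smooth_on TM (\<lambda>p. f (norm_sq g p))"
  by (rule smooth_on_compose[OF _ smooth_norm_sq norm_sq_image])

lemma smooth_ghat: "smooth_on TM gh"
proof (rule smooth_on_blinfunI)
  fix e :: 'a
  have "gh p e = \<alpha> (norm_sq g p) *\<^sub>R g (fst p) e + (\<beta> (norm_sq g p) * (snd p \<bullet> g (fst p) e)) *\<^sub>R g (fst p) (snd p)" for p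
    by (cases p) (simp add: ghat_apply)
  then show "smooth_on TM (\<lambda>p. gh p e)"
    by (simp only:) (intro smooth_intros smooth_on_norm_sq smooth_alpha smooth_beta smooth_on_tangent_bundle smooth_metric)
qed

lemma smooth_bundle_metric: "smooth_on TM G"
proof (rule smooth_on_blinfunI)
  fix e :: "'a \<times> 'a"
  note s\<Gamma> = smooth_on_tangent_bundle[OF smooth_christoffel] and sg = smooth_on_tangent_bundle[OF smooth_metric]
  have "smooth_on TM (christoffel_at \<Gamma>)"
  proof (rule smooth_on_blinfunI)
    fix w :: 'a
    have "christoffel_at \<Gamma> p w = \<Gamma> (fst p) w (snd p)" for p by (cases p) (simp add: christoffel_at_apply)
    then show "smooth_on TM (\<lambda>p. christoffel_at \<Gamma> p w)" by (simp only:) (intro smooth_intros s\<Gamma>)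
  qed
  then show "smooth_on TM (\<lambda>p. G p e)"
    unfolding tangent_bundle_metric_def
    by (simp only: blinfun_apply_blinfun_compose block_operator_apply)
       (intro smooth_intros smooth_on_adjoint_operator sg smooth_ghat)
qed

lemma bundle_ambient_structure: "embedded_ambient_structure TM G"
  unfolding embedded_ambient_structure_def
  using tangent_bundle_embedded[OF embedded] smooth_bundle_metric bundle_metric_spd
  by (auto simp: tangent_bundle_def)

sublocale TM: ambient_structure TM G
  by unfold_locales (rule bundle_ambient_structure)

lemma dir_deriv_norm_sq:
  assumes v: "v \<in> T x" and \<xi>: "\<xi> \<in> TM.T (x, v)"
  shows "TM.D (norm_sq g) (x, v) \<xi> = 2 * (v \<bullet> g x (snd \<xi> + \<Gamma> x (fst \<xi>) v))"
proof -
  note ss = smooth_on_snd[OF smooth_on_ident]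
  have "norm_sq g = (\<lambda>p. snd p \<bullet> g (fst p) (snd p))" by (simp add: norm_sq_def fun_eq_iff)
  then show ?thesis
    using dir_deriv_bundle_metric[OF \<xi> ss _ ss] v metric_commute[OF tangent_space_base[OF v], of _ v]
    by (simp add: tangent_bundle_tangent_fst(3)[OF \<xi>])
qed

lemma dir_deriv_fun_norm_sq:
  fixes f :: "real \<Rightarrow> real"
  assumes f: "smooth_on {0..} f" and v: "v \<in> T x" and \<xi>: "\<xi> \<in> TM.T (x, v)"
  shows "TM.D (\<lambda>p. f (norm_sq g p)) (x, v) \<xi> =
    2 * (v \<bullet> g x (snd \<xi> + \<Gamma> x (fst \<xi>) v)) * vector_derivative f (at (norm_sq g (x, v)) within {0..})"
proof -
  let ?s = "norm_sq g (x, v)"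
  have s: "?s \<in> {0..}" using norm_sq_nonneg[OF tangent_space_base[OF v]] by simp
  have "(f has_vector_derivative vector_derivative f (at ?s within {0..})) (at ?s within {0..})"
    using smooth_on_differentiable[OF f s] by (simp add: vector_derivative_works)
  then have "dir_deriv {0..} f ?s (TM.D (norm_sq g) (x, v) \<xi>) =
      TM.D (norm_sq g) (x, v) \<xi> *\<^sub>R vector_derivative f (at ?s within {0..})"
    unfolding has_vector_derivative_def
    by (rule dir_deriv_eq) (rule dir_deriv_in_tangent_space[OF smooth_norm_sq norm_sq_image \<xi>])
  then show ?thesis
    using dir_deriv_compose[OF f smooth_norm_sq norm_sq_image \<xi>] by (simp add: dir_deriv_norm_sq[OF v \<xi>])
qed

text \<open>Besides the covariant derivatives of \<open>Y\<close> and \<open>Z\<close> there are terms from the dependence of \<open>gh\<close> on \<open>v\<close>. They are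
  linear in \<open>c\<close>, the value of the connection map on \<open>\<xi>\<close>, so they vanish along horizontal lifts.\<close>

lemma dir_deriv_ghat:
  assumes v: "v \<in> T x" and \<xi>: "\<xi> \<in> TM.T (x, v)"
    and Y: "Y \<in> VF" and Z: "Z \<in> VF"
  defines "c \<equiv> snd \<xi> + \<Gamma> x (fst \<xi>) v" and "s \<equiv> norm_sq g (x, v)"
  shows "TM.D (\<lambda>p. Y (fst p) \<bullet> gh p (Z (fst p))) (x, v) \<xi> =
    (D Y x (fst \<xi>) + \<Gamma> x (fst \<xi>) (Y x)) \<bullet> gh (x, v) (Z x)
    + Y x \<bullet> gh (x, v) (D Z x (fst \<xi>) + \<Gamma> x (fst \<xi>) (Z x))
    + 2 * (v \<bullet> g x c) * (vector_derivative \<alpha> (at s within {0..}) * (Y x \<bullet> g x (Z x))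
        + vector_derivative \<beta> (at s within {0..}) * (v \<bullet> g x (Y x)) * (v \<bullet> g x (Z x)))
    + \<beta> s * ((c \<bullet> g x (Y x)) * (v \<bullet> g x (Z x)) + (v \<bullet> g x (Y x)) * (c \<bullet> g x (Z x)))"
proof -
  have x: "x \<in> M" by (rule tangent_space_base[OF v])
  note ss = smooth_on_snd[OF smooth_on_ident] and sg = smooth_on_tangent_bundle[OF smooth_metric]
  have sV: "smooth_on TM (\<lambda>p. V (fst p))" and tV: "V (fst (x, v)) \<in> T x"
    and DV: "TM.D (\<lambda>p. V (fst p)) (x, v) \<xi> = D V x (fst \<xi>)" if "V \<in> VF" for V
    using vector_field_tangent[OF that x] dir_deriv_tangent_bundle[OF vector_field_smooth[OF that] \<xi>]
    by (auto intro: smooth_on_tangent_bundle vector_field_smooth that)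
  have snd: "snd (x, v) \<in> T x" using v by simp
  define m where "m p = Y (fst p) \<bullet> g (fst p) (Z (fst p))" for p :: "'a \<times> 'a"
  define q where "q V p = snd p \<bullet> g (fst p) (V (fst p))" for V and p :: "'a \<times> 'a"
  have sm: "smooth_on TM m" unfolding m_def by (intro smooth_intros sV Y Z sg)
  have sq: "smooth_on TM (q V)" if "V \<in> VF" for V unfolding q_def by (intro smooth_intros sV that sg)
  have Dm: "TM.D m (x, v) \<xi> = (D Y x (fst \<xi>) + \<Gamma> x (fst \<xi>) (Y x)) \<bullet> g x (Z x)
      + Y x \<bullet> g x (D Z x (fst \<xi>) + \<Gamma> x (fst \<xi>) (Z x))"
    unfolding m_def using dir_deriv_bundle_metric[OF \<xi> sV[OF Y] tV[OF Y] sV[OF Z] tV[OF Z]]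
    by (simp add: DV[OF Y] DV[OF Z])
  have Dq: "TM.D (q V) (x, v) \<xi> = c \<bullet> g x (V x) + v \<bullet> g x (D V x (fst \<xi>) + \<Gamma> x (fst \<xi>) (V x))"
    if V: "V \<in> VF" for V
    unfolding q_def using dir_deriv_bundle_metric[OF \<xi> ss snd sV[OF V] tV[OF V]]
    by (simp add: DV[OF V] c_def tangent_bundle_tangent_fst(3)[OF \<xi>])
  note s\<alpha> = smooth_on_norm_sq[OF smooth_alpha] and s\<beta> = smooth_on_norm_sq[OF smooth_beta]
  have "TM.D (\<lambda>p. Y (fst p) \<bullet> gh p (Z (fst p))) (x, v) \<xi> =
      TM.D (\<lambda>p. \<alpha> (norm_sq g p) * m p + \<beta> (norm_sq g p) * (q Y p * q Z p)) (x, v) \<xi>"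
  proof (rule dir_deriv_cong[OF _ \<xi>])
    show "smooth_on TM (\<lambda>p. Y (fst p) \<bullet> gh p (Z (fst p)))" by (intro smooth_intros sV Y Z smooth_ghat)
    fix p assume "p \<in> TM"
    then obtain y u where p: "p = (y, u)" "y \<in> M" by (auto simp: tangent_bundle_def)
    show "Y (fst p) \<bullet> gh p (Z (fst p)) = \<alpha> (norm_sq g p) * m p + \<beta> (norm_sq g p) * (q Y p * q Z p)"
      using metric_commute[OF p(2), of "Y y" u] by (simp add: p(1) ghat_inner m_def q_def)
  qed
  also have "\<dots> = \<alpha> s * TM.D m (x, v) \<xi> + TM.D (\<lambda>p. \<alpha> (norm_sq g p)) (x, v) \<xi> * m (x, v)
      + (\<beta> s * (q Y (x, v) * TM.D (q Z) (x, v) \<xi> + TM.D (q Y) (x, v) \<xi> * q Z (x, v))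
        + TM.D (\<lambda>p. \<beta> (norm_sq g p)) (x, v) \<xi> * (q Y (x, v) * q Z (x, v)))"
    by (simp add: dir_deriv_add[OF smooth_on_mult[OF s\<alpha> sm] smooth_on_mult[OF s\<beta> smooth_on_mult[OF sq[OF Y] sq[OF Z]]] \<xi>]
        dir_deriv_mult[OF s\<alpha> sm \<xi>] dir_deriv_mult[OF s\<beta> smooth_on_mult[OF sq[OF Y] sq[OF Z]] \<xi>]
        dir_deriv_mult[OF sq[OF Y] sq[OF Z] \<xi>] s_def)
  finally show ?thesis
    unfolding Dm Dq[OF Y] Dq[OF Z] dir_deriv_fun_norm_sq[OF smooth_alpha v \<xi>] dir_deriv_fun_norm_sq[OF smooth_beta v \<xi>]
      c_def[symmetric] s_def[symmetric]
    using metric_commute[OF x, of "Y x" v] metric_commute[OF x, of "D Y x (fst \<xi>) + \<Gamma> x (fst \<xi>) (Y x)" v]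
    by (simp add: ghat_inner s_def[symmetric] m_def q_def) (simp add: algebra_simps)
qed

lemma horizontal_lift_tangent:
  assumes "x \<in> M" "v \<in> T x" "\<delta> \<in> T x"
  shows "horizontal_lift \<Gamma> (x, v) \<delta> \<in> TM.T (x, v)"
  using assms T_subspace[OF assms(1)]
  by (simp add: tangent_bundle_tangent_iff horizontal_lift_def subspace_0)

lemma vertical_lift_tangent:
  assumes "x \<in> M" "v \<in> T x" "\<delta> \<in> T x"
  shows "vertical_lift \<delta> \<in> TM.T (x, v)"
  using assms T_subspace[OF assms(1)]
  by (simp add: tangent_bundle_tangent_iff vertical_lift_def subspace_0 blinfun.zero_left blinfun.zero_right)

lemma dir_deriv_ghat_horizontal:
  assumes v: "v \<in> T x" and X: "X \<in> VF" and Y: "Y \<in> VF" and Z: "Z \<in> VF"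
  shows "TM.D (\<lambda>p. (Y \<circ> fst) p \<bullet> gh p ((Z \<circ> fst) p)) (x, v) (horizontal_lift \<Gamma> (x, v) (X x)) =
    N X Y x \<bullet> gh (x, v) (Z x) + Y x \<bullet> gh (x, v) (N X Z x)"
proof -
  have x: "x \<in> M" by (rule tangent_space_base[OF v])
  have "horizontal_lift \<Gamma> (x, v) (X x) \<in> TM.T (x, v)"
    by (rule horizontal_lift_tangent[OF x v vector_field_tangent[OF X x]])
  from dir_deriv_ghat[OF v this Y Z] show ?thesis
    by (simp add: horizontal_lift_def blinfun.zero_right connection_eq[OF X Y x] connection_eq[OF X Z x] comp_def)
qed

end

section \<open>The Christoffel function of the bundle metric\<close>

context bundle_metric
begin

definition vertical_coefficient :: "'a \<Rightarrow> 'a \<Rightarrow> 'a \<Rightarrow> 'a \<Rightarrow> real" where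
  "vertical_coefficient x v c d = (let s = norm_sq g (x, v);
      a' = vector_derivative \<alpha> (at s within {0..}); b' = vector_derivative \<beta> (at s within {0..}) in
    ((\<beta> s - a') * (c \<bullet> g x d) + (b' - 2 * (a' / \<alpha> s) * \<beta> s) * (v \<bullet> g x c) * (v \<bullet> g x d)) / (\<alpha> s + s * \<beta> s))"

definition vertical_part :: "'a \<Rightarrow> 'a \<Rightarrow> 'a \<Rightarrow> 'a \<Rightarrow> 'a" where
  "vertical_part x v c d =
    (vector_derivative \<alpha> (at (norm_sq g (x, v)) within {0..}) / \<alpha> (norm_sq g (x, v))) *\<^sub>R
      ((v \<bullet> g x d) *\<^sub>R c + (v \<bullet> g x c) *\<^sub>R d) + vertical_coefficient x v c d *\<^sub>R v"

lemma vertical_part_symmetric: "x \<in> M \<Longrightarrow> vertical_part x v c d = vertical_part x v d c"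
  using metric_commute[of x c d]
  by (simp add: vertical_part_def vertical_coefficient_def Let_def add.commute mult.commute mult.left_commute)

lemma vertical_part_tangent:
  assumes "x \<in> M" "v \<in> T x" "c \<in> T x" "d \<in> T x"
  shows "vertical_part x v c d \<in> T x"
  unfolding vertical_part_def
  by (intro subspace_add[OF T_subspace[OF assms(1)]] subspace_scale[OF T_subspace[OF assms(1)]] assms)

text \<open>The vertical part compensates for the derivative of \<open>gh\<close> along the fibre. The multiples of \<open>c\<close> and \<open>d\<close> account for
  the derivative of the factor \<open>\<alpha>\<close>. They leave an error with a factor \<open>\<langle>v, d\<rangle>\<close> or \<open>\<langle>v, e\<rangle>\<close>, and pairing \<open>v\<close> with \<open>gh e\<close>
  gives \<open>(\<alpha> + \<beta> \<parallel>v\<parallel>\<^sup>2) \<langle>v, e\<rangle>\<close>; so dividing by \<open>\<alpha> + \<beta> \<parallel>v\<parallel>\<^sup>2\<close> yields the coefficient of \<open>v\<close>.\<close>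

lemma vertical_part_metric:
  fixes c d e v x
  assumes x: "x \<in> M"
  defines "s \<equiv> norm_sq g (x, v)"
  shows "vertical_part x v c d \<bullet> gh (x, v) e + d \<bullet> gh (x, v) (vertical_part x v c e) =
    2 * (v \<bullet> g x c) * (vector_derivative \<alpha> (at s within {0..}) * (d \<bullet> g x e)
        + vector_derivative \<beta> (at s within {0..}) * (v \<bullet> g x d) * (v \<bullet> g x e))
    + \<beta> s * ((c \<bullet> g x d) * (v \<bullet> g x e) + (v \<bullet> g x d) * (c \<bullet> g x e))"
proof -
  define a b where "a = \<alpha> s" "b = \<beta> s"
  define a' b' where "a' = vector_derivative \<alpha> (at s within {0..})" "b' = vector_derivative \<beta> (at s within {0..})"
  define p q1 q2 r1 r2 m where "p = v \<bullet> g x c" "q1 = v \<bullet> g x d" "q2 = v \<bullet> g x e" "r1 = c \<bullet> g x d" "r2 = c \<bullet> g x e" "m = d \<bullet> g x e"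
  define F1 where "F1 = vertical_coefficient x v c d"
  define F2 where "F2 = vertical_coefficient x v c e"
  have s: "s = v \<bullet> g x v" by (simp add: s_def norm_sq_def)
  have s0: "s \<ge> 0" unfolding s_def by (rule norm_sq_nonneg[OF x])
  have a: "a > 0" and ab: "a + s * b > 0"
    using alpha_pos[OF s0] beta_nonneg[OF s0] s0 by (simp_all add: a_b_def add_pos_nonneg)
  note defs = s_def[symmetric] a_b_def[symmetric] a'_b'_def[symmetric] p_q1_q2_r1_r2_m_def[symmetric]
  have F1: "(a + s * b) * F1 = (b - a') * r1 + (b' - 2 * (a' / a) * b) * p * q1"
    and F2: "(a + s * b) * F2 = (b - a') * r2 + (b' - 2 * (a' / a) * b) * p * q2"
    using ab unfolding F1_def F2_def vertical_coefficient_def Let_def defs by simp_all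
  have V1: "vertical_part x v c d = (a' / a) *\<^sub>R (q1 *\<^sub>R c + p *\<^sub>R d) + F1 *\<^sub>R v"
    and V2: "vertical_part x v c e = (a' / a) *\<^sub>R (q2 *\<^sub>R c + p *\<^sub>R e) + F2 *\<^sub>R v"
    unfolding vertical_part_def F1_def F2_def defs by simp_all
  have comm: "d \<bullet> g x c = r1" "e \<bullet> g x c = r2" "c \<bullet> g x v = p" "d \<bullet> g x v = q1" "e \<bullet> g x v = q2" "e \<bullet> g x d = m"
    using metric_commute[OF x] by (simp_all add: p_q1_q2_r1_r2_m_def)
  have L1: "vertical_part x v c d \<bullet> gh (x, v) e =
      a * ((a' / a) * (q1 * r2 + p * m) + F1 * q2) + b * q2 * ((a' / a) * (q1 * p + p * q1) + F1 * s)"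
    unfolding V1 ghat_inner
    by (simp add: inner_add_left defs comm s[symmetric])
  have L2: "d \<bullet> gh (x, v) (vertical_part x v c e) =
      a * ((a' / a) * (q2 * r1 + p * m) + F2 * q1) + b * ((a' / a) * (q2 * p + p * q2) + F2 * s) * q1"
    unfolding V2 ghat_inner
    by (simp add: inner_add_right blinfun.add_right blinfun.scaleR_right defs comm s[symmetric])
  define k where "k = a' / a"
  have k: "a * k = a'" using a by (simp add: k_def)
  have "a * (k * (q1 * r2 + p * m) + F1 * q2) + b * q2 * (k * (q1 * p + p * q1) + F1 * s) +
      (a * (k * (q2 * r1 + p * m) + F2 * q1) + b * (k * (q2 * p + p * q2) + F2 * s) * q1)
    = (a * k) * (q1 * r2 + q2 * r1 + 2 * p * m) + 4 * b * k * p * q1 * q2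
      + ((a + s * b) * F1) * q2 + ((a + s * b) * F2) * q1" by algebra
  also have "\<dots> = 2 * p * (a' * m + b' * q1 * q2) + b * (r1 * q2 + q1 * r2)"
    unfolding F1 F2 k k_def[symmetric] by algebra
  finally show ?thesis unfolding L1 L2 k_def[symmetric] defs .
qed

text \<open>The first components of the two mixed parts of the Christoffel function of \<open>G\<close>, added up.\<close>

definition curvature_part :: "'a \<Rightarrow> 'a \<Rightarrow> 'a \<Rightarrow> 'a \<Rightarrow> 'a \<Rightarrow> 'a \<Rightarrow> 'a" where
  "curvature_part x v \<xi> c \<eta> d =
    - (\<alpha> (norm_sq g (x, v)) / 2) *\<^sub>R (christoffel_curvature x v d \<xi> + christoffel_curvature x v c \<eta>)"

text \<open>The sum of the four parts of the Christoffel function of \<open>G\<close>, with the multiples of \<open>\<Gamma>(_, v)\<close> in the second component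
  collected: the connection map applied to the result is what remains after \<open>- \<Gamma> x h v\<close>.\<close>

definition bundle_christoffel :: "'a \<times> 'a \<Rightarrow> 'a \<times> 'a \<Rightarrow> 'a \<times> 'a \<Rightarrow> 'a \<times> 'a" where
  "bundle_christoffel p \<xi> \<eta> = (let x = fst p; v = snd p; c = connection_map \<Gamma> p \<xi>; d = connection_map \<Gamma> p \<eta>;
      h = \<Gamma> x (fst \<xi>) (fst \<eta>) + curvature_part x v (fst \<xi>) c (fst \<eta>) d in
    (h, - \<Gamma> x h v + D \<Gamma> x (fst \<xi>) (fst \<eta>) v - \<Gamma> x (fst \<eta>) (\<Gamma> x (fst \<xi>) v)
       + (1 / 2) *\<^sub>R christoffel_curvature x (fst \<xi>) (fst \<eta>) v
       + \<Gamma> x (fst \<xi>) d + \<Gamma> x c (fst \<eta>) + vertical_part x v c d))"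

text \<open>The alternating part of \<open>(D\<^sub>\<xi> \<Gamma>)(\<eta>, v) - \<Gamma>(\<eta>, \<Gamma>(\<xi>, v))\<close> is by definition minus half the curvature.\<close>

lemma bundle_christoffel_symmetric:
  assumes v: "v \<in> T x" and \<xi>: "\<xi> \<in> TM.T (x, v)" and \<eta>: "\<eta> \<in> TM.T (x, v)"
  shows "bundle_christoffel (x, v) \<xi> \<eta> = bundle_christoffel (x, v) \<eta> \<xi>"
proof -
  have x: "x \<in> M" by (rule tangent_space_base[OF v])
  define c where "c = connection_map \<Gamma> (x, v) \<xi>"
  define d where "d = connection_map \<Gamma> (x, v) \<eta>"
  have t: "fst \<xi> \<in> T x" "c \<in> T x" "fst \<eta> \<in> T x" "d \<in> T x"
    using \<xi> \<eta> by (simp_all add: tangent_bundle_tangent_iff[OF x v] c_def d_def connection_map_def)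
  have h: "\<Gamma> x (fst \<xi>) (fst \<eta>) + curvature_part x v (fst \<xi>) c (fst \<eta>) d =
      \<Gamma> x (fst \<eta>) (fst \<xi>) + curvature_part x v (fst \<eta>) d (fst \<xi>) c"
    by (simp add: christoffel_symmetric[OF t(1,3)] curvature_part_def add.commute)
  have half: "(1 / 2) *\<^sub>R y + (1 / 2) *\<^sub>R y = y" for y :: 'a by (simp add: scaleR_left_distrib[symmetric])
  have "D \<Gamma> x (fst \<xi>) (fst \<eta>) v - \<Gamma> x (fst \<eta>) (\<Gamma> x (fst \<xi>) v)
       + (1 / 2) *\<^sub>R christoffel_curvature x (fst \<xi>) (fst \<eta>) v
     = D \<Gamma> x (fst \<eta>) (fst \<xi>) v - \<Gamma> x (fst \<xi>) (\<Gamma> x (fst \<eta>) v)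
       - (christoffel_curvature x (fst \<xi>) (fst \<eta>) v - (1 / 2) *\<^sub>R christoffel_curvature x (fst \<xi>) (fst \<eta>) v)"
    by (simp add: christoffel_curvature_def scaleR_right_diff_distrib)
  also have "christoffel_curvature x (fst \<xi>) (fst \<eta>) v - (1 / 2) *\<^sub>R christoffel_curvature x (fst \<xi>) (fst \<eta>) v
      = - ((1 / 2) *\<^sub>R christoffel_curvature x (fst \<eta>) (fst \<xi>) v)"
    using half[of "christoffel_curvature x (fst \<xi>) (fst \<eta>) v"]
    by (simp add: curvature_skew_first[of x "fst \<eta>" "fst \<xi>"] algebra_simps)
  finally have 2: "D \<Gamma> x (fst \<xi>) (fst \<eta>) v - \<Gamma> x (fst \<eta>) (\<Gamma> x (fst \<xi>) v)
       + (1 / 2) *\<^sub>R christoffel_curvature x (fst \<xi>) (fst \<eta>) v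
     = D \<Gamma> x (fst \<eta>) (fst \<xi>) v - \<Gamma> x (fst \<xi>) (\<Gamma> x (fst \<eta>) v)
       + (1 / 2) *\<^sub>R christoffel_curvature x (fst \<eta>) (fst \<xi>) v" by simp
  show ?thesis
    unfolding bundle_christoffel_def Let_def fst_conv snd_conv c_def[symmetric] d_def[symmetric]
    using h arg_cong[OF 2, of "\<lambda>z. - \<Gamma> x (\<Gamma> x (fst \<xi>) (fst \<eta>) + curvature_part x v (fst \<xi>) c (fst \<eta>) d) v + z"]
      christoffel_symmetric[OF t(1,4)] christoffel_symmetric[OF t(2,3)] vertical_part_symmetric[OF x, of v c d]
    by (simp add: algebra_simps)
qed

text \<open>For the extension of \<open>\<eta>\<close> by lifted fields, \<open>D1\<close> and \<open>D2\<close> split its covariant derivative into a horizontal and a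
  vertical part: each is the covariant derivative \<open>cov\<close> in \<open>M\<close> plus tangent correction terms, curvature terms
  \<open>\<tau>\<close> and \<open>\<rho>\<close> and the fibre term \<open>\<nu>\<close>. Tangency is then clear, and metric compatibility reduces to balances
  of curvature terms and of fibre terms.\<close>

lemma bundle_christoffel_form:
  assumes v: "v \<in> T x"
  shows "TM.levi_civita_form (x, v) (bundle_christoffel (x, v))"
proof -
  have x: "x \<in> M" by (rule tangent_space_base[OF v])
  let ?p = "(x, v)"
  let ?C = "connection_map \<Gamma> (x, v)"
  define H where "H \<eta> = (\<lambda>y. P y (fst \<eta>))" for \<eta> :: "'a \<times> 'a"
  define V where "V \<eta> = (\<lambda>y. P y (?C \<eta>))" for \<eta>
  have vf: "H \<eta> \<in> VF" "V \<eta> \<in> VF" for \<eta>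
    by (simp_all add: H_def V_def projected_vector_field)
  have p: "?p \<in> TM" by (rule iffD2[OF tangent_bundle_iff v])
  have t: "fst \<eta> \<in> T x" "?C \<eta> \<in> T x" if "\<eta> \<in> TM.T ?p" for \<eta>
    using that by (simp_all add: tangent_bundle_tangent_iff[OF x v] connection_map_def)
  have val: "H \<eta> x = fst \<eta>" "V \<eta> x = ?C \<eta>" if "\<eta> \<in> TM.T ?p" for \<eta>
    by (simp_all add: H_def V_def tangent_projection(3)[OF x] t[OF that])
  define W where "W \<eta> = lift_field (H \<eta>) (V \<eta>)" for \<eta>
  have W: "W \<eta> \<in> vector_fields TM" for \<eta> unfolding W_def by (rule lift_field_vector_field[OF vf])
  have Wp: "W \<eta> ?p = \<eta>" if "\<eta> \<in> TM.T ?p" for \<eta>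
    by (simp add: W_def lift_field_def val[OF that] connection_map_def)
  define cov where "cov Y \<xi> = D Y x (fst \<xi>) + \<Gamma> x (fst \<xi>) (Y x)" for Y and \<xi> :: "'a \<times> 'a"
  define \<tau> where "\<tau> \<xi> \<eta> = curvature_part x v (fst \<xi>) (?C \<xi>) (fst \<eta>) (?C \<eta>)" for \<xi> \<eta>
  define \<rho> where "\<rho> \<xi> \<eta> = (1 / 2) *\<^sub>R christoffel_curvature x (fst \<xi>) (fst \<eta>) v" for \<xi> \<eta> :: "'a \<times> 'a"
  define \<nu> where "\<nu> \<xi> \<eta> = vertical_part x v (?C \<xi>) (?C \<eta>)" for \<xi> \<eta>
  have D1: "fst (TM.D (W \<eta>) ?p \<xi> + bundle_christoffel ?p \<xi> \<eta>) = cov (H \<eta>) \<xi> + \<tau> \<xi> \<eta>"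
    and D2: "snd (TM.D (W \<eta>) ?p \<xi> + bundle_christoffel ?p \<xi> \<eta>)
        + \<Gamma> x (fst (TM.D (W \<eta>) ?p \<xi> + bundle_christoffel ?p \<xi> \<eta>)) v = cov (V \<eta>) \<xi> + (\<rho> \<xi> \<eta> + \<nu> \<xi> \<eta>)"
    if \<xi>: "\<xi> \<in> TM.T ?p" and \<eta>: "\<eta> \<in> TM.T ?p" for \<xi> \<eta>
  proof -
    note D = dir_deriv_lift_field[OF vf \<xi>, of \<eta> \<eta>, folded W_def, unfolded val[OF \<eta>]]
    show "fst (TM.D (W \<eta>) ?p \<xi> + bundle_christoffel ?p \<xi> \<eta>) = cov (H \<eta>) \<xi> + \<tau> \<xi> \<eta>"
      by (simp add: D bundle_christoffel_def Let_def cov_def \<tau>_def val[OF \<eta>])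
    have "\<Gamma> x (fst \<eta>) (snd \<xi>) + \<Gamma> x (fst \<eta>) (\<Gamma> x (fst \<xi>) v) = \<Gamma> x (?C \<xi>) (fst \<eta>)"
      using christoffel_symmetric[OF t(1)[OF \<eta>] t(2)[OF \<xi>]] by (simp add: connection_map_def blinfun.add_right)
    then show "snd (TM.D (W \<eta>) ?p \<xi> + bundle_christoffel ?p \<xi> \<eta>)
        + \<Gamma> x (fst (TM.D (W \<eta>) ?p \<xi> + bundle_christoffel ?p \<xi> \<eta>)) v = cov (V \<eta>) \<xi> + (\<rho> \<xi> \<eta> + \<nu> \<xi> \<eta>)"
      by (simp add: D bundle_christoffel_def Let_def cov_def \<rho>_def \<nu>_def val[OF \<eta>] blinfun.add_left blinfun.add_right)
        (simp add: algebra_simps)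
  qed
  have covT: "cov Y \<xi> \<in> T x" if "\<xi> \<in> TM.T ?p" "Y \<in> VF" for Y \<xi>
    unfolding cov_def by (rule christoffel_tangent[OF t(1)[OF that(1)] that(2)])
  show ?thesis
  proof (rule TM.levi_civita_formI[OF p W Wp])
    fix \<xi> \<eta> assume \<xi>: "\<xi> \<in> TM.T ?p" and \<eta>: "\<eta> \<in> TM.T ?p"
    show "bundle_christoffel ?p \<xi> \<eta> = bundle_christoffel ?p \<eta> \<xi>"
      by (rule bundle_christoffel_symmetric[OF v \<xi> \<eta>])
    have "\<tau> \<xi> \<eta> \<in> T x" "\<rho> \<xi> \<eta> \<in> T x" "\<nu> \<xi> \<eta> \<in> T x"
      unfolding \<tau>_def \<rho>_def \<nu>_def curvature_part_def
      by (intro subspace_add[OF T_subspace[OF x]] subspace_scale[OF T_subspace[OF x]] curvature_tangent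
          vertical_part_tangent x v t \<xi> \<eta>)+
    then show "TM.D (W \<eta>) ?p \<xi> + bundle_christoffel ?p \<xi> \<eta> \<in> TM.T ?p"
      unfolding tangent_bundle_tangent_iff[OF x v] D2[OF \<xi> \<eta>] unfolding D1[OF \<xi> \<eta>]
      by (intro conjI subspace_add[OF T_subspace[OF x]] covT \<xi> vf)
    fix \<zeta> assume \<zeta>: "\<zeta> \<in> TM.T ?p"
    show "TM.D (\<lambda>y. W \<eta> y \<bullet> G y (W \<zeta> y)) ?p \<xi> =
        (TM.D (W \<eta>) ?p \<xi> + bundle_christoffel ?p \<xi> \<eta>) \<bullet> G ?p \<zeta>
        + \<eta> \<bullet> G ?p (TM.D (W \<zeta>) ?p \<xi> + bundle_christoffel ?p \<xi> \<zeta>)"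
    proof -
      let ?a = "\<alpha> (norm_sq g ?p)"
      have sm: "smooth_on M (\<lambda>y. H \<eta> y \<bullet> g y (H \<zeta> y))"
        by (intro smooth_intros smooth_metric vector_field_smooth vf)
      have sm': "smooth_on TM (\<lambda>q. V \<eta> (fst q) \<bullet> gh q (V \<zeta> (fst q)))"
        by (intro smooth_intros smooth_ghat smooth_on_tangent_bundle vector_field_smooth vf)
      have "(\<lambda>q. W \<eta> q \<bullet> G q (W \<zeta> q)) =
          (\<lambda>q. H \<eta> (fst q) \<bullet> g (fst q) (H \<zeta> (fst q)) + V \<eta> (fst q) \<bullet> gh q (V \<zeta> (fst q)))"
        by (auto simp: W_def lift_field_def bundle_metric_inner)
      then have "TM.D (\<lambda>q. W \<eta> q \<bullet> G q (W \<zeta> q)) ?p \<xi> =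
          D (\<lambda>y. H \<eta> y \<bullet> g y (H \<zeta> y)) x (fst \<xi>) + TM.D (\<lambda>q. V \<eta> (fst q) \<bullet> gh q (V \<zeta> (fst q))) ?p \<xi>"
        by (simp add: dir_deriv_add[OF smooth_on_tangent_bundle[OF sm] sm' \<xi>] dir_deriv_tangent_bundle[OF sm \<xi>])
      also have "D (\<lambda>y. H \<eta> y \<bullet> g y (H \<zeta> y)) x (fst \<xi>) =
          cov (H \<eta>) \<xi> \<bullet> g x (fst \<zeta>) + fst \<eta> \<bullet> g x (cov (H \<zeta>) \<xi>)"
        using levi_civita_form_metric[OF christoffel_form[OF x] vf(1) vf(1) t(1)[OF \<xi>], of \<eta> \<zeta>]
        by (simp add: cov_def val \<eta> \<zeta>)
      also have "TM.D (\<lambda>q. V \<eta> (fst q) \<bullet> gh q (V \<zeta> (fst q))) ?p \<xi> =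
          cov (V \<eta>) \<xi> \<bullet> gh ?p (?C \<zeta>) + ?C \<eta> \<bullet> gh ?p (cov (V \<zeta>) \<xi>)
          + (\<nu> \<xi> \<eta> \<bullet> gh ?p (?C \<zeta>) + ?C \<eta> \<bullet> gh ?p (\<nu> \<xi> \<zeta>))"
        unfolding \<nu>_def vertical_part_metric[OF x]
        using dir_deriv_ghat[OF v \<xi> vf(2) vf(2), of \<eta> \<zeta>]
        by (simp add: cov_def val \<eta> \<zeta> connection_map_def[of \<Gamma> ?p \<xi>])
      finally have L: "TM.D (\<lambda>q. W \<eta> q \<bullet> G q (W \<zeta> q)) ?p \<xi> =
          cov (H \<eta>) \<xi> \<bullet> g x (fst \<zeta>) + fst \<eta> \<bullet> g x (cov (H \<zeta>) \<xi>) +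
          (cov (V \<eta>) \<xi> \<bullet> gh ?p (?C \<zeta>) + ?C \<eta> \<bullet> gh ?p (cov (V \<zeta>) \<xi>)
          + (\<nu> \<xi> \<eta> \<bullet> gh ?p (?C \<zeta>) + ?C \<eta> \<bullet> gh ?p (\<nu> \<xi> \<zeta>)))" .
      have C: "snd w + \<Gamma> x (fst w) v = ?C w" for w by (simp add: connection_map_def)
      have R: "(TM.D (W \<eta>) ?p \<xi> + bundle_christoffel ?p \<xi> \<eta>) \<bullet> G ?p \<zeta>
          + \<eta> \<bullet> G ?p (TM.D (W \<zeta>) ?p \<xi> + bundle_christoffel ?p \<xi> \<zeta>) =
          (cov (H \<eta>) \<xi> + \<tau> \<xi> \<eta>) \<bullet> g x (fst \<zeta>) + (cov (V \<eta>) \<xi> + (\<rho> \<xi> \<eta> + \<nu> \<xi> \<eta>)) \<bullet> gh ?p (?C \<zeta>) +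
          (fst \<eta> \<bullet> g x (cov (H \<zeta>) \<xi> + \<tau> \<xi> \<zeta>) + ?C \<eta> \<bullet> gh ?p (cov (V \<zeta>) \<xi> + (\<rho> \<xi> \<zeta> + \<nu> \<xi> \<zeta>)))"
        unfolding bundle_metric_inner D2[OF \<xi> \<eta>] D2[OF \<xi> \<zeta>] unfolding D1[OF \<xi> \<eta>] D1[OF \<xi> \<zeta>] C by simp
      \<comment> \<open>The terms with \<open>\<rho>\<close> cancel half of those with \<open>\<tau>\<close> by pair symmetry; the other half is skew.\<close>
      have curv: "\<tau> \<xi> \<eta> \<bullet> g x (fst \<zeta>) + fst \<eta> \<bullet> g x (\<tau> \<xi> \<zeta>) + \<rho> \<xi> \<eta> \<bullet> gh ?p (?C \<zeta>) + ?C \<eta> \<bullet> gh ?p (\<rho> \<xi> \<zeta>) = 0"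
      proof -
        let ?R = "christoffel_curvature x"
        have normal: "v \<bullet> g x (?R (fst \<xi>) w v) = 0" if "w \<in> T x" for w
          using curvature_skew_last[OF t(1)[OF \<xi>] that v v] metric_commute[OF x, of v "?R (fst \<xi>) w v"] by simp
        have \<rho>1: "\<rho> \<xi> \<eta> \<bullet> gh ?p (?C \<zeta>) = ?a / 2 * (?R v (?C \<zeta>) (fst \<xi>) \<bullet> g x (fst \<eta>))"
          using normal[OF t(1)[OF \<eta>]] metric_commute[OF x, of "?R (fst \<xi>) (fst \<eta>) v" v]
            curvature_pair_symmetric[OF t(1)[OF \<xi>] t(1)[OF \<eta>] v t(2)[OF \<zeta>]]
          by (simp add: \<rho>_def ghat_inner)
        have \<rho>2: "?C \<eta> \<bullet> gh ?p (\<rho> \<xi> \<zeta>) = ?a / 2 * (?R v (?C \<eta>) (fst \<xi>) \<bullet> g x (fst \<zeta>))"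
          using normal[OF t(1)[OF \<zeta>]] metric_commute[OF x, of "?C \<eta>" "?R (fst \<xi>) (fst \<zeta>) v"]
            curvature_pair_symmetric[OF t(1)[OF \<xi>] t(1)[OF \<zeta>] v t(2)[OF \<eta>]]
          by (simp add: \<rho>_def ghat_inner blinfun.scaleR_right)
        have \<tau>1: "\<tau> \<xi> \<eta> \<bullet> g x (fst \<zeta>) =
            - (?a / 2) * (?R v (?C \<eta>) (fst \<xi>) \<bullet> g x (fst \<zeta>) + ?R v (?C \<xi>) (fst \<eta>) \<bullet> g x (fst \<zeta>))"
          by (simp add: \<tau>_def curvature_part_def inner_add_left)
        have \<tau>2: "fst \<eta> \<bullet> g x (\<tau> \<xi> \<zeta>) =
            - (?a / 2) * (?R v (?C \<zeta>) (fst \<xi>) \<bullet> g x (fst \<eta>) + ?R v (?C \<xi>) (fst \<zeta>) \<bullet> g x (fst \<eta>))"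
          unfolding metric_commute[OF x, of "fst \<eta>"] by (simp add: \<tau>_def curvature_part_def inner_add_left)
        show ?thesis
          unfolding \<rho>1 \<rho>2 \<tau>1 \<tau>2 curvature_skew_last[OF v t(2)[OF \<xi>] t(1)[OF \<eta>] t(1)[OF \<zeta>]]
          by (simp add: algebra_simps)
      qed
      show ?thesis
        unfolding L R using curv by (simp add: inner_add_left inner_add_right blinfun.add_right)
    qed
  qed
qed

lemma bundle_christoffel_unique:
  assumes "levi_civita_connection TM G N'" "christoffel_function TM N' \<Gamma>'"
    and v: "v \<in> T x" and "\<xi> \<in> TM.T (x, v)" "\<eta> \<in> TM.T (x, v)"
  shows "\<Gamma>' (x, v) \<xi> \<eta> = bundle_christoffel (x, v) \<xi> \<eta>"
  by (rule TM.levi_civita_form_unique[OF iffD2[OF tangent_bundle_iff v]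
        TM.christoffel_levi_civita_form[OF assms(1,2) iffD2[OF tangent_bundle_iff v]] bundle_christoffel_form[OF v] assms(4,5)])

end

context bundle_metric
begin

lemma christoffel_curvature_zero:
  assumes "x \<in> M"
  shows "christoffel_curvature x 0 \<eta> \<zeta> = 0" "christoffel_curvature x \<xi> 0 \<zeta> = 0" "christoffel_curvature x \<xi> \<eta> 0 = 0"
  by (simp_all add: christoffel_curvature_def linear_0[OF dir_deriv_linear[OF smooth_christoffel assms]]
      blinfun.zero_left blinfun.zero_right)

lemma vertical_part_zero: "vertical_part x v 0 d = 0" "vertical_part x v c 0 = 0"
  by (simp_all add: vertical_part_def vertical_coefficient_def Let_def blinfun.zero_right)

lemma connection_map_lift: "connection_map \<Gamma> (x, v) (horizontal_lift \<Gamma> (x, v) \<delta>) = 0"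
    "connection_map \<Gamma> (x, v) (vertical_lift \<delta>) = \<delta>"
  by (simp_all add: connection_map_def horizontal_lift_def vertical_lift_def blinfun.zero_left blinfun.zero_right)

lemma fst_lift: "fst (horizontal_lift \<Gamma> (x, v) \<delta>) = \<delta>" "fst (vertical_lift \<delta>) = 0"
  by (simp_all add: horizontal_lift_def vertical_lift_def)

lemma lift_decomposition:
  "horizontal_lift \<Gamma> (x, v) (fst \<xi>) + vertical_lift (connection_map \<Gamma> (x, v) \<xi>) = \<xi>"
  by (simp add: connection_map_def horizontal_lift_def vertical_lift_def)

lemma bundle_christoffel_lifts:
  fixes x v
  assumes x: "x \<in> M"
  defines "h \<equiv> horizontal_lift \<Gamma> (x, v)" and "a \<equiv> \<alpha> (norm_sq g (x, v))" and "R \<equiv> christoffel_curvature x"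
  shows "bundle_christoffel (x, v) (h \<xi>) (h \<eta>) = (\<Gamma> x \<xi> \<eta>, - \<Gamma> x (\<Gamma> x \<xi> \<eta>) v
      + D \<Gamma> x \<xi> \<eta> v - \<Gamma> x \<eta> (\<Gamma> x \<xi> v) + (1 / 2) *\<^sub>R R \<xi> \<eta> v)"
    and "bundle_christoffel (x, v) (h \<xi>) (vertical_lift d) =
      (- (a / 2) *\<^sub>R R v d \<xi>, (a / 2) *\<^sub>R \<Gamma> x (R v d \<xi>) v + \<Gamma> x \<xi> d)"
    and "bundle_christoffel (x, v) (vertical_lift c) (h \<eta>) =
      (- (a / 2) *\<^sub>R R v c \<eta>, (a / 2) *\<^sub>R \<Gamma> x (R v c \<eta>) v + \<Gamma> x c \<eta>)"
    and "bundle_christoffel (x, v) (vertical_lift c) (vertical_lift d) = (0, vertical_part x v c d)"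
  by (simp_all add: bundle_christoffel_def Let_def h_def a_def R_def connection_map_lift fst_lift
      curvature_part_def christoffel_curvature_zero[OF x] vertical_part_zero
      linear_0[OF dir_deriv_linear[OF smooth_christoffel x]]
      blinfun.zero_left blinfun.zero_right blinfun.scaleR_left blinfun.scaleR_right
      blinfun.minus_left blinfun.minus_right)

lemma bundle_christoffel_formulas:
  assumes N': "levi_civita_connection TM G N'" and \<Gamma>': "christoffel_function TM N' \<Gamma>'"
    and x: "x \<in> M" and v: "v \<in> T x"
    and \<xi>: "\<xi> \<in> TM.T (x, v)" and \<eta>: "\<eta> \<in> TM.T (x, v)"
  defines "h \<equiv> \<lambda>\<delta>. horizontal_lift \<Gamma> (x, v) (fst \<delta>)" and "C \<equiv> connection_map \<Gamma> (x, v)"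
    and "R \<equiv> curvature M N x" and "a \<equiv> \<alpha> (norm_sq g (x, v))"
  shows "\<Gamma>' (x, v) \<xi> \<eta> = \<Gamma>' (x, v) (h \<xi>) (h \<eta>) + \<Gamma>' (x, v) (h \<xi>) (vertical_lift (C \<eta>))
        + \<Gamma>' (x, v) (vertical_lift (C \<xi>)) (h \<eta>) + \<Gamma>' (x, v) (vertical_lift (C \<xi>)) (vertical_lift (C \<eta>))" (is ?sum)
    and "\<Gamma>' (x, v) (h \<xi>) (h \<eta>) = (\<Gamma> x (fst \<xi>) (fst \<eta>), - \<Gamma> x (\<Gamma> x (fst \<xi>) (fst \<eta>)) v
        + D \<Gamma> x (fst \<xi>) (fst \<eta>) v - \<Gamma> x (fst \<eta>) (\<Gamma> x (fst \<xi>) v) + (1 / 2) *\<^sub>R R (fst \<xi>) (fst \<eta>) v)" (is ?hh)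
    and "\<Gamma>' (x, v) (h \<xi>) (vertical_lift (C \<eta>)) =
      (- (a / 2) *\<^sub>R R v (C \<eta>) (fst \<xi>), (a / 2) *\<^sub>R \<Gamma> x (R v (C \<eta>) (fst \<xi>)) v + \<Gamma> x (fst \<xi>) (C \<eta>))" (is ?hv)
    and "\<Gamma>' (x, v) (vertical_lift (C \<xi>)) (h \<eta>) =
      (- (a / 2) *\<^sub>R R v (C \<xi>) (fst \<eta>), (a / 2) *\<^sub>R \<Gamma> x (R v (C \<xi>) (fst \<eta>)) v + \<Gamma> x (C \<xi>) (fst \<eta>))" (is ?vh)
    and "\<Gamma>' (x, v) (vertical_lift (C \<xi>)) (vertical_lift (C \<eta>)) = (0, vertical_part x v (C \<xi>) (C \<eta>))" (is ?vv)
proof -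
  have t: "fst \<xi> \<in> T x" "fst \<eta> \<in> T x" "C \<xi> \<in> T x" "C \<eta> \<in> T x"
    using \<xi> \<eta> by (simp_all add: tangent_bundle_tangent_iff[OF x v] C_def connection_map_def)
  have lift: "h \<delta> \<in> TM.T (x, v)" if "fst \<delta> \<in> T x" for \<delta>
    unfolding h_def by (rule horizontal_lift_tangent[OF x v that])
  note vlift = vertical_lift_tangent[OF x v] and u = bundle_christoffel_unique[OF N' \<Gamma>' v]
  note B = bundle_christoffel_lifts[OF x, of v, folded a_def]
  have "\<Gamma>' (x, v) \<xi> \<eta> = \<Gamma>' (x, v) (h \<xi> + vertical_lift (C \<xi>)) (h \<eta> + vertical_lift (C \<eta>))"
    unfolding h_def C_def lift_decomposition ..
  then show ?sum
    by (simp add: blinfun.add_left blinfun.add_right algebra_simps)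
  show ?hh
    unfolding u[OF lift[OF t(1)] lift[OF t(2)]] R_def curvature_eq_christoffel[OF t(1,2) v]
    unfolding h_def by (rule B(1))
  show ?hv
    unfolding u[OF lift[OF t(1)] vlift[OF t(4)]] R_def curvature_eq_christoffel[OF v t(4,1)]
    unfolding h_def by (rule B(2))
  show ?vh
    unfolding u[OF vlift[OF t(3)] lift[OF t(2)]] R_def curvature_eq_christoffel[OF v t(3,2)]
    unfolding h_def by (rule B(3))
  show ?vv
    unfolding u[OF vlift[OF t(3)] vlift[OF t(4)]] by (rule B(4))
qed

end

theorem proposition10:
  fixes M :: "'a::euclidean_space set"
    and g :: "'a \<Rightarrow> 'a \<Rightarrow>\<^sub>L 'a"
    and \<Gamma> :: "'a \<Rightarrow> 'a \<Rightarrow>\<^sub>L 'a \<Rightarrow>\<^sub>L 'a"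
    and N :: "('a \<Rightarrow> 'a) \<Rightarrow> ('a \<Rightarrow> 'a) \<Rightarrow> ('a \<Rightarrow> 'a)"
    and \<alpha> \<beta> :: "real \<Rightarrow> real"
  assumes "embedded_ambient_structure M g"
    and "levi_civita_connection M g N"
    and "christoffel_function M N \<Gamma>"
    and "smooth_on {0..} \<alpha>" and "\<forall>t\<ge>0. 0 < \<alpha> t"
    and "smooth_on {0..} \<beta>" and "\<forall>t\<ge>0. 0 \<le> \<beta> t"
  shows
    "(\<forall>x\<in>M. \<forall>v\<in>tangent_space M x.
        self_adjoint_pos_def (ghat g \<alpha> \<beta> (x, v)) \<and>
        is_metric_projection (ghat g \<alpha> \<beta> (x, v)) (tangent_space M x)
          (metric_projection (g x) (tangent_space M x)))
     \<and>
     (\<forall>x\<in>M. \<forall>v\<in>tangent_space M x.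
        bij (blinfun_apply (ghat g \<alpha> \<beta> (x, v))) \<and>
        (let s = norm_sq g (x, v) in
         \<forall>\<omega>. inv (blinfun_apply (ghat g \<alpha> \<beta> (x, v))) \<omega> =
           (1 / \<alpha> s) *\<^sub>R inv (blinfun_apply (g x)) \<omega>
           - (\<beta> s / (\<alpha> s * (\<alpha> s + \<beta> s * s)) * (v \<bullet> \<omega>)) *\<^sub>R v))
     \<and>
     (\<forall>X\<in>vector_fields M. \<forall>Y\<in>vector_fields M. \<forall>Z\<in>vector_fields M.
        \<forall>x\<in>M. \<forall>v\<in>tangent_space M x.
        dir_deriv (tangent_bundle M) (\<lambda>p. (Y \<circ> fst) p \<bullet> ghat g \<alpha> \<beta> p ((Z \<circ> fst) p))
            (x, v) (horizontal_lift \<Gamma> (x, v) (X x))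
          = N X Y x \<bullet> ghat g \<alpha> \<beta> (x, v) (Z x) + Y x \<bullet> ghat g \<alpha> \<beta> (x, v) (N X Z x))
     \<and>
     (let G = tangent_bundle_metric \<Gamma> g (ghat g \<alpha> \<beta>) in
      (\<exists>N\<^sub>G \<Gamma>\<^sub>G. levi_civita_connection (tangent_bundle M) G N\<^sub>G \<and>
               christoffel_function (tangent_bundle M) N\<^sub>G \<Gamma>\<^sub>G) \<and>
      (\<forall>N\<^sub>G \<Gamma>\<^sub>G.
         levi_civita_connection (tangent_bundle M) G N\<^sub>G \<and>
         christoffel_function (tangent_bundle M) N\<^sub>G \<Gamma>\<^sub>G \<longrightarrow>
         (\<forall>x\<in>M. \<forall>v\<in>tangent_space M x.
          \<forall>\<xi>\<in>tangent_space (tangent_bundle M) (x, v).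
          \<forall>\<eta>\<in>tangent_space (tangent_bundle M) (x, v).
          let \<xi>\<^sub>m = fst \<xi>; \<eta>\<^sub>m = fst \<eta>;
              C\<xi> = connection_map \<Gamma> (x, v) \<xi>; C\<eta> = connection_map \<Gamma> (x, v) \<eta>;
              \<xi>\<^sub>h = horizontal_lift \<Gamma> (x, v) \<xi>\<^sub>m; \<eta>\<^sub>h = horizontal_lift \<Gamma> (x, v) \<eta>\<^sub>m;
              \<xi>\<^sub>v = vertical_lift C\<xi>; \<eta>\<^sub>v = vertical_lift C\<eta>;
              R = curvature M N x;
              s = norm_sq g (x, v);
              a = \<alpha> s; a' = vector_derivative \<alpha> (at s within {0..});
              b = \<beta> s; b' = vector_derivative \<beta> (at s within {0..});
              F = ((b - a') * (C\<xi> \<bullet> g x C\<eta>)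
                   + (b' - 2 * (a' / a) * b) * (v \<bullet> g x C\<xi>) * (v \<bullet> g x C\<eta>)) / (a + s * b)
          in
            \<Gamma>\<^sub>G (x, v) \<xi> \<eta> =
              \<Gamma>\<^sub>G (x, v) \<xi>\<^sub>h \<eta>\<^sub>h + \<Gamma>\<^sub>G (x, v) \<xi>\<^sub>h \<eta>\<^sub>v + \<Gamma>\<^sub>G (x, v) \<xi>\<^sub>v \<eta>\<^sub>h + \<Gamma>\<^sub>G (x, v) \<xi>\<^sub>v \<eta>\<^sub>v \<and>
            \<Gamma>\<^sub>G (x, v) \<xi>\<^sub>h \<eta>\<^sub>h =
              (\<Gamma> x \<xi>\<^sub>m \<eta>\<^sub>m,
               - \<Gamma> x (\<Gamma> x \<xi>\<^sub>m \<eta>\<^sub>m) v + dir_deriv M \<Gamma> x \<xi>\<^sub>m \<eta>\<^sub>m v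
               - \<Gamma> x \<eta>\<^sub>m (\<Gamma> x \<xi>\<^sub>m v) + (1 / 2) *\<^sub>R R \<xi>\<^sub>m \<eta>\<^sub>m v) \<and>
            \<Gamma>\<^sub>G (x, v) \<xi>\<^sub>h \<eta>\<^sub>v =
              (- (a / 2) *\<^sub>R R v C\<eta> \<xi>\<^sub>m,
               (a / 2) *\<^sub>R \<Gamma> x (R v C\<eta> \<xi>\<^sub>m) v + \<Gamma> x \<xi>\<^sub>m C\<eta>) \<and>
            \<Gamma>\<^sub>G (x, v) \<xi>\<^sub>v \<eta>\<^sub>h =
              (- (a / 2) *\<^sub>R R v C\<xi> \<eta>\<^sub>m,
               (a / 2) *\<^sub>R \<Gamma> x (R v C\<xi> \<eta>\<^sub>m) v + \<Gamma> x C\<xi> \<eta>\<^sub>m) \<and>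
            \<Gamma>\<^sub>G (x, v) \<xi>\<^sub>v \<eta>\<^sub>v =
              (0,
               (a' / a) *\<^sub>R ((v \<bullet> g x C\<eta>) *\<^sub>R C\<xi> + (v \<bullet> g x C\<xi>) *\<^sub>R C\<eta>) + F *\<^sub>R v))))"
proof -
  interpret bundle_metric M g N \<Gamma> \<alpha> \<beta>
    by unfold_locales (use assms in auto)
  note formulas = bundle_christoffel_formulas[unfolded vertical_part_def vertical_coefficient_def Let_def]
  show ?thesis
    unfolding Let_def[of "tangent_bundle_metric \<Gamma> g (ghat g \<alpha> \<beta>)"]
  proof (intro conjI ballI allI impI)
    fix x v assume x: "x \<in> M" and v: "v \<in> T x"
    show "self_adjoint_pos_def (gh (x, v))" by (rule ghat_spd[OF x])
    show "is_metric_projection (gh (x, v)) (T x) (metric_projection (g x) (T x))"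
      by (rule ghat_metric_projection[OF x v])
    show "bij (blinfun_apply (gh (x, v)))" by (rule ghat_bij[OF x])
    show "let s = norm_sq g (x, v) in \<forall>\<omega>. inv (blinfun_apply (gh (x, v))) \<omega> =
        (1 / \<alpha> s) *\<^sub>R inv (blinfun_apply (g x)) \<omega> - (\<beta> s / (\<alpha> s * (\<alpha> s + \<beta> s * s)) * (v \<bullet> \<omega>)) *\<^sub>R v"
      unfolding Let_def by (intro allI ghat_inverse[OF x])
  next
    fix X Y Z x v
    assume "X \<in> vector_fields M" "Y \<in> vector_fields M" "Z \<in> vector_fields M" "x \<in> M" "v \<in> T x"
    then show "dir_deriv TM (\<lambda>p. (Y \<circ> fst) p \<bullet> gh p ((Z \<circ> fst) p)) (x, v) (horizontal_lift \<Gamma> (x, v) (X x)) =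
        N X Y x \<bullet> gh (x, v) (Z x) + Y x \<bullet> gh (x, v) (N X Z x)"
      by (intro dir_deriv_ghat_horizontal)
  next
    show "\<exists>N\<^sub>G \<Gamma>\<^sub>G. levi_civita_connection TM G N\<^sub>G \<and> christoffel_function TM N\<^sub>G \<Gamma>\<^sub>G"
      by (rule TM.levi_civita_connection_exists)
  qed (unfold Let_def, elim conjE, intro conjI; rule formulas; assumption)
qed

end
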